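(* Let $\mathfrak{h}$ be a $d$-dimensional complex vector space with a nondegenerate symmetric bilinear form, let $h\in\mathfrak{h}$, write $V=V_{\widehat{\mathfrak{h}}}(1,0)$, and let $\omega'\in\mathrm{Sc}(V,\omega_h)$ with associated linear transformation $\mathcal{A}_{\omega'}:\mathfrak{h}\to\mathfrak{h}$. Then: 1) $\mathrm{Im}\,\mathcal{A}_{\omega'}$ generates a Heisenberg vertex operator algebra $$(V_{\widehat{\mathrm{Im}\,\mathcal{A}_{\omega'}}}(1,0),\omega')=(C_V(\langle\omega_h-\omega'\rangle),\omega'),$$ and $\mathrm{Ker}\,\mathcal{A}_{\omega'}$ generates a Heisenberg vertex operator algebra $$(V_{\widehat{\mathrm{Ker}\,\mathcal{A}_{\omega'}}}(1,0),\omega_h-\omega')=(C_V(\langle\omega'\rangle),\omega_h-\omega').$$ 2) $$(C_V(V_{\widehat{\mathrm{Ker}\,\mathcal{A}_{\omega'}}}(1,0)),\omega')=(V_{\widehat{\mathrm{Im}\,\mathcal{A}_{\omega'}}}(1,0),\omega'),$$ $$(C_V(V_{\widehat{\mathrm{Im}\,\mathcal{A}_{\omega'}}}(1,0)),\omega_h-\omega')=(V_{\widehat{\mathrm{Ker}\,\mathcal{A}_{\omega'}}}(1,0),\omega_h-\omega').$$ 3) $(V,\omega_h)\cong(C_V(\langle\omega'\rangle),\omega_h-\omega')\otimes(C_V(C_V(\langle\omega'\rangle)),\omega')$ as vertex operator algebras.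
   Context: Everything is over $\mathbb{C}$. $\widehat{\mathfrak{h}}=\mathbb{C}[t,t^{-1}]\otimes\mathfrak{h}\oplus\mathbb{C}C$ is the Lie algebra with $C$ central and $[u\otimes t^m,v\otimes t^n]=m\langle u,v\rangle\delta_{m,-n}C$. $V_{\widehat{\mathfrak{h}}}(1,0)=U(\widehat{\mathfrak{h}})\otimes_{U(\widehat{\mathfrak{h}}^{\geq 0})}\mathbb{C}\mathbf{1}$, where $\widehat{\mathfrak{h}}^{\ge 0}=\mathbb{C}[t]\otimes\mathfrak{h}\oplus\mathbb{C}C$ acts on $\mathbb{C}\mathbf{1}$ with $\mathbb{C}[t]\otimes\mathfrak{h}$ acting by $0$ and $C$ by $1$; $u(n)$ is the action of $u\otimes t^n$; it is a vertex algebra with vacuum $\mathbf{1}$ and $Y(u(-1)\mathbf{1},z)=\sum_{n}u(n)z^{-n-1}$. $\mathfrak{h}$ is identified with the weight-one subspace via $u\mapsto u(-1)\mathbf{1}$. Fix an orthonormal basis $h_1,\dots,h_d$ of $\mathfrak{h}$; $\omega_h=\frac12\sum_i h_i(-1)^2\mathbf{1}+h(-2)\mathbf{1}$, a conformal vector. For a vertex operator algebra $(V,\omega)$, $\omega'\in V$ is semi-conformal if it is the conformal vector of a vertex operator subalgebra $U$ (possibly $\omega'\neq\omega$) with $\omega_n|_U=\omega'_n|_U$ for all $n\ge0$; $\mathrm{Sc}(V,\omega)$ is the set of these. For a subset or subalgebra $S\subseteq V$, $\langle S\rangle$ is the vertex subalgebra generated by $S$, and $C_V(S)=\{v\in V\mid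 s_nv=0\ \forall s\in S,\ n\ge0\}$ is the commutant. Any $\omega'\in\mathrm{Sc}(V,\omega_h)$ has weight two, so $\omega'=\sum_{i\le j}a_{ij}h_i(-1)h_j(-1)\mathbf{1}+\sum_ib_ih_i(-2)\mathbf{1}$ uniquely; $A_{\omega'}$ is the symmetric $d\times d$ matrix with diagonal entries $2a_{ii}$ and off-diagonal entries $a_{ij}$ ($i<j$), and $\mathcal{A}_{\omega'}$ is the linear transformation of $\mathfrak{h}$ with matrix $A_{\omega'}$ in the basis $h_1,\dots,h_d$. It is known that $\mathcal{A}_{\omega'}$ is idempotent and self-adjoint, so the form is nondegenerate on both $\mathrm{Im}\,\mathcal{A}_{\omega'}$ and $\mathrm{Ker}\,\mathcal{A}_{\omega'}$. For a subspace $\mathfrak{k}\subseteq\mathfrak{h}$ on which the form is nondegenerate, $V_{\widehat{\mathfrak{k}}}(1,0)$ (the same construction applied to $\mathfrak{k}$) is identified with the vertex subalgebra of $V_{\widehat{\mathfrak{h}}}(1,0)$ generated by $\mathfrak{k}$. *)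

theory Defs
  imports Complex_Main "HOL-Library.Poly_Mapping" "HOL-Library.Product_Plus"
begin

section \<open>Complex vector spaces\<close>

class complex_vector = ab_group_add +
  fixes scaleC :: "complex \<Rightarrow> 'a \<Rightarrow> 'a"  (infixr \<open>*\<^sub>C\<close> 75)
  assumes scaleC_add_right: "a *\<^sub>C (x + y) = a *\<^sub>C x + a *\<^sub>C y"
    and scaleC_add_left: "(a + b) *\<^sub>C x = a *\<^sub>C x + b *\<^sub>C x"
    and scaleC_scaleC: "a *\<^sub>C (b *\<^sub>C x) = (a * b) *\<^sub>C x"
    and scaleC_one: "1 *\<^sub>C x = x"

global_interpretation complex_vector:
  vector_space "scaleC :: complex \<Rightarrow> 'a \<Rightarrow> 'a::complex_vector"
  by unfold_locales (simp_all add: scaleC_add_right scaleC_add_left scaleC_scaleC scaleC_one)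

abbreviation cspan :: "'a::complex_vector set \<Rightarrow> 'a set" where
  "cspan \<equiv> complex_vector.span"

abbreviation csubspace :: "'a::complex_vector set \<Rightarrow> bool" where
  "csubspace \<equiv> complex_vector.subspace"

abbreviation cdim :: "'a::complex_vector set \<Rightarrow> nat" where
  "cdim \<equiv> complex_vector.dim"

definition clinear_on :: "'a::complex_vector set \<Rightarrow> ('a \<Rightarrow> 'b::complex_vector) \<Rightarrow> bool" where
  "clinear_on V f \<longleftrightarrow>
    (\<forall>x\<in>V. \<forall>y\<in>V. f (x + y) = f x + f y) \<and> (\<forall>c. \<forall>x\<in>V. f (c *\<^sub>C x) = c *\<^sub>C f x)"

instantiation complex :: complex_vector
begin
definition scaleC_complex :: "complex \<Rightarrow> complex \<Rightarrow> complex" where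
  "scaleC_complex a x = a * x"
instance by standard (simp_all add: scaleC_complex_def algebra_simps)
end

instantiation prod :: (complex_vector, complex_vector) complex_vector
begin
definition scaleC_prod :: "complex \<Rightarrow> 'a \<times> 'b \<Rightarrow> 'a \<times> 'b" where
  "scaleC_prod a x = (a *\<^sub>C fst x, a *\<^sub>C snd x)"
instance
  by standard
    (simp_all add: scaleC_prod_def prod_eq_iff scaleC_add_right scaleC_add_left scaleC_scaleC scaleC_one)
end

instantiation poly_mapping :: (type, complex_vector) complex_vector
begin
lift_definition scaleC_poly_mapping :: "complex \<Rightarrow> ('a \<Rightarrow>\<^sub>0 'b) \<Rightarrow> ('a \<Rightarrow>\<^sub>0 'b)"
  is "\<lambda>c f k. c *\<^sub>C f k"
proof -
  fix c and f :: "'a \<Rightarrow> 'b"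
  assume "finite {k. f k \<noteq> 0}"
  then show "finite {k. c *\<^sub>C f k \<noteq> 0}"
    by (rule rev_finite_subset) auto
qed
instance
  by standard (transfer, simp add: scaleC_add_right scaleC_add_left scaleC_scaleC scaleC_one)+
end


section \<open>Tensor products of complex vector spaces\<close>

definition tensor_relators :: "(('a::complex_vector \<times> 'b::complex_vector) \<Rightarrow>\<^sub>0 complex) set" where
  "tensor_relators =
     {Poly_Mapping.single (a + a', b) 1 - Poly_Mapping.single (a, b) 1 - Poly_Mapping.single (a', b) 1
        | a a' b. True}
   \<union> {Poly_Mapping.single (a, b + b') 1 - Poly_Mapping.single (a, b) 1 - Poly_Mapping.single (a, b') 1
        | a b b'. True}
   \<union> {Poly_Mapping.single (c *\<^sub>C a, b) 1 - c *\<^sub>C Poly_Mapping.single (a, b) 1 | c a b. True}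
   \<union> {Poly_Mapping.single (a, c *\<^sub>C b) 1 - c *\<^sub>C Poly_Mapping.single (a, b) 1 | c a b. True}"

definition tensor_eq ::
  "(('a::complex_vector \<times> 'b::complex_vector) \<Rightarrow>\<^sub>0 complex) \<Rightarrow> (('a \<times> 'b) \<Rightarrow>\<^sub>0 complex) \<Rightarrow> bool" where
  "tensor_eq p q \<longleftrightarrow> p - q \<in> cspan tensor_relators"

lemma equivp_tensor_eq:
  "equivp (tensor_eq :: (('a::complex_vector \<times> 'b::complex_vector) \<Rightarrow>\<^sub>0 complex) \<Rightarrow> _ \<Rightarrow> bool)"
proof (rule equivpI)
  show "reflp (tensor_eq :: (('a \<times> 'b) \<Rightarrow>\<^sub>0 complex) \<Rightarrow> _)"
    by (auto simp: reflp_def tensor_eq_def complex_vector.span_zero)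
  show "symp (tensor_eq :: (('a \<times> 'b) \<Rightarrow>\<^sub>0 complex) \<Rightarrow> _)"
    unfolding symp_def tensor_eq_def using complex_vector.span_neg by fastforce
  show "transp (tensor_eq :: (('a \<times> 'b) \<Rightarrow>\<^sub>0 complex) \<Rightarrow> _)"
  proof (rule transpI)
    fix p q r :: "('a \<times> 'b) \<Rightarrow>\<^sub>0 complex"
    assume "tensor_eq p q" "tensor_eq q r"
    then show "tensor_eq p r"
      unfolding tensor_eq_def using complex_vector.span_add by fastforce
  qed
qed

quotient_type (overloaded) ('a, 'b) tensor =
  "(('a::complex_vector \<times> 'b::complex_vector) \<Rightarrow>\<^sub>0 complex)" / tensor_eq
  by (rule equivp_tensor_eq)

instantiation tensor :: (complex_vector, complex_vector) complex_vector
begin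

lift_definition zero_tensor :: "('a, 'b) tensor" is 0 .

lift_definition plus_tensor :: "('a, 'b) tensor \<Rightarrow> ('a, 'b) tensor \<Rightarrow> ('a, 'b) tensor" is "(+)"
  unfolding tensor_eq_def by (metis complex_vector.span_add add_diff_add)

lift_definition uminus_tensor :: "('a, 'b) tensor \<Rightarrow> ('a, 'b) tensor" is uminus
  unfolding tensor_eq_def by (metis complex_vector.span_neg minus_diff_minus)

lift_definition minus_tensor :: "('a, 'b) tensor \<Rightarrow> ('a, 'b) tensor \<Rightarrow> ('a, 'b) tensor" is "(-)"
proof -
  fix p p' q q' :: "('a \<times> 'b) \<Rightarrow>\<^sub>0 complex"
  assume "tensor_eq p p'" "tensor_eq q q'"
  then have "(p - p') - (q - q') \<in> cspan tensor_relators"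
    unfolding tensor_eq_def by (rule complex_vector.span_diff)
  then show "tensor_eq (p - q) (p' - q')" by (simp add: tensor_eq_def algebra_simps)
qed

lift_definition scaleC_tensor :: "complex \<Rightarrow> ('a, 'b) tensor \<Rightarrow> ('a, 'b) tensor" is scaleC
  unfolding tensor_eq_def
  by (metis complex_vector.span_scale complex_vector.scale_right_diff_distrib)

instance
proof
  fix x y z :: "('a, 'b) tensor" and a b :: complex
  note [simp] = tensor_eq_def complex_vector.span_zero
  show "x + y + z = x + (y + z)" by transfer (simp add: add.assoc)
  show "x + y = y + x" by transfer (simp add: add.commute)
  show "0 + x = x" by transfer simp
  show "- x + x = 0" by transfer simp
  show "x - y = x + - y" by transfer simp
  show "a *\<^sub>C (x + y) = a *\<^sub>C x + a *\<^sub>C y" by transfer (simp add: scaleC_add_right)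
  show "(a + b) *\<^sub>C x = a *\<^sub>C x + b *\<^sub>C x" by transfer (simp add: scaleC_add_left)
  show "a *\<^sub>C (b *\<^sub>C x) = (a * b) *\<^sub>C x" by transfer (simp add: scaleC_scaleC)
  show "1 *\<^sub>C x = x" by transfer (simp add: scaleC_one)
qed

end

lift_definition pure_tensor ::
  "'a::complex_vector \<Rightarrow> 'b::complex_vector \<Rightarrow> ('a, 'b) tensor"  (infixr \<open>\<otimes>\<^sub>C\<close> 72)
  is "\<lambda>a b. Poly_Mapping.single (a, b) 1" .

text \<open>Over a field, the tensor product of two subspaces embeds into the tensor product of the
  ambient spaces.\<close>

definition tensor_space ::
  "'a::complex_vector set \<Rightarrow> 'b::complex_vector set \<Rightarrow> ('a, 'b) tensor set" where
  "tensor_space V W = cspan {v \<otimes>\<^sub>C w | v w. v \<in> V \<and> w \<in> W}"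


section \<open>Vertex algebras\<close>

text \<open>\<open>Y a n b\<close> is the product \<open>a\<^sub>n b\<close>, where \<open>Y(a, z) = \<Sum>\<^sub>n a\<^sub>n z\<^bsup>-n-1\<^esup>\<close>. The underlying space is
  a subspace \<open>V\<close> of the ambient type, so that subalgebras share the operation \<open>Y\<close>; nothing is
  required of \<open>Y\<close> outside \<open>V\<close>. The last axiom is the component form of the Jacobi identity
  (Borcherds identity). By truncation all its sums are finite; \<^const>\<open>Sum_any\<close> sums the nonzero
  terms.\<close>

locale vertex_algebra =
  fixes V :: "'v::complex_vector set" and Y :: "'v \<Rightarrow> int \<Rightarrow> 'v \<Rightarrow> 'v" and vac :: 'v
  assumes subspace: "csubspace V"
    and vac_closed: "vac \<in> V"
    and Y_closed: "\<lbrakk>a \<in> V; b \<in> V\<rbrakk> \<Longrightarrow> Y a n b \<in> V"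
    and Y_linear_right: "a \<in> V \<Longrightarrow> clinear_on V (Y a n)"
    and Y_linear_left: "b \<in> V \<Longrightarrow> clinear_on V (\<lambda>a. Y a n b)"
    and truncation: "\<lbrakk>a \<in> V; b \<in> V\<rbrakk> \<Longrightarrow> \<exists>N. \<forall>n\<ge>N. Y a n b = 0"
    and vacuum: "a \<in> V \<Longrightarrow> Y vac n a = (if n = -1 then a else 0)"
    and creation: "a \<in> V \<Longrightarrow> Y a (-1) vac = a"
    and creation_nonneg: "\<lbrakk>a \<in> V; n \<ge> 0\<rbrakk> \<Longrightarrow> Y a n vac = 0"
    and borcherds: "\<lbrakk>a \<in> V; b \<in> V; c \<in> V\<rbrakk> \<Longrightarrow>
      Sum_any (\<lambda>i::nat. (of_int m gchoose i) *\<^sub>C Y (Y a (l + int i) b) (m + n - int i) c) =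
      Sum_any (\<lambda>i::nat. ((-1) ^ i * (of_int l gchoose i)) *\<^sub>C
        (Y a (l + m - int i) (Y b (n + int i) c)
          - ((-1) powi l) *\<^sub>C Y b (l + n - int i) (Y a (m + int i) c)))"

definition vertex_subalgebra ::
  "'v::complex_vector set \<Rightarrow> ('v \<Rightarrow> int \<Rightarrow> 'v \<Rightarrow> 'v) \<Rightarrow> 'v \<Rightarrow> 'v set \<Rightarrow> bool" where
  "vertex_subalgebra V Y vac U \<longleftrightarrow>
    csubspace U \<and> U \<subseteq> V \<and> vac \<in> U \<and> (\<forall>a\<in>U. \<forall>b\<in>U. \<forall>n. Y a n b \<in> U)"

definition generated_subalgebra ::
  "'v::complex_vector set \<Rightarrow> ('v \<Rightarrow> int \<Rightarrow> 'v \<Rightarrow> 'v) \<Rightarrow> 'v \<Rightarrow> 'v set \<Rightarrow> 'v set" where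
  "generated_subalgebra V Y vac S = \<Inter>{U. vertex_subalgebra V Y vac U \<and> S \<subseteq> U}"

definition commutant ::
  "'v::complex_vector set \<Rightarrow> ('v \<Rightarrow> int \<Rightarrow> 'v \<Rightarrow> 'v) \<Rightarrow> 'v set \<Rightarrow> 'v set" where
  "commutant V Y S = {v \<in> V. \<forall>s\<in>S. \<forall>n\<ge>0. Y s n v = 0}"

text \<open>The Virasoro operators are \<open>L(n) = \<omega>\<^bsub>n+1\<^esub>\<close>.\<close>

definition weight_space ::
  "'v::complex_vector set \<Rightarrow> ('v \<Rightarrow> int \<Rightarrow> 'v \<Rightarrow> 'v) \<Rightarrow> 'v \<Rightarrow> int \<Rightarrow> 'v set" where
  "weight_space V Y \<omega> n = {v \<in> V. Y \<omega> 1 v = of_int n *\<^sub>C v}"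

locale vertex_operator_algebra = vertex_algebra V Y vac
  for V :: "'v::complex_vector set" and Y :: "'v \<Rightarrow> int \<Rightarrow> 'v \<Rightarrow> 'v" and vac :: 'v +
  fixes \<omega> :: 'v
  assumes conformal_closed: "\<omega> \<in> V"
    and virasoro: "\<exists>c::complex. \<forall>m n. \<forall>v\<in>V.
      Y \<omega> (m + 1) (Y \<omega> (n + 1) v) - Y \<omega> (n + 1) (Y \<omega> (m + 1) v) =
      of_int (m - n) *\<^sub>C Y \<omega> (m + n + 1) v
        + (if m + n = 0 then (of_int (m ^ 3 - m) / 12 * c) *\<^sub>C v else 0)"
    and derivative: "\<lbrakk>a \<in> V; b \<in> V\<rbrakk> \<Longrightarrow> Y (Y \<omega> 0 a) n b = - of_int n *\<^sub>C Y a (n - 1) b"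
    and grading: "V = cspan (\<Union>n. weight_space V Y \<omega> n)"
    and weight_space_finite: "\<exists>B. finite B \<and> weight_space V Y \<omega> n = cspan B"
    and weight_bounded_below: "\<exists>N. \<forall>n<N. weight_space V Y \<omega> n = {0}"

definition semi_conformal ::
  "'v::complex_vector set \<Rightarrow> ('v \<Rightarrow> int \<Rightarrow> 'v \<Rightarrow> 'v) \<Rightarrow> 'v \<Rightarrow> 'v \<Rightarrow> 'v set" where
  "semi_conformal V Y vac \<omega> =
    {\<omega>'. \<exists>U. vertex_subalgebra V Y vac U \<and> vertex_operator_algebra U Y vac \<omega>' \<and>
       (\<forall>n\<ge>0. \<forall>u\<in>U. Y \<omega> n u = Y \<omega>' n u)}"

text \<open>The vertex operators of a tensor product are \<open>Y(a \<otimes> b, z) = Y(a, z) \<otimes> Y(b, z)\<close>, extended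
  bilinearly (and, to make the operation unique, by \<open>0\<close> outside the tensor product).\<close>

definition tensor_Y ::
  "'v::complex_vector set \<Rightarrow> ('v \<Rightarrow> int \<Rightarrow> 'v \<Rightarrow> 'v) \<Rightarrow>
   'w::complex_vector set \<Rightarrow> ('w \<Rightarrow> int \<Rightarrow> 'w \<Rightarrow> 'w) \<Rightarrow>
   ('v, 'w) tensor \<Rightarrow> int \<Rightarrow> ('v, 'w) tensor \<Rightarrow> ('v, 'w) tensor" where
  "tensor_Y V Y W Y' = (THE Z.
     (\<forall>x\<in>tensor_space V W. \<forall>n. clinear_on (tensor_space V W) (Z x n)) \<and>
     (\<forall>y\<in>tensor_space V W. \<forall>n. clinear_on (tensor_space V W) (\<lambda>x. Z x n y)) \<and>
     (\<forall>x n y. x \<notin> tensor_space V W \<or> y \<notin> tensor_space V W \<longrightarrow> Z x n y = 0) \<and>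
     (\<forall>a\<in>V. \<forall>c\<in>V. \<forall>b\<in>W. \<forall>d\<in>W. \<forall>n.
        Z (a \<otimes>\<^sub>C b) n (c \<otimes>\<^sub>C d) = Sum_any (\<lambda>i::int. Y a i c \<otimes>\<^sub>C Y' b (n - i - 1) d)))"

definition voa_isomorphic ::
  "'v::complex_vector set \<Rightarrow> ('v \<Rightarrow> int \<Rightarrow> 'v \<Rightarrow> 'v) \<Rightarrow> 'v \<Rightarrow> 'v \<Rightarrow>
   'w::complex_vector set \<Rightarrow> ('w \<Rightarrow> int \<Rightarrow> 'w \<Rightarrow> 'w) \<Rightarrow> 'w \<Rightarrow> 'w \<Rightarrow> bool" where
  "voa_isomorphic V Y vac \<omega> W Y' vac' \<omega>' \<longleftrightarrow>
    vertex_operator_algebra V Y vac \<omega> \<and> vertex_operator_algebra W Y' vac' \<omega>' \<and>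
    (\<exists>f. clinear_on V f \<and> bij_betw f V W \<and> f vac = vac' \<and> f \<omega> = \<omega>' \<and>
      (\<forall>a\<in>V. \<forall>b\<in>V. \<forall>n. f (Y a n b) = Y' (f a) n (f b)))"


section \<open>Induced modules\<close>

text \<open>The tensor algebra of a Lie algebra \<open>g\<close> (a subspace of the type \<open>'g\<close> with bracket \<open>br\<close>) is
  presented as the free algebra on the set \<open>g\<close>, whose basis consists of the words over \<open>g\<close>, modulo
  the linear relations between letters; \<open>U(g)\<close> is the quotient by the span of
  \<open>enveloping_relators\<close>. With \<open>p\<close> a subalgebra acting on the line \<open>\<complex>\<one>\<close> through the character \<open>\<chi>\<close>,
  the module \<open>U(g) \<otimes>\<^bsub>U(p)\<^esub> \<complex>\<one>\<close> is obtained by imposing in addition the balancing relations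
  \<open>u w \<otimes> \<one> = u \<otimes> w \<one>\<close> for monomials \<open>u\<close> in \<open>U(g)\<close> and \<open>w\<close> in \<open>U(p)\<close>.\<close>

definition free_algebra :: "'g set \<Rightarrow> ('g list \<Rightarrow>\<^sub>0 complex) set" where
  "free_algebra g = {q. Poly_Mapping.keys q \<subseteq> lists g}"

abbreviation word :: "'g list \<Rightarrow> ('g list \<Rightarrow>\<^sub>0 complex)" where
  "word w \<equiv> Poly_Mapping.single w 1"

definition enveloping_relators ::
  "'g::complex_vector set \<Rightarrow> ('g \<Rightarrow> 'g \<Rightarrow> 'g) \<Rightarrow> ('g list \<Rightarrow>\<^sub>0 complex) set" where
  "enveloping_relators g br =
     {word (u @ [x + y] @ w) - word (u @ [x] @ w) - word (u @ [y] @ w)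
        | u w x y. u \<in> lists g \<and> w \<in> lists g \<and> x \<in> g \<and> y \<in> g}
   \<union> {word (u @ [c *\<^sub>C x] @ w) - c *\<^sub>C word (u @ [x] @ w)
        | u w c x. u \<in> lists g \<and> w \<in> lists g \<and> x \<in> g}
   \<union> {word (u @ [x, y] @ w) - word (u @ [y, x] @ w) - word (u @ [br x y] @ w)
        | u w x y. u \<in> lists g \<and> w \<in> lists g \<and> x \<in> g \<and> y \<in> g}"

definition induced_relators ::
  "'g::complex_vector set \<Rightarrow> ('g \<Rightarrow> 'g \<Rightarrow> 'g) \<Rightarrow> 'g set \<Rightarrow> ('g \<Rightarrow> complex) \<Rightarrow> ('g list \<Rightarrow>\<^sub>0 complex) set"
  where
  "induced_relators g br p \<chi> = enveloping_relators g br
   \<union> {word (u @ w) - prod_list (map \<chi> w) *\<^sub>C word u | u w. u \<in> lists g \<and> w \<in> lists p}"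

text \<open>The map \<open>x\<^sub>1\<dots>x\<^sub>k \<mapsto> x\<^sub>1(\<dots>(x\<^sub>k m))\<close>.\<close>

definition eval_words ::
  "('g \<Rightarrow> 'v \<Rightarrow> 'v) \<Rightarrow> 'v \<Rightarrow> ('g list \<Rightarrow>\<^sub>0 complex) \<Rightarrow> 'v::complex_vector" where
  "eval_words act m q = (\<Sum>w\<in>Poly_Mapping.keys q. Poly_Mapping.lookup q w *\<^sub>C foldr act w m)"

text \<open>\<open>(M, act, m)\<close> is a realization of \<open>U(g) \<otimes>\<^bsub>U(p)\<^esub> \<complex>\<one>\<close>, with \<open>m\<close> as \<open>1 \<otimes> \<one>\<close>: the map
  \<open>q \<mapsto> q m\<close> descends to an isomorphism from the quotient of the free algebra by the above relations
  onto \<open>M\<close>. As \<open>act x\<close> is linear on \<open>M\<close>, this isomorphism intertwines left multiplication by \<open>x\<close>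
  with \<open>act x\<close>.\<close>

definition induced_module ::
  "'g::complex_vector set \<Rightarrow> ('g \<Rightarrow> 'g \<Rightarrow> 'g) \<Rightarrow> 'g set \<Rightarrow> ('g \<Rightarrow> complex) \<Rightarrow>
   'v::complex_vector set \<Rightarrow> ('g \<Rightarrow> 'v \<Rightarrow> 'v) \<Rightarrow> 'v \<Rightarrow> bool" where
  "induced_module g br p \<chi> M act m \<longleftrightarrow>
    csubspace M \<and> m \<in> M \<and>
    (\<forall>x\<in>g. act x ` M \<subseteq> M \<and> clinear_on M (act x)) \<and>
    eval_words act m ` free_algebra g = M \<and>
    (\<forall>q\<in>free_algebra g. eval_words act m q = 0 \<longleftrightarrow> q \<in> cspan (induced_relators g br p \<chi>))"


section \<open>Heisenberg vertex algebras\<close>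

definition bilinear_form :: "('h::complex_vector \<Rightarrow> 'h \<Rightarrow> complex) \<Rightarrow> bool" where
  "bilinear_form B \<longleftrightarrow> (\<forall>u. clinear_on UNIV (B u)) \<and> (\<forall>v. clinear_on UNIV (\<lambda>u. B u v))"

definition symmetric_form :: "('h \<Rightarrow> 'h \<Rightarrow> complex) \<Rightarrow> bool" where
  "symmetric_form B \<longleftrightarrow> (\<forall>u v. B u v = B v u)"

definition nondegenerate_on :: "'h::complex_vector set \<Rightarrow> ('h \<Rightarrow> 'h \<Rightarrow> complex) \<Rightarrow> bool" where
  "nondegenerate_on k B \<longleftrightarrow> (\<forall>u\<in>k. (\<forall>v\<in>k. B u v = 0) \<longrightarrow> u = 0)"

definition orthonormal_basis :: "('h::complex_vector \<Rightarrow> 'h \<Rightarrow> complex) \<Rightarrow> nat \<Rightarrow> (nat \<Rightarrow> 'h) \<Rightarrow> bool" where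
  "orthonormal_basis B d e \<longleftrightarrow>
    inj_on e {1..d} \<and> \<not> complex_vector.dependent (e ` {1..d}) \<and> cspan (e ` {1..d}) = UNIV \<and>
    (\<forall>i\<in>{1..d}. \<forall>j\<in>{1..d}. B (e i) (e j) = (if i = j then 1 else 0))"

text \<open>The pair \<open>(f, a)\<close> stands for \<open>\<Sum>\<^sub>m t\<^sup>m \<otimes> f(m) + a C\<close> in \<open>\<complex>[t, t\<^sup>-\<^sup>1] \<otimes> \<hh> \<oplus> \<complex>C\<close>.\<close>

type_synonym 'h affine = "(int \<Rightarrow>\<^sub>0 'h) \<times> complex"

definition heis_bracket ::
  "('h::complex_vector \<Rightarrow> 'h \<Rightarrow> complex) \<Rightarrow> 'h affine \<Rightarrow> 'h affine \<Rightarrow> 'h affine" where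
  "heis_bracket B x y =
    (0, Sum_any (\<lambda>m. of_int m * B (Poly_Mapping.lookup (fst x) m) (Poly_Mapping.lookup (fst y) (- m))))"

definition affinization :: "'h::complex_vector set \<Rightarrow> 'h affine set" where
  "affinization k = {x. \<forall>m. Poly_Mapping.lookup (fst x) m \<in> k}"

definition affinization_nonneg :: "'h::complex_vector set \<Rightarrow> 'h affine set" where
  "affinization_nonneg k = {x \<in> affinization k. \<forall>m<0. Poly_Mapping.lookup (fst x) m = 0}"

definition loop :: "'h::complex_vector \<Rightarrow> int \<Rightarrow> 'h affine" where
  "loop u n = (Poly_Mapping.single n u, 0)"

text \<open>The character of \<open>affinization_nonneg k\<close> that is \<open>0\<close> on \<open>\<complex>[t] \<otimes> k\<close> and \<open>1\<close> on \<open>C\<close> is \<open>snd\<close>.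
  The vertex algebra structure on \<open>V\<close> is determined by the last condition, since the vectors
  \<open>u(-1)\<one>\<close> generate \<open>V\<close>.\<close>

definition heisenberg_vertex_algebra ::
  "'h::complex_vector set \<Rightarrow> ('h \<Rightarrow> 'h \<Rightarrow> complex) \<Rightarrow>
   'v::complex_vector set \<Rightarrow> ('v \<Rightarrow> int \<Rightarrow> 'v \<Rightarrow> 'v) \<Rightarrow> 'v \<Rightarrow> ('h affine \<Rightarrow> 'v \<Rightarrow> 'v) \<Rightarrow> bool" where
  "heisenberg_vertex_algebra k B V Y vac act \<longleftrightarrow>
    csubspace k \<and> nondegenerate_on k B \<and>
    induced_module (affinization k) (heis_bracket B) (affinization_nonneg k) snd V act vac \<and>
    vertex_algebra V Y vac \<and>
    (\<forall>u\<in>k. \<forall>n. \<forall>v\<in>V. Y (act (loop u (-1)) vac) n v = act (loop u n) v)"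

text \<open>\<open>omega_vec e d act vac h\<close> is \<open>\<omega>\<^sub>h\<close>, for the orthonormal basis \<open>e 1, \<dots>, e d\<close>.\<close>

definition omega_vec ::
  "(nat \<Rightarrow> 'h::complex_vector) \<Rightarrow> nat \<Rightarrow> ('h affine \<Rightarrow> 'v \<Rightarrow> 'v) \<Rightarrow> 'v \<Rightarrow> 'h \<Rightarrow> 'v::complex_vector"
  where
  "omega_vec e d act vac h =
    (1/2) *\<^sub>C (\<Sum>i=1..d. act (loop (e i) (-1)) (act (loop (e i) (-1)) vac)) + act (loop h (-2)) vac"

text \<open>The coefficients \<open>a\<^bsub>ij\<^esub>\<close>, \<open>i \<le> j\<close>, of a vector of weight two.\<close>

definition quadratic_coeff ::
  "(nat \<Rightarrow> 'h::complex_vector) \<Rightarrow> nat \<Rightarrow> ('h affine \<Rightarrow> 'v \<Rightarrow> 'v) \<Rightarrow> 'v \<Rightarrow> 'v::complex_vector \<Rightarrow>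
   nat \<Rightarrow> nat \<Rightarrow> complex" where
  "quadratic_coeff e d act vac \<omega>' = (THE a.
     (\<forall>i j. \<not> (1 \<le> i \<and> i \<le> j \<and> j \<le> d) \<longrightarrow> a i j = 0) \<and>
     (\<exists>b. \<omega>' =
        (\<Sum>i=1..d. \<Sum>j=i..d. a i j *\<^sub>C act (loop (e i) (-1)) (act (loop (e j) (-1)) vac))
        + (\<Sum>i=1..d. b i *\<^sub>C act (loop (e i) (-2)) vac)))"

definition A_matrix ::
  "(nat \<Rightarrow> 'h::complex_vector) \<Rightarrow> nat \<Rightarrow> ('h affine \<Rightarrow> 'v \<Rightarrow> 'v) \<Rightarrow> 'v \<Rightarrow> 'v::complex_vector \<Rightarrow>
   nat \<Rightarrow> nat \<Rightarrow> complex" where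
  "A_matrix e d act vac \<omega>' i j =
    (if i = j then 2 * quadratic_coeff e d act vac \<omega>' i i
     else quadratic_coeff e d act vac \<omega>' (min i j) (max i j))"

text \<open>The \<open>j\<close>-th coordinate of \<open>u\<close> in the orthonormal basis is \<open>\<langle>e\<^sub>j, u\<rangle>\<close>.\<close>

definition A_map ::
  "('h::complex_vector \<Rightarrow> 'h \<Rightarrow> complex) \<Rightarrow> (nat \<Rightarrow> 'h) \<Rightarrow> nat \<Rightarrow> ('h affine \<Rightarrow> 'v \<Rightarrow> 'v) \<Rightarrow> 'v \<Rightarrow>
   'v::complex_vector \<Rightarrow> 'h \<Rightarrow> 'h" where
  "A_map B e d act vac \<omega>' u =
    (\<Sum>i=1..d. \<Sum>j=1..d. (A_matrix e d act vac \<omega>' i j * B (e j) u) *\<^sub>C e i)"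

end

theory Submission
  imports Defs
begin

text \<open>
Write \<open>u(n)\<close> for the operator of \<open>u \<otimes> t\<^sup>n\<close>. For an orthogonal projection \<open>P\<close> of \<open>\<hh>\<close> put
\<open>\<omega>\<^sub>P = 1/2 \<Sum>\<^sub>i (P e\<^sub>i)(-1)(P e\<^sub>i)(-1)\<one> + (P h)(-2)\<one>\<close>, so that \<open>\<omega>\<^sub>h\<close> is the case \<open>P = 1\<close>. The theorem
follows from two facts: every semi-conformal vector \<open>\<omega>'\<close> is \<open>\<omega>\<^sub>A\<close> with \<open>A\<close> its associated map, which is
such a projection; and all assertions hold for the pair \<open>\<omega>\<^sub>P\<close>, \<open>\<omega>\<^sub>Q\<close> with \<open>Q = 1 - P\<close>.

The first fact is a computation with commutators. A vector \<open>\<omega>\<close> of weight two is determined by the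
annihilation operators on it: \<open>u(1)\<omega> = (A u)(-1)\<one>\<close> and \<open>u(2)\<omega> = 2\<langle>u, b\<rangle>\<one>\<close>, and this also determines
all commutators \<open>[u(m), \<omega>\<^sub>n]\<close>. Commuting \<open>u(1)\<close> with \<open>v(1)\<close> shows that \<open>A\<close> is self-adjoint, applying \<open>u(1)\<close>
to \<open>\<omega>'\<^sub>1 \<omega>' = 2\<omega>'\<close> gives \<open>A\<^sup>2 = A\<close>, and applying it to \<open>(\<omega>\<^sub>h)\<^sub>2 \<omega>' = 0\<close> gives \<open>b = A h\<close>. Hence \<open>\<omega>'\<close> and
\<open>\<omega>\<^sub>A\<close> agree under all annihilation operators and are equal; likewise \<open>\<omega>\<^sub>h - \<omega>' = \<omega>\<^sub>1\<^sub>-\<^sub>A\<close>.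

For the second fact let \<open>V\<^sub>P\<close> be the vertex subalgebra generated by \<open>P \<hh>\<close>. The operator \<open>(\<omega>\<^sub>Q)\<^sub>1\<close> counts
the total degree of the modes from \<open>Q \<hh>\<close> in a monomial, so its kernel is spanned by the monomials
in modes from \<open>P \<hh>\<close>. This closes the circle of inclusions
\<open>C(\<omega>\<^sub>Q) \<subseteq> ker (\<omega>\<^sub>Q)\<^sub>1 \<subseteq> V\<^sub>P \<subseteq> C(V\<^sub>Q) \<subseteq> C(\<omega>\<^sub>Q)\<close>, where the last two follow from locality and
\<open>\<omega>\<^sub>Q \<in> V\<^sub>Q\<close>. The products \<open>(\<omega>\<^sub>P)\<^sub>n \<omega>\<^sub>P\<close> make \<open>(V\<^sub>P, \<omega>\<^sub>P)\<close> a vertex operator algebra. The tensor decomposition is the map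
\<open>a \<otimes> b \<mapsto> a\<^sub>-\<^sub>1 b\<close> from \<open>V\<^sub>Q \<otimes> V\<^sub>P\<close> to \<open>V\<close>: it is onto because its image is stable under all \<open>u(n)\<close>, and
injective by an induction that strips off annihilation operators from the first factor.

Two points concern the induced modules themselves. That the vacuum does not vanish is shown by
letting the Heisenberg algebra act on formal power series by multiplications and derivatives. That
\<open>V\<^sub>P\<close> is induced from the Heisenberg algebra of \<open>P \<hh>\<close> amounts to showing that no further relations hold between its words; here irreducibility
replaces a basis of the enveloping algebra: in the module presented by the relations of \<open>P \<hh>\<close>, a
nonzero vector is sent to a nonzero multiple of the vacuum by suitable annihilation operators,
hence cannot become zero in \<open>V\<close>.
\<close>

section \<open>Complex linear algebra\<close>

abbreviation clinear :: "('a::complex_vector \<Rightarrow> 'b::complex_vector) \<Rightarrow> bool" where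
  "clinear \<equiv> Vector_Spaces.linear scaleC scaleC"

global_interpretation complex_vector_pair:
  vector_space_pair "scaleC :: complex \<Rightarrow> 'a \<Rightarrow> 'a::complex_vector"
    "scaleC :: complex \<Rightarrow> 'b \<Rightarrow> 'b::complex_vector"
  by unfold_locales

lemma clinear_on_UNIV_iff: "clinear_on UNIV f \<longleftrightarrow> clinear f"
  by (auto simp: clinear_on_def Vector_Spaces.linear_iff complex_vector.vector_space_axioms)

lemmas clinear_add = complex_vector_pair.linear_add
  and clinear_scale = complex_vector_pair.linear_scale
  and clinear_sum = complex_vector_pair.linear_sum
  and clinear_0 = complex_vector_pair.linear_0
  and clinear_diff = complex_vector_pair.linear_diff

lemma clinearI:
  "(\<And>x y. f (x + y) = f x + f y) \<Longrightarrow> (\<And>c x. f (c *\<^sub>C x) = c *\<^sub>C f x) \<Longrightarrow> clinear f"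
  by (simp add: Vector_Spaces.linear_iff complex_vector.vector_space_axioms)

lemma clinear_span_subset:
  assumes "clinear f" "csubspace W" "\<And>x. x \<in> S \<Longrightarrow> f x \<in> W" "x \<in> cspan S"
  shows "f x \<in> W"
  using assms(4)
proof (induction rule: complex_vector.span_induct_alt)
  case base
  then show ?case using assms clinear_0 complex_vector.subspace_0 by metis
next
  case (step c x y)
  then show ?case
    using assms by (simp add: clinear_add clinear_scale complex_vector.subspace_add
        complex_vector.subspace_scale)
qed

lemma clinear_eq_on_span:
  assumes "clinear f" "clinear g" "\<And>x. x \<in> S \<Longrightarrow> f x = g x" "x \<in> cspan S"
  shows "f x = g x"
  using assms complex_vector_pair.linear_eq_on by blast

lemma in_span_finite_family:
  assumes "x \<in> cspan (g ` I)"
  obtains J where "finite J" "J \<subseteq> I" "x \<in> cspan (g ` J)"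
proof -
  have "\<exists>J. finite J \<and> J \<subseteq> I \<and> x \<in> cspan (g ` J)"
    using assms
  proof (induction rule: complex_vector.span_induct_alt)
    case base
    then show ?case by (intro exI[of _ "{}"]) auto
  next
    case (step c b y)
    then obtain i J where *: "i \<in> I" "b = g i" "finite J" "J \<subseteq> I" "y \<in> cspan (g ` J)"
      by auto
    moreover have "cspan (g ` J) \<subseteq> cspan (g ` insert i J)"
      by (intro complex_vector.span_mono) auto
    moreover have "b \<in> cspan (g ` insert i J)"
      using * by (intro complex_vector.span_base) auto
    ultimately have "c *\<^sub>C b + y \<in> cspan (g ` insert i J)"
      using * by (blast intro: complex_vector.span_add complex_vector.span_scale)
    with * show ?case by (intro exI[of _ "insert i J"]) auto
  qed
  with that show ?thesis by blast
qed

text \<open>Subtracting \<open>lam i\<close> from \<open>L\<close> removes \<open>g i\<close> from the spanning family and multiplies \<open>z\<close> by a nonzero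
scalar; so the members of the family can be removed one by one.\<close>

lemma eigenvector_of_other_eigenvalues_is_0:
  assumes L: "clinear L"
    and "finite K" "\<And>i. i \<in> K \<Longrightarrow> L (g i) = lam i *\<^sub>C g i \<and> lam i \<noteq> mu"
    and "z \<in> cspan (g ` K)" "L z = mu *\<^sub>C z"
  shows "z = 0"
  using assms(2-)
proof (induction K rule: finite_induct)
  case empty
  then show ?case by simp
next
  case (insert i K)
  have "z \<in> cspan (insert (g i) (g ` K))" using insert.prems by simp
  then obtain c where c: "z - c *\<^sub>C g i \<in> cspan (g ` K)"
    using complex_vector.span_breakdown_eq by blast
  have "L x - lam i *\<^sub>C x \<in> cspan (g ` K)" if "x \<in> cspan (g ` K)" for x
  proof -
    have "L x \<in> cspan (g ` K)"
      by (rule clinear_span_subset[OF L _ _ that])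
        (use insert.prems in \<open>auto intro!: complex_vector.span_scale complex_vector.span_base[OF imageI]\<close>)
    then show ?thesis
      using that by (simp add: complex_vector.span_diff complex_vector.span_scale)
  qed
  from this[OF c] have "L z - lam i *\<^sub>C z \<in> cspan (g ` K)"
    using insert.prems(1)[of i]
    by (simp add: clinear_diff[OF L] clinear_scale[OF L] complex_vector.scale_right_diff_distrib
        scaleC_scaleC mult.commute)
  then have "(mu - lam i) *\<^sub>C z \<in> cspan (g ` K)"
    using insert.prems by (simp add: complex_vector.scale_left_diff_distrib)
  then have "inverse (mu - lam i) *\<^sub>C ((mu - lam i) *\<^sub>C z) \<in> cspan (g ` K)"
    by (rule complex_vector.span_scale)
  moreover have "inverse (mu - lam i) * (mu - lam i) = 1"
    using insert.prems(1)[of i] by (intro left_inverse) auto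
  ultimately have "z \<in> cspan (g ` K)"
    by (simp only: scaleC_scaleC scaleC_one)
  with insert show ?case by blast
qed

text \<open>The eigenvectors are indexed by \<open>I\<close> because the monomials in the creation operators are indexed by words,
and the degree of a word is not a function of the vector: words of different degrees may
both give the zero vector.\<close>

lemma eigenvector_in_span_of_eigenvectors:
  assumes L: "clinear L" and eig: "\<And>i. i \<in> I \<Longrightarrow> L (g i) = lam i *\<^sub>C g i"
    and x: "x \<in> cspan (g ` I)" and Lx: "L x = mu *\<^sub>C x"
  shows "x \<in> cspan (g ` {i \<in> I. lam i = mu})"
proof -
  obtain J where J: "finite J" "J \<subseteq> I" "x \<in> cspan (g ` J)"
    using x in_span_finite_family by blast
  have "g ` J = g ` {i \<in> J. lam i = mu} \<union> g ` {i \<in> J. lam i \<noteq> mu}" by auto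
  with J obtain y z where yz: "x = y + z" "y \<in> cspan (g ` {i \<in> J. lam i = mu})"
      "z \<in> cspan (g ` {i \<in> J. lam i \<noteq> mu})"
    by (auto simp: complex_vector.span_Un)
  have "clinear (\<lambda>x. mu *\<^sub>C x)"
    by (rule clinearI) (simp_all add: scaleC_add_right scaleC_scaleC mult.commute)
  then have "L y = mu *\<^sub>C y"
    by (rule clinear_eq_on_span[OF L _ _ yz(2)]) (use eig J in auto)
  then have "L z = mu *\<^sub>C z"
    using Lx yz(1) by (simp add: clinear_add[OF L] scaleC_add_right)
  then have "z = 0"
  proof (intro eigenvector_of_other_eigenvalues_is_0[OF L _ _ yz(3)])
    show "L (g i) = lam i *\<^sub>C g i \<and> lam i \<noteq> mu" if "i \<in> {i \<in> J. lam i \<noteq> mu}" for i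
      using eig J(2) that by blast
  qed (use J(1) in auto)
  moreover have "cspan (g ` {i \<in> J. lam i = mu}) \<subseteq> cspan (g ` {i \<in> I. lam i = mu})"
    using J by (intro complex_vector.span_mono) auto
  ultimately show ?thesis using yz(1,2) by auto
qed

text \<open>Such a projection serves as a quotient map whose values stay in the same type.\<close>

lemma exists_projection_with_kernel:
  fixes R :: "'a::complex_vector set"
  assumes "csubspace R"
  obtains \<pi> :: "'a \<Rightarrow> 'a" where "clinear \<pi>" "\<And>x. \<pi> x = 0 \<longleftrightarrow> x \<in> R" "\<And>x. x - \<pi> x \<in> R"
proof -
  obtain C where C: "C \<subseteq> R" "complex_vector.independent C" "R \<subseteq> cspan C"
    using complex_vector.basis_exists by metis
  define D where "D = complex_vector.extend_basis C"
  have D: "C \<subseteq> D" "complex_vector.independent D" "cspan D = UNIV"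
    unfolding D_def using C complex_vector.extend_basis_superset
      complex_vector.independent_extend_basis complex_vector.span_extend_basis by metis+
  obtain \<pi> :: "'a \<Rightarrow> 'a" where pi: "clinear \<pi>" "\<And>x. x \<in> D \<Longrightarrow> \<pi> x = (if x \<in> C then 0 else x)"
    using complex_vector_pair.linear_independent_extend[OF D(2), of "\<lambda>x. if x \<in> C then 0 else x"]
    by blast
  have diff: "x - \<pi> x \<in> R" for x
  proof (rule clinear_span_subset[of "\<lambda>x. x - \<pi> x" R D])
    show "clinear (\<lambda>x. x - \<pi> x)"
      by (intro clinearI) (simp_all add: clinear_add[OF pi(1)] clinear_scale[OF pi(1)]
          complex_vector.scale_right_diff_distrib)
    show "x - \<pi> x \<in> R" if "x \<in> D" for x
      using pi(2)[OF that] C assms complex_vector.subspace_0 by auto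
  qed (use assms D in auto)
  have zero: "\<pi> x = 0" if "x \<in> R" for x
    by (rule clinear_eq_on_span[of \<pi> "\<lambda>_. 0" C])
      (use pi C D that complex_vector_pair.linear_zero in auto)
  show thesis
  proof (rule that[OF pi(1) _ diff])
    show "\<pi> x = 0 \<longleftrightarrow> x \<in> R" for x
      using diff[of x] zero[of x] by auto
  qed
qed

text \<open>Injectivity makes the equation hold for infinite supports too: then both sides are \<open>0\<close> by convention.\<close>

lemma clinear_Sum_any:
  assumes "clinear f" "\<And>x. f x = 0 \<Longrightarrow> x = 0"
  shows "f (Sum_any g) = Sum_any (\<lambda>i. f (g i))"
proof -
  have "{a. f (g a) \<noteq> 0} = {a. g a \<noteq> 0}"
    using assms(2) clinear_0[OF assms(1)] by fastforce
  then show ?thesis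
    by (simp add: Sum_any.expand_set clinear_sum[OF assms(1)])
qed

definition linear_extension :: "('b \<Rightarrow> 'a::complex_vector) \<Rightarrow> ('b \<Rightarrow>\<^sub>0 complex) \<Rightarrow> 'a" where
  "linear_extension g q = (\<Sum>w\<in>Poly_Mapping.keys q. Poly_Mapping.lookup q w *\<^sub>C g w)"

lemma linear_extension_superset:
  "finite K \<Longrightarrow> Poly_Mapping.keys q \<subseteq> K \<Longrightarrow> linear_extension g q = (\<Sum>w\<in>K. Poly_Mapping.lookup q w *\<^sub>C g w)"
  unfolding linear_extension_def by (rule sum.mono_neutral_left) (auto simp: in_keys_iff)

lemma lookup_scaleC: "Poly_Mapping.lookup (c *\<^sub>C q) w = c *\<^sub>C Poly_Mapping.lookup q w"
  by transfer simp

lemma linear_extension_single [simp]: "linear_extension g (Poly_Mapping.single w c) = c *\<^sub>C g w"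
  by (simp add: linear_extension_def)

lemma clinear_linear_extension: "clinear (linear_extension g)"
proof (rule clinearI)
  fix p q :: "'a \<Rightarrow>\<^sub>0 complex" and c
  have "Poly_Mapping.keys (p + q) \<subseteq> Poly_Mapping.keys p \<union> Poly_Mapping.keys q"
    by (rule Poly_Mapping.keys_add)
  then show "linear_extension g (p + q) = linear_extension g p + linear_extension g q"
    by (simp add: linear_extension_superset[of "Poly_Mapping.keys p \<union> Poly_Mapping.keys q"] lookup_add
        scaleC_add_left sum.distrib)
  have "Poly_Mapping.keys (c *\<^sub>C q) \<subseteq> Poly_Mapping.keys q"
    by (auto simp: in_keys_iff lookup_scaleC scaleC_complex_def)
  then show "linear_extension g (c *\<^sub>C q) = c *\<^sub>C linear_extension g q"
    by (simp add: linear_extension_superset[of "Poly_Mapping.keys q"] lookup_scaleC scaleC_complex_def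
        scaleC_scaleC complex_vector.scale_sum_right)
qed

lemma poly_mapping_sum_monomials:
  "(\<Sum>k\<in>Poly_Mapping.keys f. Poly_Mapping.single k (Poly_Mapping.lookup f k)) = f"
  by (rule poly_mapping_eqI)
    (auto simp: lookup_sum lookup_single when_def in_keys_iff sum.delta)

lemma linear_extension_id: "linear_extension (\<lambda>w. Poly_Mapping.single w 1) q = q"
proof -
  have "c *\<^sub>C Poly_Mapping.single w (1::complex) = Poly_Mapping.single w c" for c and w :: 'a
    by (rule poly_mapping_eqI) (simp add: lookup_scaleC scaleC_complex_def lookup_single when_def)
  then show ?thesis by (simp add: linear_extension_def poly_mapping_sum_monomials)
qed

lemma clinear_comp_linear_extension:
  assumes "clinear f" shows "f (linear_extension g q) = linear_extension (\<lambda>w. f (g w)) q"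
  unfolding linear_extension_def by (simp add: clinear_sum[OF assms] clinear_scale[OF assms])

lemma clinear_eq_linear_extension:
  assumes "clinear f" shows "f q = linear_extension (\<lambda>w. f (Poly_Mapping.single w 1)) q"
  using clinear_comp_linear_extension[OF assms, of "\<lambda>w. Poly_Mapping.single w 1" q] by (simp add: linear_extension_id)

lemma in_subspace_linear_extension:
  assumes "csubspace W" "\<And>w. w \<in> Poly_Mapping.keys q \<Longrightarrow> g w \<in> W"
  shows "linear_extension g q \<in> W"
  unfolding linear_extension_def using assms
  by (intro complex_vector.subspace_sum complex_vector.subspace_scale) auto

lemma eval_words_eq_linear_extension: "eval_words act m = linear_extension (\<lambda>w. foldr act w m)"
  by (simp add: eval_words_def linear_extension_def fun_eq_iff)

section \<open>Heisenberg representations generated by a vacuum vector\<close>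

definition fock_space :: "'h set \<Rightarrow> ('h \<Rightarrow> int \<Rightarrow> 'm \<Rightarrow> 'm) \<Rightarrow> 'm \<Rightarrow> 'm::complex_vector set" where
  "fock_space k J vac = cspan {foldr (\<lambda>(u, n). J u n) w vac | w. set w \<subseteq> k \<times> UNIV}"

lemma fock_space_vac: "vac \<in> fock_space k J vac"
  unfolding fock_space_def
  by (rule complex_vector.span_base) (auto intro!: exI[of _ "[]"])

lemma subspace_fock_space: "csubspace (fock_space k J vac)"
  unfolding fock_space_def by (rule complex_vector.subspace_span)

lemma fock_space_step:
  assumes "clinear (J u n)" "u \<in> k" "x \<in> fock_space k J vac"
  shows "J u n x \<in> fock_space k J vac"
  using assms(3) unfolding fock_space_def
proof (rule clinear_span_subset[OF assms(1) complex_vector.subspace_span, rotated])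
  fix x assume "x \<in> {foldr (\<lambda>(u, n). J u n) w vac |w. set w \<subseteq> k \<times> UNIV}"
  then obtain w where w: "set w \<subseteq> k \<times> UNIV" "x = foldr (\<lambda>(u, n). J u n) w vac" by blast
  then show "J u n x \<in> cspan {foldr (\<lambda>(u, n). J u n) w vac |w. set w \<subseteq> k \<times> UNIV}"
    using assms(2) by (intro complex_vector.span_base) (auto intro!: exI[of _ "(u, n) # w"])
qed

text \<open>The relations are only required on the span of the monomials applied to the vacuum, because a quotient
of the free algebra, realized by a projection, satisfies them only there. The vectors \<open>f i\<close> form a
frame rather than a basis, so that the images of an orthonormal basis under an orthogonal projection
serve for the image of the projection.\<close>

locale heisenberg_rep =
  fixes k :: "'h::complex_vector set" and B :: "'h \<Rightarrow> 'h \<Rightarrow> complex"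
    and J :: "'h \<Rightarrow> int \<Rightarrow> 'm::complex_vector \<Rightarrow> 'm" and vac :: 'm
    and f :: "nat \<Rightarrow> 'h" and d :: nat
  assumes J_linear: "u \<in> k \<Longrightarrow> clinear (J u n)"
    and J_add: "\<lbrakk>u \<in> k; v \<in> k; x \<in> fock_space k J vac\<rbrakk> \<Longrightarrow> J (u + v) n x = J u n x + J v n x"
    and J_scale: "\<lbrakk>u \<in> k; x \<in> fock_space k J vac\<rbrakk> \<Longrightarrow> J (c *\<^sub>C u) n x = c *\<^sub>C J u n x"
    and J_commute: "\<lbrakk>u \<in> k; v \<in> k; x \<in> fock_space k J vac\<rbrakk> \<Longrightarrow>
      J u m (J v n x) = J v n (J u m x) + (if m + n = 0 then of_int m * B u v else 0) *\<^sub>C x"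
    and J_vac: "\<lbrakk>u \<in> k; n \<ge> 0\<rbrakk> \<Longrightarrow> J u n vac = 0"
    and subspace_k: "csubspace k"
    and f_in: "i \<in> {1..d} \<Longrightarrow> f i \<in> k"
    and frame: "u \<in> k \<Longrightarrow> (\<Sum>i=1..d. B u (f i) *\<^sub>C f i) = u"
    and B_sym: "B u v = B v u"
begin

abbreviation "M \<equiv> fock_space k J vac"

lemma J_closed: "u \<in> k \<Longrightarrow> x \<in> M \<Longrightarrow> J u n x \<in> M"
  by (intro fock_space_step J_linear)

lemma J_sum:
  assumes "finite I" "\<And>i. i \<in> I \<Longrightarrow> g i \<in> k" "x \<in> M"
  shows "J (\<Sum>i\<in>I. c i *\<^sub>C g i) n x = (\<Sum>i\<in>I. c i *\<^sub>C J (g i) n x)"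
  using assms(1,2)
proof (induction I rule: finite_induct)
  case empty
  have "J (0 *\<^sub>C 0) n x = 0 *\<^sub>C J 0 n x"
    using assms(3) complex_vector.subspace_0[OF subspace_k] by (intro J_scale)
  then show ?case by simp
next
  case (insert i I)
  then have "(\<Sum>i\<in>I. c i *\<^sub>C g i) \<in> k"
    by (intro complex_vector.subspace_sum complex_vector.subspace_scale subspace_k) auto
  with insert assms(3) show ?case
    by (simp add: J_add J_scale complex_vector.subspace_scale[OF subspace_k])
qed

lemma J_frame:
  assumes "u \<in> k" "x \<in> M"
  shows "J u n x = (\<Sum>i=1..d. B u (f i) *\<^sub>C J (f i) n x)"
  using J_sum[of "{1..d}" f x "\<lambda>i. B u (f i)" n] assms f_in frame by simp

definition creation_monomial :: "(nat \<times> nat) list \<Rightarrow> 'm" where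
  "creation_monomial w = foldr (\<lambda>(i, n). J (f i) (- int n)) w vac"

definition creation_words :: "(nat \<times> nat) list set" where
  "creation_words = lists ({1..d} \<times> {0<..})"

definition word_degree :: "(nat \<times> nat) list \<Rightarrow> nat" where
  "word_degree w = sum_list (map snd w)"

lemma creation_monomial_simps [simp]:
  "creation_monomial [] = vac"
  "creation_monomial ((i, n) # w) = J (f i) (- int n) (creation_monomial w)"
  by (simp_all add: creation_monomial_def)

lemma word_degree_simps [simp]:
  "word_degree [] = 0" "word_degree ((i, n) # w) = n + word_degree w"
  by (simp_all add: word_degree_def)

lemma creation_words_simps [simp]:
  "[] \<in> creation_words"
  "(i, n) # w \<in> creation_words \<longleftrightarrow> 1 \<le> i \<and> i \<le> d \<and> 0 < n \<and> w \<in> creation_words"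
  by (auto simp: creation_words_def)

lemma creation_words_induct [consumes 1, case_names Nil Cons]:
  assumes "w \<in> creation_words" "P []"
    and "\<And>i n w. \<lbrakk>i \<in> {1..d}; 0 < n; w \<in> creation_words; P w\<rbrakk> \<Longrightarrow> P ((i, n) # w)"
  shows "P w"
  using assms(1)
proof (induction w)
  case (Cons a w)
  then show ?case by (cases a) (use assms(3) in auto)
qed (rule assms(2))

lemma creation_monomial_in_M: "w \<in> creation_words \<Longrightarrow> creation_monomial w \<in> M"
  by (induction rule: creation_words_induct) (simp_all add: fock_space_vac J_closed f_in)

text \<open>Creation operators are expanded in the frame; an annihilation operator is moved to the right until it
meets the vacuum.\<close>

lemma J_creation_span:
  assumes "u \<in> k" "x \<in> cspan (creation_monomial ` creation_words)"
  shows "J u m x \<in> cspan (creation_monomial ` creation_words)"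
proof (rule clinear_span_subset[OF J_linear[OF assms(1)] complex_vector.subspace_span _ assms(2)])
  let ?S = "cspan (creation_monomial ` creation_words)"
  have up: "J (f i) (- int n) x \<in> ?S" if "i \<in> {1..d}" "0 < n" "x \<in> ?S" for i n x
  proof (rule clinear_span_subset[OF J_linear complex_vector.subspace_span _ that(3)])
    fix y assume "y \<in> creation_monomial ` creation_words"
    then obtain w where "w \<in> creation_words" "y = creation_monomial w" by blast
    with that show "J (f i) (- int n) y \<in> ?S"
      by (intro complex_vector.span_base image_eqI[of _ _ "(i, n) # w"]) auto
  qed (use f_in that in auto)
  fix y assume "y \<in> creation_monomial ` creation_words"
  then obtain w where w: "w \<in> creation_words" and y: "y = creation_monomial w" by blast
  show "J u m y \<in> ?S"
  proof (cases "m < 0")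
    case True
    have "creation_monomial w \<in> ?S" using w by (intro complex_vector.span_base) auto
    then have "J (f i) m (creation_monomial w) \<in> ?S" if "i \<in> {1..d}" for i
      using up[of i "nat (- m)"] that True by auto
    then show ?thesis
      unfolding y J_frame[OF assms(1) creation_monomial_in_M[OF w]]
      by (intro complex_vector.span_sum complex_vector.span_scale)
  next
    case False
    show ?thesis unfolding y using w
    proof (induction rule: creation_words_induct)
      case Nil
      then show ?case using False assms(1) by (simp add: J_vac complex_vector.span_zero)
    next
      case (Cons i n w)
      have "creation_monomial w \<in> ?S" using Cons by (intro complex_vector.span_base) auto
      moreover have "J u m (creation_monomial ((i, n) # w)) =
          J (f i) (- int n) (J u m (creation_monomial w)) +
          (if m + - int n = 0 then of_int m * B u (f i) else 0) *\<^sub>C creation_monomial w"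
        unfolding creation_monomial_simps
        using Cons assms(1) f_in creation_monomial_in_M by (intro J_commute) auto
      ultimately show ?case
        using up Cons by (simp only: complex_vector.span_add complex_vector.span_scale)
    qed
  qed
qed

lemma fock_space_eq_creation_span: "M = cspan (creation_monomial ` creation_words)"
proof
  let ?S = "cspan (creation_monomial ` creation_words)"
  have "foldr (\<lambda>(u, n). J u n) w vac \<in> ?S" if "set w \<subseteq> k \<times> UNIV" for w
    using that
  proof (induction w)
    case Nil
    then show ?case
      by (auto intro!: complex_vector.span_base image_eqI[of _ _ "[]"])
  next
    case (Cons a w)
    then show ?case by (cases a) (auto intro: J_creation_span)
  qed
  then show "M \<subseteq> ?S"
    unfolding fock_space_def by (intro complex_vector.span_minimal complex_vector.subspace_span) blast
  show "?S \<subseteq> M"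
    by (intro complex_vector.span_minimal subspace_fock_space) (auto intro: creation_monomial_in_M)
qed

text \<open>The degree operator truncated to modes at most \<open>N\<close>.\<close>

text \<open>The operator \<open>\<Sum> f\<^sub>i(-n) f\<^sub>i(n)\<close>, truncated to \<open>n \<le> N\<close> in order to be a finite sum; a given vector
involves only finitely many modes.\<close>

definition degree_operator :: "nat \<Rightarrow> 'm \<Rightarrow> 'm" where
  "degree_operator N x = (\<Sum>n=1..N. \<Sum>i=1..d. J (f i) (- int n) (J (f i) (int n) x))"

lemma clinear_degree_operator: "clinear (degree_operator N)"
  unfolding degree_operator_def
  by (rule clinearI)
    (simp_all add: clinear_add[OF J_linear] clinear_scale[OF J_linear] f_in sum.distrib
      complex_vector.scale_sum_right)

lemma degree_operator_J:
  assumes "j \<in> {1..d}" "0 < m" "m \<le> N" "x \<in> M"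
  shows "degree_operator N (J (f j) (- int m) x) =
    J (f j) (- int m) (degree_operator N x) + of_nat m *\<^sub>C J (f j) (- int m) x"
proof -
  \<comment> \<open>Only the mode \<open>n = m\<close> fails to commute with \<open>f\<^sub>j(-m)\<close>.\<close>
  have "J (f i) (- int n) (J (f i) (int n) (J (f j) (- int m) x)) =
      J (f j) (- int m) (J (f i) (- int n) (J (f i) (int n) x))
        + (if n = m then (of_nat m * B (f j) (f i)) *\<^sub>C J (f i) (- int m) x else 0)"
    if "i \<in> {1..d}" "n \<in> {1..N}" for i n
  proof -
    have "J (f i) (int n) (J (f j) (- int m) x) = J (f j) (- int m) (J (f i) (int n) x)
       + (if int n + - int m = 0 then of_int (int n) * B (f i) (f j) else 0) *\<^sub>C x"
      using that assms by (intro J_commute f_in)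
    moreover have "J (f i) (- int n) (J (f j) (- int m) y) = J (f j) (- int m) (J (f i) (- int n) y)"
      if "y \<in> M" for y
      using J_commute[OF f_in f_in that, of i j "- int n" "- int m"] \<open>i \<in> _\<close> \<open>n \<in> _\<close> assms
      by simp
    ultimately show ?thesis
      using that assms f_in B_sym[of "f i" "f j"]
      by (auto simp: clinear_add[OF J_linear] clinear_scale[OF J_linear] J_closed)
  qed
  then have "degree_operator N (J (f j) (- int m) x) =
      (\<Sum>n=1..N. \<Sum>i=1..d. J (f j) (- int m) (J (f i) (- int n) (J (f i) (int n) x)))
      + (\<Sum>n=1..N. \<Sum>i=1..d. if n = m then (of_nat m * B (f j) (f i)) *\<^sub>C J (f i) (- int m) x else 0)"
    unfolding degree_operator_def sum.distrib[symmetric] by (intro sum.cong refl) simp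
  moreover have "(\<Sum>n=1..N. \<Sum>i=1..d. if n = m then (of_nat m * B (f j) (f i)) *\<^sub>C J (f i) (- int m) x else 0)
     = (\<Sum>i=1..d. (of_nat m * B (f j) (f i)) *\<^sub>C J (f i) (- int m) x)"
    using assms by (subst sum.swap) simp
  moreover have "\<dots> = of_nat m *\<^sub>C J (f j) (- int m) x"
    using assms f_in
    by (simp add: J_frame[of "f j" x] complex_vector.scale_sum_right scaleC_scaleC)
  moreover have "(\<Sum>n=1..N. \<Sum>i=1..d. J (f j) (- int m) (J (f i) (- int n) (J (f i) (int n) x)))
     = J (f j) (- int m) (degree_operator N x)"
    unfolding degree_operator_def using assms f_in by (simp add: clinear_sum[OF J_linear])
  ultimately show ?thesis by simp
qed

lemma degree_operator_creation_monomial: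
  assumes "w \<in> creation_words" "word_degree w \<le> N"
  shows "degree_operator N (creation_monomial w) = of_nat (word_degree w) *\<^sub>C creation_monomial w"
  using assms
proof (induction rule: creation_words_induct)
  case Nil
  have "degree_operator N vac = 0"
    unfolding degree_operator_def
    by (intro sum.neutral ballI) (simp add: J_vac f_in clinear_0[OF J_linear])
  then show ?case by simp
next
  case (Cons i n w)
  then show ?case
    using degree_operator_J[of i n N "creation_monomial w"] f_in[of i] creation_monomial_in_M[of w]
    by (simp add: clinear_scale[OF J_linear] scaleC_add_left)
qed

text \<open>The degree operator kills such a vector, which is therefore a combination of monomials of degree
zero.\<close>

lemma annihilated_in_vac_span:
  assumes x: "x \<in> M" and ann: "\<And>u n. \<lbrakk>u \<in> k; 0 < n\<rbrakk> \<Longrightarrow> J u n x = 0"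
  shows "x \<in> cspan {vac}"
proof -
  obtain W where W: "finite W" "W \<subseteq> creation_words" "x \<in> cspan (creation_monomial ` W)"
    using x in_span_finite_family unfolding fock_space_eq_creation_span by blast
  obtain N where N: "\<And>w. w \<in> W \<Longrightarrow> word_degree w \<le> N"
    using W(1) by (metis finite_nat_set_iff_bounded_le finite_imageI imageI)
  have "degree_operator N x = 0 *\<^sub>C x"
    unfolding degree_operator_def using ann f_in
    by (simp add: clinear_0[OF J_linear])
  then have "x \<in> cspan (creation_monomial ` {w \<in> W. (of_nat (word_degree w) :: complex) = 0})"
    using W N degree_operator_creation_monomial
    by (intro eigenvector_in_span_of_eigenvectors[OF clinear_degree_operator _ W(3)]) auto
  moreover have "creation_monomial ` {w \<in> W. (of_nat (word_degree w) :: complex) = 0} \<subseteq> {vac}"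
  proof -
    have "w = []" if "w \<in> creation_words" "word_degree w = 0" for w
      using that by (cases w) auto
    then show ?thesis using W(2) by fastforce
  qed
  ultimately show ?thesis using complex_vector.span_mono by blast
qed

text \<open>The vectors killed by all products of \<open>N\<close> annihilation operators.\<close>

primrec annihilation_filtration :: "nat \<Rightarrow> 'm set" where
  "annihilation_filtration 0 = {0}"
| "annihilation_filtration (Suc N) =
     {x \<in> M. \<forall>u\<in>k. \<forall>n>0. J u n x \<in> annihilation_filtration N}"

lemma subspace_annihilation_filtration: "csubspace (annihilation_filtration N)"
proof (induction N)
  case (Suc N)
  then show ?case
    using subspace_fock_space[of k J vac]
    by (auto simp: complex_vector.subspace_def clinear_0[OF J_linear] clinear_add[OF J_linear]
        clinear_scale[OF J_linear])
qed simp

lemma annihilation_filtration_Suc: "annihilation_filtration N \<subseteq> annihilation_filtration (Suc N)"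
proof (induction N)
  case 0
  then show ?case
    by (auto simp: complex_vector.subspace_0[OF subspace_fock_space] clinear_0[OF J_linear])
qed auto

lemma annihilation_filtration_mono:
  "N \<le> N' \<Longrightarrow> annihilation_filtration N \<subseteq> annihilation_filtration N'"
  by (rule lift_Suc_mono_le[of annihilation_filtration]) (rule annihilation_filtration_Suc)

lemma creation_annihilation_filtration:
  assumes "u \<in> k" "x \<in> annihilation_filtration N"
  shows "J u n x \<in> annihilation_filtration (Suc N)"
  using assms(2)
proof (induction N arbitrary: x)
  case 0
  then show ?case
    by (auto simp: clinear_0[OF J_linear] assms complex_vector.subspace_0[OF subspace_fock_space])
next
  case (Suc N)
  have "J v m (J u n x) \<in> annihilation_filtration (Suc N)" if "v \<in> k" "m > 0" for v m
  proof -
    have "x \<in> M" using Suc.prems by simp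
    then have "J v m (J u n x) = J u n (J v m x) + (if m + n = 0 then of_int m * B v u else 0) *\<^sub>C x"
      using that assms by (intro J_commute)
    moreover have "J u n (J v m x) \<in> annihilation_filtration (Suc N)"
      using Suc that by simp
    ultimately show ?thesis
      using Suc.prems subspace_annihilation_filtration[of "Suc N"]
      by (simp only: complex_vector.subspace_add complex_vector.subspace_scale)
  qed
  then show ?case using Suc.prems assms(1) by (simp add: J_closed)
qed

lemma exists_annihilation_filtration:
  assumes "x \<in> M"
  shows "\<exists>N. x \<in> annihilation_filtration N"
  using assms unfolding fock_space_eq_creation_span
proof (induction rule: complex_vector.span_induct_alt)
  case base
  then show ?case by (intro exI[of _ 0]) simp
next
  case (step c y z)
  then obtain w where w: "w \<in> creation_words" "y = creation_monomial w" by blast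
  have "\<exists>N. creation_monomial w \<in> annihilation_filtration N"
    using w(1)
  proof (induction rule: creation_words_induct)
    case Nil
    then show ?case
      by (intro exI[of _ "Suc 0"]) (auto simp: fock_space_vac J_vac)
  next
    case (Cons i n w)
    then obtain N where "creation_monomial w \<in> annihilation_filtration N" by blast
    with Cons show ?case
      unfolding creation_monomial_simps by (blast intro: creation_annihilation_filtration f_in)
  qed
  then obtain N1 N2 where "y \<in> annihilation_filtration N1" "z \<in> annihilation_filtration N2"
    using w step by blast
  then have "y \<in> annihilation_filtration (max N1 N2)" "z \<in> annihilation_filtration (max N1 N2)"
    using annihilation_filtration_mono by (meson max.cobounded1 max.cobounded2 subsetD)+
  then show ?case
    using subspace_annihilation_filtration
    by (blast intro: complex_vector.subspace_add complex_vector.subspace_scale)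
qed

text \<open>Irreducibility, in the form in which it is used: as long as some annihilation operator does not kill
the vector, apply it; the process ends at a multiple of the vacuum.\<close>

lemma annihilates_to_vac:
  assumes "x \<in> M" "x \<noteq> 0"
  obtains w c where "set w \<subseteq> k \<times> {0<..}" "c \<noteq> 0" "foldr (\<lambda>(u, n). J u n) w x = c *\<^sub>C vac"
proof -
  obtain N where "x \<in> annihilation_filtration N" using exists_annihilation_filtration assms by blast
  then have "\<exists>w c. set w \<subseteq> k \<times> {0<..} \<and> c \<noteq> 0 \<and> foldr (\<lambda>(u, n). J u n) w x = c *\<^sub>C vac"
    using assms(2)
  proof (induction N arbitrary: x)
    case (Suc N)
    show ?case
    proof (cases "\<forall>u\<in>k. \<forall>n>0. J u n x = 0")
      case True
      then have "x \<in> cspan {vac}"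
        using Suc.prems by (intro annihilated_in_vac_span) auto
      then obtain c where "x = c *\<^sub>C vac"
        by (auto simp: complex_vector.span_singleton)
      with Suc.prems show ?thesis by (intro exI[of _ "[]"] exI[of _ c]) auto
    next
      case False
      then obtain u n where un: "u \<in> k" "n > 0" "J u n x \<noteq> 0" by blast
      then have "J u n x \<in> annihilation_filtration N" using Suc.prems by simp
      from Suc.IH[OF this un(3)] obtain w c where "set w \<subseteq> k \<times> {0<..}" "c \<noteq> 0"
        "foldr (\<lambda>(u, n). J u n) w (J u n x) = c *\<^sub>C vac" by blast
      with un show ?thesis by (intro exI[of _ "w @ [(u, n)]"] exI[of _ c]) auto
    qed
  qed simp
  with that show ?thesis by blast
qed

end

section \<open>Bilinear forms and orthonormal bases\<close>

lemma bilinear_form_linear: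
  assumes "bilinear_form B"
  shows "clinear (B u)" "clinear (\<lambda>u. B u v)"
  using assms by (auto simp: bilinear_form_def clinear_on_UNIV_iff)

lemma bilinear_form_simps:
  assumes "bilinear_form B"
  shows "B (u + v) w = B u w + B v w" "B w (u + v) = B w u + B w v"
    "B (c *\<^sub>C u) w = c * B u w" "B w (c *\<^sub>C u) = c * B w u"
    "B 0 w = 0" "B w 0 = 0" "B (u - v) w = B u w - B v w" "B w (u - v) = B w u - B w v"
    "B (sum g I) w = (\<Sum>i\<in>I. B (g i) w)" "B w (sum g I) = (\<Sum>i\<in>I. B w (g i))"
  using bilinear_form_linear[OF assms, of w] bilinear_form_linear(2)[OF assms, of w]
  by (simp_all add: clinear_add[of "\<lambda>u. B u w"] clinear_scale[of "\<lambda>u. B u w"]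
      clinear_0[of "\<lambda>u. B u w"] clinear_diff[of "\<lambda>u. B u w"] clinear_sum[of "\<lambda>u. B u w"]
      clinear_add[of "B w"] clinear_scale[of "B w"] clinear_0[of "B w"] clinear_diff[of "B w"]
      clinear_sum[of "B w"] scaleC_complex_def)

lemma orthonormal_basis_expansion:
  assumes "bilinear_form B" "orthonormal_basis B d e"
  shows "(\<Sum>i=1..d. B u (e i) *\<^sub>C e i) = u"
proof (rule clinear_eq_on_span[of "\<lambda>u. \<Sum>i=1..d. B u (e i) *\<^sub>C e i" "\<lambda>u. u" "e ` {1..d}"])
  show "clinear (\<lambda>u. \<Sum>i=1..d. B u (e i) *\<^sub>C e i)"
    by (rule clinearI)
      (simp_all add: bilinear_form_simps[OF assms(1)] scaleC_add_left sum.distrib scaleC_scaleC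
        complex_vector.scale_sum_right)
  show "(\<Sum>i=1..d. B x (e i) *\<^sub>C e i) = x" if "x \<in> e ` {1..d}" for x
  proof -
    from that obtain j where j: "j \<in> {1..d}" "x = e j" by blast
    then have "(\<Sum>i=1..d. B x (e i) *\<^sub>C e i) = (\<Sum>i=1..d. if i = j then e j else 0)"
      using assms(2) by (intro sum.cong) (auto simp: orthonormal_basis_def scaleC_one)
    then show ?thesis using j by simp
  qed
  show "u \<in> cspan (e ` {1..d})" using assms(2) by (simp add: orthonormal_basis_def)
qed (simp add: clinearI)

lemma orthonormal_basis_form:
  assumes "bilinear_form B" "symmetric_form B" "orthonormal_basis B d e"
  shows "(\<Sum>i=1..d. B (e i) u * B (e i) v) = B u v"
proof -
  have "B u v = B (\<Sum>i=1..d. B u (e i) *\<^sub>C e i) v"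
    by (simp only: orthonormal_basis_expansion[OF assms(1,3)])
  also have "\<dots> = (\<Sum>i=1..d. B (e i) u * B (e i) v)"
    using assms(2) by (simp add: bilinear_form_simps[OF assms(1)] symmetric_form_def)
  finally show ?thesis ..
qed

section \<open>The affinization\<close>

lemma heis_bracket_loop:
  assumes "bilinear_form B"
  shows "heis_bracket B (loop u m) (loop v n) = (0, if m + n = 0 then of_int m * B u v else 0)"
proof -
  have "Sum_any (\<lambda>j. of_int j * B (Poly_Mapping.lookup (Poly_Mapping.single m u) j)
        (Poly_Mapping.lookup (Poly_Mapping.single n v) (- j))) =
     (\<Sum>j\<in>{m}. of_int j * B (Poly_Mapping.lookup (Poly_Mapping.single m u) j)
        (Poly_Mapping.lookup (Poly_Mapping.single n v) (- j)))"
    by (rule Sum_any.expand_superset)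
      (auto simp: lookup_single when_def bilinear_form_simps[OF assms] split: if_splits)
  then show ?thesis
    by (auto simp: heis_bracket_def loop_def lookup_single when_def bilinear_form_simps[OF assms]
        add_eq_0_iff)
qed

lemma heis_bracket_central:
  assumes "bilinear_form B"
  shows "heis_bracket B (0, c) x = 0"
  by (simp add: heis_bracket_def bilinear_form_simps[OF assms] zero_prod_def)

lemma subspace_affinization: "csubspace k \<Longrightarrow> csubspace (affinization k)"
  by (auto simp: complex_vector.subspace_def affinization_def lookup_add scaleC_prod_def lookup_scaleC)

lemma affinization_UNIV [simp]: "affinization UNIV = UNIV"
  by (simp add: affinization_def)

lemma affinization_mono: "k \<subseteq> k' \<Longrightarrow> affinization k \<subseteq> affinization k'"
  by (auto simp: affinization_def)

lemma affinization_nonneg_mono: "k \<subseteq> k' \<Longrightarrow> affinization_nonneg k \<subseteq> affinization_nonneg k'"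
  using affinization_mono by (auto simp: affinization_nonneg_def)

lemma loop_in_affinization: "csubspace k \<Longrightarrow> u \<in> k \<Longrightarrow> loop u n \<in> affinization k"
  by (auto simp: affinization_def loop_def lookup_single when_def complex_vector.subspace_0)

lemma central_in_affinization: "csubspace k \<Longrightarrow> (0, c) \<in> affinization k"
  by (auto simp: affinization_def complex_vector.subspace_0)

lemma loop_in_affinization_nonneg:
  "csubspace k \<Longrightarrow> u \<in> k \<Longrightarrow> 0 \<le> n \<Longrightarrow> loop u n \<in> affinization_nonneg k"
  by (auto simp: affinization_nonneg_def loop_in_affinization)
    (auto simp: loop_def lookup_single when_def)

lemma central_in_affinization_nonneg: "csubspace k \<Longrightarrow> (0, c) \<in> affinization_nonneg k"
  by (auto simp: affinization_nonneg_def central_in_affinization)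

lemma affine_decomposition:
  "x = (\<Sum>m\<in>Poly_Mapping.keys (fst x). loop (Poly_Mapping.lookup (fst x) m) m) + (0, snd x)"
  by (rule prod_eqI) (simp_all add: fst_sum snd_sum loop_def poly_mapping_sum_monomials)

lemma loop_add: "loop (u + v) n = loop u n + loop v n"
  by (simp add: loop_def prod_eq_iff single_add)

lemma loop_scale: "loop (c *\<^sub>C u) n = c *\<^sub>C loop u n"
proof -
  have "Poly_Mapping.single n (c *\<^sub>C u) = c *\<^sub>C Poly_Mapping.single n u"
    by (rule poly_mapping_eqI) (simp add: lookup_scaleC lookup_single when_def)
  then show ?thesis by (simp add: loop_def scaleC_prod_def scaleC_complex_def)
qed

lemma relator_add:
  assumes "u \<in> lists g" "w \<in> lists g" "x \<in> g" "y \<in> g"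
  shows "word (u @ [x + y] @ w) - word (u @ [x] @ w) - word (u @ [y] @ w) \<in> induced_relators g br p \<chi>"
  unfolding induced_relators_def enveloping_relators_def
  by (rule UnI1, rule UnI1, rule UnI1, intro CollectI exI conjI, rule refl) (fact assms)+

lemma relator_scale:
  assumes "u \<in> lists g" "w \<in> lists g" "x \<in> g"
  shows "word (u @ [c *\<^sub>C x] @ w) - c *\<^sub>C word (u @ [x] @ w) \<in> induced_relators g br p \<chi>"
  unfolding induced_relators_def enveloping_relators_def
  by (rule UnI1, rule UnI1, rule UnI2, intro CollectI exI conjI, rule refl) (fact assms)+

lemma relator_bracket:
  assumes "u \<in> lists g" "w \<in> lists g" "x \<in> g" "y \<in> g"
  shows "word (u @ [x, y] @ w) - word (u @ [y, x] @ w) - word (u @ [br x y] @ w)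
    \<in> induced_relators g br p \<chi>"
  unfolding induced_relators_def enveloping_relators_def
  by (rule UnI1, rule UnI2, intro CollectI exI conjI, rule refl) (fact assms)+

lemma relator_induced:
  assumes "u \<in> lists g" "w \<in> lists p"
  shows "word (u @ w) - prod_list (map \<chi> w) *\<^sub>C word u \<in> induced_relators g br p \<chi>"
  unfolding induced_relators_def
  by (rule UnI2, intro CollectI exI conjI, rule refl) (fact assms)+

text \<open>Linear operators indexed by the affinization such that the words satisfy the defining relations of the
induced module. Both the given vertex algebra and a quotient of the free algebra are instances.\<close>

locale affine_rep =
  fixes k :: "'h::complex_vector set" and B :: "'h \<Rightarrow> 'h \<Rightarrow> complex"
    and act :: "'h affine \<Rightarrow> 'm::complex_vector \<Rightarrow> 'm" and vac :: 'm
  assumes subspace_k: "csubspace k" and bilinear: "bilinear_form B"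
    and act_linear: "x \<in> affinization k \<Longrightarrow> clinear (act x)"
    and relators: "q \<in> induced_relators (affinization k) (heis_bracket B) (affinization_nonneg k) snd \<Longrightarrow>
      eval_words act vac q = 0"
begin

definition word_space :: "'m set" where
  "word_space = cspan {foldr act w vac | w. w \<in> lists (affinization k)}"

lemma word_spaceI: "w \<in> lists (affinization k) \<Longrightarrow> foldr act w vac \<in> word_space"
  unfolding word_space_def by (rule complex_vector.span_base) blast

lemma vac_in_word_space: "vac \<in> word_space"
  using word_spaceI[of "[]"] by simp

lemma eq_on_word_space:
  assumes "clinear f" "clinear g" "x \<in> word_space"
    and "\<And>w. w \<in> lists (affinization k) \<Longrightarrow> f (foldr act w vac) = g (foldr act w vac)"
  shows "f x = g x"
proof (rule clinear_eq_on_span[OF assms(1,2) _ assms(3)[unfolded word_space_def]])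
  show "f m = g m" if "m \<in> {foldr act w vac | w. w \<in> lists (affinization k)}" for m
    using that assms(4) by blast
qed

lemma act_closed:
  assumes "x \<in> affinization k" "m \<in> word_space" shows "act x m \<in> word_space"
  using assms(2) unfolding word_space_def
proof (rule clinear_span_subset[OF act_linear[OF assms(1)] complex_vector.subspace_span, rotated])
  fix m assume "m \<in> {foldr act w vac |w. w \<in> lists (affinization k)}"
  then obtain w where w: "w \<in> lists (affinization k)" "m = foldr act w vac" by blast
  then show "act x m \<in> cspan {foldr act w vac |w. w \<in> lists (affinization k)}"
    using word_spaceI[of "x # w"] assms(1) by (simp add: word_space_def)
qed

lemma eval_diff:
  "eval_words act vac (p + q) = eval_words act vac p + eval_words act vac q"
  "eval_words act vac (p - q) = eval_words act vac p - eval_words act vac q"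
  "eval_words act vac (c *\<^sub>C p) = c *\<^sub>C eval_words act vac p"
  "eval_words act vac (word w) = foldr act w vac"
  by (simp_all add: eval_words_eq_linear_extension clinear_add[OF clinear_linear_extension] clinear_diff[OF clinear_linear_extension]
      clinear_scale[OF clinear_linear_extension] scaleC_one)

lemma act_add:
  assumes "x \<in> affinization k" "y \<in> affinization k" "m \<in> word_space"
  shows "act (x + y) m = act x m + act y m"
proof (rule eq_on_word_space[OF _ _ assms(3)])
  have "x + y \<in> affinization k"
    by (intro complex_vector.subspace_add subspace_affinization subspace_k assms)
  then show "clinear (act (x + y))" by (rule act_linear)
  show "clinear (\<lambda>m. act x m + act y m)"
    using assms by (intro complex_vector_pair.linear_compose_add act_linear)
  fix w assume w: "w \<in> lists (affinization k)"
  have "word ([] @ [x + y] @ w) - word ([] @ [x] @ w) - word ([] @ [y] @ w)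
      \<in> induced_relators (affinization k) (heis_bracket B) (affinization_nonneg k) snd"
    using assms w by (intro relator_add) simp_all
  from relators[OF this] show "act (x + y) (foldr act w vac) = act x (foldr act w vac) + act y (foldr act w vac)"
    by (simp add: eval_diff algebra_simps)
qed

lemma act_scale:
  assumes "x \<in> affinization k" "m \<in> word_space"
  shows "act (c *\<^sub>C x) m = c *\<^sub>C act x m"
proof (rule eq_on_word_space[OF _ _ assms(2)])
  have "c *\<^sub>C x \<in> affinization k"
    by (intro complex_vector.subspace_scale subspace_affinization subspace_k assms)
  then show "clinear (act (c *\<^sub>C x))" by (rule act_linear)
  show "clinear (\<lambda>m. c *\<^sub>C act x m)"
    using act_linear[OF assms(1)]
    by (intro clinearI) (simp_all add: clinear_add clinear_scale scaleC_add_right scaleC_scaleC mult.commute)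
  fix w assume w: "w \<in> lists (affinization k)"
  have "word ([] @ [c *\<^sub>C x] @ w) - c *\<^sub>C word ([] @ [x] @ w)
      \<in> induced_relators (affinization k) (heis_bracket B) (affinization_nonneg k) snd"
    using assms w by (intro relator_scale) simp_all
  from relators[OF this] show "act (c *\<^sub>C x) (foldr act w vac) = c *\<^sub>C act x (foldr act w vac)"
    by (simp add: eval_diff)
qed

lemma bracket_in_affinization: "heis_bracket B x y \<in> affinization k"
  by (simp add: heis_bracket_def central_in_affinization[OF subspace_k])

lemma act_commute:
  assumes "x \<in> affinization k" "y \<in> affinization k" "m \<in> word_space"
  shows "act x (act y m) = act y (act x m) + act (heis_bracket B x y) m"
proof (rule eq_on_word_space[OF _ _ assms(3)])
  have lin: "clinear (act x)" "clinear (act y)" "clinear (act (heis_bracket B x y))"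
    using act_linear assms bracket_in_affinization by auto
  then show "clinear (\<lambda>m. act x (act y m))" "clinear (\<lambda>m. act y (act x m) + act (heis_bracket B x y) m)"
    by (auto intro!: clinearI simp: clinear_add clinear_scale scaleC_add_right)
  fix w assume w: "w \<in> lists (affinization k)"
  have "word ([] @ [x, y] @ w) - word ([] @ [y, x] @ w) - word ([] @ [heis_bracket B x y] @ w)
      \<in> induced_relators (affinization k) (heis_bracket B) (affinization_nonneg k) snd"
    using assms w by (intro relator_bracket) simp_all
  from relators[OF this] show "act x (act y (foldr act w vac)) =
      act y (act x (foldr act w vac)) + act (heis_bracket B x y) (foldr act w vac)"
    by (simp add: eval_diff algebra_simps)
qed

lemma act_nonneg_vac:
  assumes "x \<in> affinization_nonneg k" shows "act x vac = snd x *\<^sub>C vac"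
proof -
  have "word ([] @ [x]) - prod_list (map snd [x]) *\<^sub>C word []
      \<in> induced_relators (affinization k) (heis_bracket B) (affinization_nonneg k) snd"
    using assms by (intro relator_induced) simp_all
  from relators[OF this] show ?thesis by (simp add: eval_diff)
qed

text \<open>The central element acts as a scalar on the vacuum and commutes with all letters.\<close>

lemma act_central:
  assumes "m \<in> word_space" shows "act (0, c) m = c *\<^sub>C m"
proof (rule eq_on_word_space[OF _ _ assms])
  have c: "(0, c) \<in> affinization k" by (rule central_in_affinization[OF subspace_k])
  then show "clinear (act (0, c))" by (rule act_linear)
  show "clinear (\<lambda>m. c *\<^sub>C m)"
    by (intro clinearI) (simp_all add: scaleC_add_right scaleC_scaleC mult.commute)
  fix w assume "w \<in> lists (affinization k)"
  then show "act (0, c) (foldr act w vac) = c *\<^sub>C foldr act w vac"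
  proof (induction w)
    case Nil
    then show ?case
      using act_nonneg_vac[OF central_in_affinization_nonneg[OF subspace_k], of c] by simp
  next
    case (Cons x w)
    then have x: "x \<in> affinization k" and w: "foldr act w vac \<in> word_space"
      using word_spaceI by auto
    have "act 0 (foldr act w vac) = 0"
      using act_scale[OF c w, of 0] by simp
    then show ?case
      using act_commute[OF c x w] Cons x
      by (simp add: heis_bracket_central[OF bilinear] clinear_scale[OF act_linear])
  qed
qed

lemma act_sum:
  assumes "finite I" "\<And>i. i \<in> I \<Longrightarrow> g i \<in> affinization k" "m \<in> word_space"
  shows "act (\<Sum>i\<in>I. g i) m = (\<Sum>i\<in>I. act (g i) m)"
  using assms(1,2)
proof (induction I rule: finite_induct)
  case empty
  then show ?case
    using act_central[OF assms(3), of 0] by (simp add: zero_prod_def)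
next
  case (insert i I)
  then have "(\<Sum>i\<in>I. g i) \<in> affinization k"
    by (intro complex_vector.subspace_sum subspace_affinization subspace_k) auto
  with insert assms(3) show ?case by (simp add: act_add)
qed

lemma act_decomposition:
  assumes "x \<in> affinization k" "m \<in> word_space"
  shows "act x m = (\<Sum>n\<in>Poly_Mapping.keys (fst x). act (loop (Poly_Mapping.lookup (fst x) n) n) m)
    + snd x *\<^sub>C m"
proof -
  have in_k: "Poly_Mapping.lookup (fst x) n \<in> k" for n
    using assms(1) by (simp add: affinization_def)
  have sum_in: "(\<Sum>n\<in>Poly_Mapping.keys (fst x). loop (Poly_Mapping.lookup (fst x) n) n) \<in> affinization k"
    by (intro complex_vector.subspace_sum subspace_affinization subspace_k loop_in_affinization in_k)
  have "act x m = act ((\<Sum>n\<in>Poly_Mapping.keys (fst x). loop (Poly_Mapping.lookup (fst x) n) n) + (0, snd x)) m"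
    by (simp flip: affine_decomposition)
  also have "\<dots> = act (\<Sum>n\<in>Poly_Mapping.keys (fst x). loop (Poly_Mapping.lookup (fst x) n) n) m
      + act (0, snd x) m"
    by (intro act_add sum_in central_in_affinization subspace_k assms)
  finally show ?thesis
    using act_sum[OF finite_keys loop_in_affinization[OF subspace_k in_k] assms(2)]
    by (simp add: act_central[OF assms(2)])
qed

lemma fock_space_eq_word_space: "fock_space k (\<lambda>u n. act (loop u n)) vac = word_space"
proof
  let ?J = "\<lambda>u n. act (loop u n)"
  have lin: "clinear (?J u n)" if "u \<in> k" for u n
    using that by (intro act_linear loop_in_affinization subspace_k)
  have "foldr (\<lambda>(u, n). ?J u n) w vac \<in> word_space" if "set w \<subseteq> k \<times> UNIV" for w
    using that
  proof (induction w)
    case Nil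
    then show ?case by (simp add: vac_in_word_space)
  next
    case (Cons a w)
    then show ?case
      by (cases a) (auto intro!: act_closed loop_in_affinization subspace_k)
  qed
  then show sub: "fock_space k ?J vac \<subseteq> word_space"
    unfolding fock_space_def
    by (intro complex_vector.span_minimal) (auto simp: word_space_def)
  have "foldr act w vac \<in> fock_space k ?J vac" if "w \<in> lists (affinization k)" for w
    using that
  proof (induction w)
    case Nil
    then show ?case by (simp add: fock_space_vac)
  next
    case (Cons x w)
    let ?m = "foldr act w vac"
    have "Poly_Mapping.lookup (fst x) n \<in> k" for n
      using Cons by (simp add: affinization_def)
    with Cons show ?case
      using act_decomposition[of x ?m] word_spaceI[of w]
      by (auto intro!: complex_vector.subspace_add complex_vector.subspace_sum
          complex_vector.subspace_scale subspace_fock_space fock_space_step[of ?J] lin)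
  qed
  then show "word_space \<subseteq> fock_space k ?J vac"
    unfolding word_space_def by (intro complex_vector.span_minimal subspace_fock_space) auto
qed

lemma heisenberg_rep_act:
  assumes "symmetric_form B" "\<And>i. i \<in> {1..d} \<Longrightarrow> f i \<in> k"
    "\<And>u. u \<in> k \<Longrightarrow> (\<Sum>i=1..d. B u (f i) *\<^sub>C f i) = u"
  shows "heisenberg_rep k B (\<lambda>u n. act (loop u n)) vac f d"
proof (rule heisenberg_rep.intro)
  note in_aff = loop_in_affinization[OF subspace_k]
  show "clinear (act (loop u n))" if "u \<in> k" for u n
    using that by (intro act_linear in_aff)
  fix u v x n
  assume uv: "u \<in> k" "v \<in> k" and "x \<in> fock_space k (\<lambda>u n. act (loop u n)) vac"
  then have x: "x \<in> word_space" by (simp add: fock_space_eq_word_space)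
  show "act (loop (u + v) n) x = act (loop u n) x + act (loop v n) x"
    unfolding loop_add using uv x by (intro act_add in_aff)
  show "act (loop u m) (act (loop v n) x) = act (loop v n) (act (loop u m) x)
      + (if m + n = 0 then of_int m * B u v else 0) *\<^sub>C x" for m
    using act_commute[OF in_aff[OF uv(1)] in_aff[OF uv(2)] x] act_central[OF x]
    by (simp add: heis_bracket_loop[OF bilinear])
next
  fix u x n c
  assume u: "u \<in> k" and "x \<in> fock_space k (\<lambda>u n. act (loop u n)) vac"
  then have x: "x \<in> word_space" by (simp add: fock_space_eq_word_space)
  show "act (loop (c *\<^sub>C u) n) x = c *\<^sub>C act (loop u n) x"
    unfolding loop_scale using u x by (intro act_scale loop_in_affinization subspace_k)
next
  fix u :: 'h and n :: int assume "u \<in> k" "0 \<le> n"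
  then show "act (loop u n) vac = 0"
    using act_nonneg_vac[OF loop_in_affinization_nonneg[OF subspace_k]] by (simp add: loop_def)
qed (use assms subspace_k in \<open>auto simp: symmetric_form_def\<close>)

end

section \<open>The power series model and the nonvanishing of the vacuum\<close>

text \<open>A function on exponent vectors is read as the coefficients of a formal power series in the variables
\<open>x\<^sub>i\<close>; then \<open>mult_var i\<close> is multiplication by \<open>x\<^sub>i\<close> and \<open>diff_var i\<close> is \<open>\<partial>/\<partial>x\<^sub>i\<close>.\<close>

definition mult_var :: "'i \<Rightarrow> (('i \<Rightarrow> nat) \<Rightarrow> complex) \<Rightarrow> ('i \<Rightarrow> nat) \<Rightarrow> complex" where
  "mult_var i p \<alpha> = (if \<alpha> i = 0 then 0 else p (\<alpha>(i := \<alpha> i - 1)))"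

definition diff_var :: "'i \<Rightarrow> (('i \<Rightarrow> nat) \<Rightarrow> complex) \<Rightarrow> ('i \<Rightarrow> nat) \<Rightarrow> complex" where
  "diff_var i p \<alpha> = of_nat (\<alpha> i + 1) * p (\<alpha>(i := \<alpha> i + 1))"

text \<open>The mode \<open>e\<^sub>i(m)\<close> multiplies by the variable with index \<open>(i, m)\<close> if \<open>m < 0\<close>, and is \<open>m\<close> times the derivative in the
variable with index \<open>(i, - m)\<close> otherwise.\<close>

fun model_mode :: "nat \<times> int \<Rightarrow> ((nat \<times> int \<Rightarrow> nat) \<Rightarrow> complex) \<Rightarrow> (nat \<times> int \<Rightarrow> nat) \<Rightarrow> complex" where
  "model_mode (i, m) p = (if m < 0 then mult_var (i, m) p else (\<lambda>\<alpha>. of_int m * diff_var (i, - m) p \<alpha>))"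

lemma mult_var_commute: "mult_var i (mult_var j p) = mult_var j (mult_var i p)"
  by (cases "i = j") (auto simp: fun_eq_iff mult_var_def fun_upd_twist)

lemma diff_var_commute: "diff_var i (diff_var j p) = diff_var j (diff_var i p)"
  by (cases "i = j") (auto simp: fun_eq_iff diff_var_def fun_upd_twist)

lemma diff_var_mult_var:
  "diff_var i (mult_var j p) \<alpha> = mult_var j (diff_var i p) \<alpha> + (if i = j then p \<alpha> else 0)"
  by (cases "i = j") (auto simp: diff_var_def mult_var_def fun_upd_twist algebra_simps of_nat_diff)

lemma model_mode_linear:
  "model_mode k (\<lambda>\<alpha>. c * p \<alpha> + c' * q \<alpha>) \<alpha> = c * model_mode k p \<alpha> + c' * model_mode k q \<alpha>"
  by (cases k) (simp add: mult_var_def diff_var_def algebra_simps)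

lemma model_mode_sum:
  assumes "finite I"
  shows "model_mode k (\<lambda>\<alpha>. \<Sum>i\<in>I. c i * p i \<alpha>) \<alpha> = (\<Sum>i\<in>I. c i * model_mode k (p i) \<alpha>)"
  using assms
proof (induction I rule: finite_induct)
  case empty
  then show ?case by (cases k) (simp add: mult_var_def diff_var_def)
next
  case (insert i I)
  then show ?case
    using model_mode_linear[of k "c i" "p i" 1 "\<lambda>\<alpha>. \<Sum>i\<in>I. c i * p i \<alpha>" \<alpha>] by simp
qed

lemma model_mode_commute:
  "model_mode (i, m) (model_mode (j, n) p) \<alpha> =
    model_mode (j, n) (model_mode (i, m) p) \<alpha> + (if i = j \<and> m + n = 0 then of_int m * p \<alpha> else 0)"
proof -
  have s: "mult_var a (\<lambda>\<alpha>. c * p \<alpha>) \<alpha> = c * mult_var a p \<alpha>"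
     "diff_var a (\<lambda>\<alpha>. c * p \<alpha>) \<alpha> = c * diff_var a p \<alpha>" for a :: "nat \<times> int" and c p \<alpha>
    by (simp_all add: mult_var_def diff_var_def)
  consider "m < 0" "n < 0" | "m < 0" "n \<ge> 0" | "m \<ge> 0" "n < 0" | "m \<ge> 0" "n \<ge> 0" by linarith
  then show ?thesis
  proof cases
    case 1
    then show ?thesis by (simp add: mult_var_commute[of "(i, m)"])
  next
    case 2
    then show ?thesis by (auto simp: s diff_var_mult_var algebra_simps)
  next
    case 3
    then show ?thesis by (auto simp: s diff_var_mult_var algebra_simps)
  next
    case 4
    then show ?thesis by (simp add: s diff_var_commute[of "(i, - m)"])
  qed
qed

definition model_act :: "('h::complex_vector \<Rightarrow> 'h \<Rightarrow> complex) \<Rightarrow> (nat \<Rightarrow> 'h) \<Rightarrow> nat \<Rightarrow> 'h affine \<Rightarrow>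
    ((nat \<times> int \<Rightarrow> nat) \<Rightarrow> complex) \<Rightarrow> (nat \<times> int \<Rightarrow> nat) \<Rightarrow> complex" where
  "model_act B e d x p \<alpha> = snd x * p \<alpha> +
    (\<Sum>(i, m)\<in>{1..d} \<times> Poly_Mapping.keys (fst x). B (e i) (Poly_Mapping.lookup (fst x) m) * model_mode (i, m) p \<alpha>)"

definition model_vac :: "('i \<Rightarrow> nat) \<Rightarrow> complex" where
  "model_vac \<alpha> = (if \<alpha> = (\<lambda>_. 0) then 1 else 0)"

context
  fixes B :: "'h::complex_vector \<Rightarrow> 'h \<Rightarrow> complex" and e d
  assumes B: "bilinear_form B" "symmetric_form B" "orthonormal_basis B d e"
begin

lemma model_act_superset:
  assumes "finite K" "Poly_Mapping.keys (fst x) \<subseteq> K"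
  shows "model_act B e d x p \<alpha> = snd x * p \<alpha> +
    (\<Sum>k\<in>{1..d} \<times> K. B (e (fst k)) (Poly_Mapping.lookup (fst x) (snd k)) * model_mode k p \<alpha>)"
  unfolding model_act_def case_prod_unfold
  using assms
  by (auto intro!: sum.mono_neutral_left simp: in_keys_iff bilinear_form_simps[OF B(1)])

lemma model_act_linear:
  "model_act B e d x (\<lambda>\<alpha>. c * p \<alpha> + c' * q \<alpha>) \<alpha> =
    c * model_act B e d x p \<alpha> + c' * model_act B e d x q \<alpha>"
  by (simp add: model_act_def case_prod_unfold model_mode_linear sum.distrib sum_distrib_left
      algebra_simps del: model_mode.simps)

lemma model_act_add:
  "model_act B e d (x + y) p \<alpha> = model_act B e d x p \<alpha> + model_act B e d y p \<alpha>"
proof -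
  let ?K = "Poly_Mapping.keys (fst x) \<union> Poly_Mapping.keys (fst y)"
  have "Poly_Mapping.keys (fst (x + y)) \<subseteq> ?K" by (simp add: Poly_Mapping.keys_add)
  then show ?thesis
    by (simp add: model_act_superset[of ?K] lookup_add bilinear_form_simps[OF B(1)] sum.distrib
      algebra_simps del: model_mode.simps)
qed

lemma model_act_scale: "model_act B e d (c *\<^sub>C x) p \<alpha> = c * model_act B e d x p \<alpha>"
proof -
  have "Poly_Mapping.keys (fst (c *\<^sub>C x)) \<subseteq> Poly_Mapping.keys (fst x)"
    by (auto simp: in_keys_iff scaleC_prod_def lookup_scaleC)
  then show ?thesis
    by (simp add: model_act_superset[of "Poly_Mapping.keys (fst x)"] scaleC_prod_def lookup_scaleC
      bilinear_form_simps[OF B(1)] sum_distrib_left scaleC_complex_def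
      algebra_simps del: model_mode.simps)
qed

lemma model_act_commute:
  "model_act B e d x (model_act B e d y p) \<alpha> =
    model_act B e d y (model_act B e d x p) \<alpha> + model_act B e d (heis_bracket B x y) p \<alpha>"
proof -
  \<comment> \<open>The bracket pairs the mode \<open>m\<close> of \<open>x\<close> with the mode \<open>-m\<close> of \<open>y\<close>, so the common index set is symmetric.\<close>
  define S where "S = (let K = Poly_Mapping.keys (fst x) \<union> Poly_Mapping.keys (fst y) in K \<union> uminus ` K)"
  have Sm: "- m \<in> S" if "m \<in> S" for m
    using that by (auto simp: S_def Let_def)
  have S: "finite S" "Poly_Mapping.keys (fst x) \<subseteq> S" "Poly_Mapping.keys (fst y) \<subseteq> S"
    by (auto simp: S_def Let_def)
  let ?K = "{1..d} \<times> S"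
  define cx where "cx = (\<lambda>k. B (e (fst k)) (Poly_Mapping.lookup (fst x) (snd k)))"
  define cy where "cy = (\<lambda>k. B (e (fst k)) (Poly_Mapping.lookup (fst y) (snd k)))"
  have ax: "model_act B e d x p = (\<lambda>\<alpha>. snd x * p \<alpha> + 1 * (\<Sum>k\<in>?K. cx k * model_mode k p \<alpha>))" for p
    using model_act_superset[OF S(1,2)] by (simp add: fun_eq_iff cx_def)
  have ay: "model_act B e d y p = (\<lambda>\<alpha>. snd y * p \<alpha> + 1 * (\<Sum>k\<in>?K. cy k * model_mode k p \<alpha>))" for p
    using model_act_superset[OF S(1,3)] by (simp add: fun_eq_iff cy_def)
  have fin: "finite ?K" using S by simp
  have com: "(\<Sum>k\<in>?K. \<Sum>l\<in>?K. cx k * (cy l * model_mode k (model_mode l p) \<alpha>)) =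
      (\<Sum>k\<in>?K. \<Sum>l\<in>?K. cx k * (cy l * model_mode l (model_mode k p) \<alpha>))
      + (\<Sum>k\<in>?K. cx k * cy (fst k, - snd k) * of_int (snd k)) * p \<alpha>"
  proof -
    have "(\<Sum>l\<in>?K. cx k * (cy l * model_mode k (model_mode l p) \<alpha>)) =
      (\<Sum>l\<in>?K. cx k * (cy l * model_mode l (model_mode k p) \<alpha>))
      + cx k * cy (fst k, - snd k) * of_int (snd k) * p \<alpha>" if k: "k \<in> ?K" for k
    proof -
      have "cx k * (cy l * model_mode k (model_mode l p) \<alpha>) =
        cx k * (cy l * model_mode l (model_mode k p) \<alpha>) +
        (if l = (fst k, - snd k) then cx k * cy (fst k, - snd k) * of_int (snd k) * p \<alpha> else 0)" for l
      proof (cases "l = (fst k, - snd k)")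
        case True
        show ?thesis
          using model_mode_commute[of "fst k" "snd k" "fst k" "- snd k" p \<alpha>]
          unfolding True by (simp add: algebra_simps del: model_mode.simps)
      next
        case False
        then have "\<not> (fst k = fst l \<and> snd k + snd l = 0)"
          by (auto simp: prod_eq_iff)
        then show ?thesis
          using model_mode_commute[of "fst k" "snd k" "fst l" "snd l" p \<alpha>] False
          by (auto simp del: model_mode.simps)
      qed
      moreover have "(fst k, - snd k) \<in> ?K" using k Sm by auto
      ultimately show ?thesis
        by (simp add: sum.distrib S(1) del: model_mode.simps)
    qed
    then show ?thesis
      by (simp add: sum.distrib sum_distrib_right del: model_mode.simps)
  qed
  have "(\<Sum>k\<in>?K. cx k * cy (fst k, - snd k) * of_int (snd k)) =
      (\<Sum>i=1..d. \<Sum>m\<in>S. cx (i, m) * cy (i, - m) * of_int m)"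
    by (simp add: sum.cartesian_product case_prod_unfold)
  also have "\<dots> = (\<Sum>m\<in>S. of_int m * B (Poly_Mapping.lookup (fst x) m) (Poly_Mapping.lookup (fst y) (- m)))"
  proof (subst sum.swap, rule sum.cong[OF refl])
    fix m
    show "(\<Sum>i=1..d. cx (i, m) * cy (i, - m) * of_int m) =
        of_int m * B (Poly_Mapping.lookup (fst x) m) (Poly_Mapping.lookup (fst y) (- m))"
      unfolding cx_def cy_def fst_conv snd_conv sum_distrib_right[symmetric] orthonormal_basis_form[OF B]
      by (rule mult.commute)
  qed
  also have "\<dots> = snd (heis_bracket B x y)"
    unfolding heis_bracket_def snd_conv
  proof (subst Sum_any.expand_superset[of S])
    show "{m. of_int m * B (Poly_Mapping.lookup (fst x) m) (Poly_Mapping.lookup (fst y) (- m)) \<noteq> 0} \<subseteq> S"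
    proof (rule subsetI, rule ccontr)
      fix m
      assume "m \<in> {m. of_int m * B (Poly_Mapping.lookup (fst x) m) (Poly_Mapping.lookup (fst y) (- m)) \<noteq> 0}"
        and "m \<notin> S"
      moreover from this S(2) have "Poly_Mapping.lookup (fst x) m = 0"
        by (auto simp: in_keys_iff)
      ultimately show False by (simp add: bilinear_form_simps[OF B(1)])
    qed
  qed (use S in simp_all)
  finally have br: "(\<Sum>k\<in>?K. cx k * cy (fst k, - snd k) * of_int (snd k)) = snd (heis_bracket B x y)" .
  have "model_act B e d (heis_bracket B x y) p \<alpha> = snd (heis_bracket B x y) * p \<alpha>"
    by (simp add: model_act_def heis_bracket_def)
  moreover have "model_act B e d x (model_act B e d y p) \<alpha> =
     snd x * (snd y * p \<alpha> + (\<Sum>k\<in>?K. cy k * model_mode k p \<alpha>))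
     + (\<Sum>k\<in>?K. cx k * (snd y * model_mode k p \<alpha>))
     + (\<Sum>k\<in>?K. \<Sum>l\<in>?K. cx k * (cy l * model_mode k (model_mode l p) \<alpha>))"
    unfolding ax ay
    by (simp add: model_mode_linear[where c' = 1, simplified] model_mode_sum S(1) sum.distrib
        distrib_left sum_distrib_left del: model_mode.simps)
  moreover have "model_act B e d y (model_act B e d x p) \<alpha> =
     snd y * (snd x * p \<alpha> + (\<Sum>k\<in>?K. cx k * model_mode k p \<alpha>))
     + (\<Sum>k\<in>?K. cy k * (snd x * model_mode k p \<alpha>))
     + (\<Sum>l\<in>?K. \<Sum>k\<in>?K. cy l * (cx k * model_mode l (model_mode k p) \<alpha>))"
    unfolding ax ay
    by (simp add: model_mode_linear[where c' = 1, simplified] model_mode_sum S(1) sum.distrib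
        distrib_left sum_distrib_left del: model_mode.simps)
  moreover have "(\<Sum>l\<in>?K. \<Sum>k\<in>?K. cy l * (cx k * model_mode l (model_mode k p) \<alpha>)) =
     (\<Sum>k\<in>?K. \<Sum>l\<in>?K. cx k * (cy l * model_mode l (model_mode k p) \<alpha>))"
    by (subst sum.swap) (simp add: mult_ac del: model_mode.simps)
  moreover have "(\<Sum>k\<in>?K. cx k * (snd y * model_mode k p \<alpha>)) = snd y * (\<Sum>k\<in>?K. cx k * model_mode k p \<alpha>)"
    "(\<Sum>k\<in>?K. cy k * (snd x * model_mode k p \<alpha>)) = snd x * (\<Sum>k\<in>?K. cy k * model_mode k p \<alpha>)"
    by (simp_all add: sum_distrib_left mult_ac del: model_mode.simps)
  ultimately show ?thesis
    unfolding com br by (simp add: algebra_simps)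
qed

lemma model_act_vac:
  assumes "x \<in> affinization_nonneg UNIV"
  shows "model_act B e d x model_vac \<alpha> = snd x * model_vac \<alpha>"
proof -
  have "model_mode (i, m) model_vac \<alpha> = 0" if "m \<in> Poly_Mapping.keys (fst x)" for i m
  proof -
    have "m \<ge> 0" using assms that by (force simp: affinization_nonneg_def in_keys_iff)
    moreover have "\<alpha>((i, - m) := Suc n) \<noteq> (\<lambda>_. 0)" for n
      by (metis fun_upd_same nat.distinct(1))
    ultimately show ?thesis by (simp add: diff_var_def model_vac_def)
  qed
  then show ?thesis
    unfolding model_act_def by (auto intro!: sum.neutral simp del: model_mode.simps)
qed

lemma foldr_model_act_linear:
  "foldr (model_act B e d) u (\<lambda>\<alpha>. c * p \<alpha> + c' * q \<alpha>) =
    (\<lambda>\<alpha>. c * foldr (model_act B e d) u p \<alpha> + c' * foldr (model_act B e d) u q \<alpha>)"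
proof (induction u)
  case (Cons x u)
  show ?case unfolding foldr.simps o_apply Cons by (rule ext) (rule model_act_linear)
qed simp

text \<open>The constant coefficient of a word applied to the series \<open>1\<close> is a linear functional that kills all
relations but not the empty word.\<close>

lemma vacuum_word_not_in_relator_span:
  "word [] \<notin> cspan (induced_relators (affinization UNIV) (heis_bracket B) (affinization_nonneg UNIV) snd)"
proof
  let ?\<rho> = "model_act B e d"
  define \<phi> where "\<phi> = linear_extension (\<lambda>w. foldr ?\<rho> w model_vac (\<lambda>_. 0))"
  have lin: "clinear \<phi>" unfolding \<phi>_def by (rule clinear_linear_extension)
  have word: "\<phi> (word w) = foldr ?\<rho> w model_vac (\<lambda>_. 0)" for w
    by (simp add: \<phi>_def scaleC_one)
  note l1 = foldr_model_act_linear[where c = 1 and c' = 1, simplified]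
  note l2 = foldr_model_act_linear[where c' = 0, simplified]
  have "\<phi> r = 0" if r: "r \<in> induced_relators (affinization UNIV) (heis_bracket B) (affinization_nonneg UNIV) snd" for r
  proof -
    from r show ?thesis
      unfolding induced_relators_def enveloping_relators_def
    proof (elim UnE CollectE exE conjE)
      fix u w and x y :: "'h affine"
      assume add: "r = word (u @ [x + y] @ w) - word (u @ [x] @ w) - word (u @ [y] @ w)"
      have "?\<rho> (x + y) p = (\<lambda>\<alpha>. ?\<rho> x p \<alpha> + ?\<rho> y p \<alpha>)" for p
        by (simp add: fun_eq_iff model_act_add)
      then show ?thesis unfolding add by (simp add: clinear_diff[OF lin] word l1)
    next
      fix u w c and x :: "'h affine"
      assume scale: "r = word (u @ [c *\<^sub>C x] @ w) - c *\<^sub>C word (u @ [x] @ w)"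
      have "?\<rho> (c *\<^sub>C x) p = (\<lambda>\<alpha>. c * ?\<rho> x p \<alpha>)" for p
        by (simp add: fun_eq_iff model_act_scale)
      then show ?thesis
        unfolding scale by (simp add: clinear_diff[OF lin] clinear_scale[OF lin] word l2 scaleC_complex_def)
    next
      fix u w and x y :: "'h affine"
      assume br: "r = word (u @ [x, y] @ w) - word (u @ [y, x] @ w) - word (u @ [heis_bracket B x y] @ w)"
      let ?p = "foldr ?\<rho> w model_vac"
      have "?\<rho> x (?\<rho> y ?p) = (\<lambda>\<alpha>. ?\<rho> y (?\<rho> x ?p) \<alpha> + ?\<rho> (heis_bracket B x y) ?p \<alpha>)"
        by (rule ext) (rule model_act_commute)
      then have "foldr ?\<rho> u (?\<rho> x (?\<rho> y ?p)) =
          (\<lambda>\<alpha>. foldr ?\<rho> u (?\<rho> y (?\<rho> x ?p)) \<alpha> + foldr ?\<rho> u (?\<rho> (heis_bracket B x y) ?p) \<alpha>)"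
        by (simp only: l1)
      then show ?thesis unfolding br by (simp add: clinear_diff[OF lin] word)
    next
      fix u w :: "'h affine list"
      assume ind: "r = word (u @ w) - prod_list (map snd w) *\<^sub>C word u" "w \<in> lists (affinization_nonneg UNIV)"
      have "foldr ?\<rho> w model_vac = (\<lambda>\<alpha>. prod_list (map snd w) * model_vac \<alpha>)"
        using ind(2)
      proof (induction w)
        case (Cons x w)
        then have "foldr ?\<rho> w model_vac = (\<lambda>\<alpha>. prod_list (map snd w) * model_vac \<alpha>)" by simp
        then show ?case
          using model_act_linear[of x "prod_list (map snd w)" model_vac 0] Cons(1)
          by (simp add: fun_eq_iff[of "model_act _ _ _ _ _"] model_act_vac mult_ac)
      qed simp
      then show ?thesis
        unfolding ind(1) by (simp add: clinear_diff[OF lin] clinear_scale[OF lin] word l2 scaleC_complex_def)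
    qed
  qed
  moreover assume "word [] \<in> cspan (induced_relators (affinization UNIV) (heis_bracket B) (affinization_nonneg UNIV) snd)"
  ultimately have "\<phi> (word []) = 0"
    by (intro clinear_eq_on_span[OF lin complex_vector_pair.linear_zero, of _ "word []"]) auto
  then show False by (simp add: word model_vac_def)
qed

end

section \<open>Vertex algebras\<close>

lemma gchoose_minus_1: "((- 1 :: complex) gchoose i) = (- 1) ^ i"
  using gbinomial_minus[of "1 :: complex" i] by (simp flip: binomial_gbinomial)

lemma gchoose_minus_2: "((- 2 :: complex) gchoose i) = (- 1) ^ i * of_nat (i + 1)"
proof -
  have "(2 + of_nat i - 1 :: complex) = of_nat (i + 1)" by simp
  then show ?thesis
    using gbinomial_minus[of "2 :: complex" i]
    by (simp flip: binomial_gbinomial del: of_nat_add of_nat_Suc)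
qed

text \<open>Both sides are \<open>\<Sum>\<^sub>j\<^sub>\<in>\<^sub>\<int> T j\<close>, on the right grouped as \<open>{- 1 - i, i}\<close>.\<close>

lemma Sum_any_int_eq_Sum_any_nat:
  fixes T :: "int \<Rightarrow> 'a::comm_monoid_add"
  assumes "finite {j. T j \<noteq> 0}"
  shows "Sum_any T = Sum_any (\<lambda>i::nat. T (- 1 - int i) + T (int i))"
proof -
  define K where "K = Suc (nat (\<Sum>j\<in>{j. T j \<noteq> 0}. \<bar>j\<bar>))"
  have K: "\<bar>j\<bar> < int K" if "T j \<noteq> 0" for j
  proof -
    have "\<bar>j\<bar> \<le> (\<Sum>j\<in>{j. T j \<noteq> 0}. \<bar>j\<bar>)"
      using assms that by (intro member_le_sum) auto
    then show ?thesis by (simp add: K_def)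
  qed
  have split: "{- int K..<int K} = (\<lambda>i. - 1 - int i) ` {..<K} \<union> int ` {..<K}"
  proof (rule set_eqI)
    fix j
    show "j \<in> {- int K..<int K} \<longleftrightarrow> j \<in> (\<lambda>i. - 1 - int i) ` {..<K} \<union> int ` {..<K}"
    proof (cases "j < 0")
      case True
      then show ?thesis by (auto intro!: image_eqI[of _ _ "nat (- 1 - j)"])
    next
      case False
      then show ?thesis by (auto intro!: image_eqI[of _ _ "nat j"])
    qed
  qed
  have "Sum_any T = (\<Sum>j\<in>{- int K..<int K}. T j)"
    using K by (intro Sum_any.expand_superset) (auto simp: abs_less_iff, fastforce+)
  also have "\<dots> = (\<Sum>j\<in>(\<lambda>i. - 1 - int i) ` {..<K}. T j) + (\<Sum>j\<in>int ` {..<K}. T j)"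
    unfolding split by (intro sum.union_disjoint) auto
  also have "\<dots> = (\<Sum>i<K. T (- 1 - int i) + T (int i))"
    by (simp add: sum.reindex inj_on_def sum.distrib)
  also have "\<dots> = Sum_any (\<lambda>i::nat. T (- 1 - int i) + T (int i))"
  proof (rule Sum_any.expand_superset[symmetric])
    show "{i. T (- 1 - int i) + T (int i) \<noteq> 0} \<subseteq> {..<K}"
      using K[of "int _"] K[of "- 1 - int _"] by (force simp: not_less)
  qed simp
  finally show ?thesis .
qed

text \<open>The ambient vertex algebra fills its type; subalgebras are carried by sets.\<close>

locale vertex_algebra_UNIV = vertex_algebra UNIV Y vac
  for Y :: "'v::complex_vector \<Rightarrow> int \<Rightarrow> 'v \<Rightarrow> 'v" and vac :: 'v
begin

lemma clinear_Y_right: "clinear (Y a n)"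
  using Y_linear_right[of a n] by (simp add: clinear_on_UNIV_iff)

lemma clinear_Y_left: "clinear (\<lambda>a. Y a n b)"
  using Y_linear_left[of b n] by (simp add: clinear_on_UNIV_iff)

lemmas Y_right_simps = clinear_add[OF clinear_Y_right] clinear_scale[OF clinear_Y_right]
  clinear_0[OF clinear_Y_right] clinear_diff[OF clinear_Y_right] clinear_sum[OF clinear_Y_right]

lemma Y_left_simps:
  "Y (a + a') n b = Y a n b + Y a' n b" "Y (c *\<^sub>C a) n b = c *\<^sub>C Y a n b" "Y 0 n b = 0"
  "Y (a - a') n b = Y a n b - Y a' n b" "Y (sum g I) n b = (\<Sum>i\<in>I. Y (g i) n b)"
  using clinear_Y_left[of n b]
  by (simp_all add: clinear_add[of "\<lambda>a. Y a n b"] clinear_scale[of "\<lambda>a. Y a n b"]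
      clinear_0[of "\<lambda>a. Y a n b"] clinear_diff[of "\<lambda>a. Y a n b"] clinear_sum[of "\<lambda>a. Y a n b"])

lemma vacuum': "Y vac n a = (if n = - 1 then a else 0)"
  using vacuum by simp

lemma creation': "Y a (- 1) vac = a"
  using creation by simp

lemma creation_nonneg': "0 \<le> n \<Longrightarrow> Y a n vac = 0"
  using creation_nonneg by simp

lemma Y_truncated:
  obtains N where "\<And>n. N \<le> n \<Longrightarrow> Y a n b = 0"
  using truncation[of a b] by auto

lemma commutator_formula:
  "Y a m (Y b n c) - Y b n (Y a m c) =
    Sum_any (\<lambda>i. (of_int m gchoose i) *\<^sub>C Y (Y a (int i) b) (m + n - int i) c)"
proof -
  have "Sum_any (\<lambda>i. (of_int m gchoose i) *\<^sub>C Y (Y a (int i) b) (m + n - int i) c) =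
    Sum_any (\<lambda>i::nat. ((-1) ^ i * (0 gchoose i)) *\<^sub>C
        (Y a (m - int i) (Y b (n + int i) c) - Y b (n - int i) (Y a (m + int i) c)))"
    using borcherds[of a b c m 0 n] by (simp add: scaleC_one)
  also have "\<dots> = (\<Sum>i\<in>{0::nat}. ((-1) ^ i * (0 gchoose i)) *\<^sub>C
        (Y a (m - int i) (Y b (n + int i) c) - Y b (n - int i) (Y a (m + int i) c)))"
  proof (rule Sum_any.expand_superset)
    show "{i::nat. ((-1) ^ i * (0 gchoose i)) *\<^sub>C
        (Y a (m - int i) (Y b (n + int i) c) - Y b (n - int i) (Y a (m + int i) c)) \<noteq> 0} \<subseteq> {0}"
    proof
      fix i :: nat
      assume "i \<in> {i. ((-1) ^ i * (0 gchoose i)) *\<^sub>C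
        (Y a (m - int i) (Y b (n + int i) c) - Y b (n - int i) (Y a (m + int i) c)) \<noteq> 0}"
      then show "i \<in> {0}" by (cases i) auto
    qed
  qed simp
  finally show ?thesis by (simp add: scaleC_one)
qed

lemma iterate_formula:
  "Y (Y a l b) n c = Sum_any (\<lambda>i::nat. ((-1) ^ i * (of_int l gchoose i)) *\<^sub>C
        (Y a (l - int i) (Y b (n + int i) c) - ((-1) powi l) *\<^sub>C Y b (l + n - int i) (Y a (int i) c)))"
proof -
  have "Sum_any (\<lambda>i::nat. (0 gchoose i) *\<^sub>C Y (Y a (l + int i) b) (n - int i) c) =
     (\<Sum>i\<in>{0::nat}. (0 gchoose i) *\<^sub>C Y (Y a (l + int i) b) (n - int i) c)"
  proof (rule Sum_any.expand_superset)
    show "{i::nat. (0 gchoose i) *\<^sub>C Y (Y a (l + int i) b) (n - int i) c \<noteq> 0} \<subseteq> {0}"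
    proof
      fix i :: nat
      assume "i \<in> {i. (0 gchoose i) *\<^sub>C Y (Y a (l + int i) b) (n - int i) c \<noteq> 0}"
      then show "i \<in> {0}" by (cases i) auto
    qed
  qed simp
  then show ?thesis
    using borcherds[of a b c 0 l n] by (simp add: scaleC_one)
qed

lemma commutator_formula_finite:
  assumes "\<And>i. K \<le> i \<Longrightarrow> Y a (int i) b = 0"
  shows "Y a m (Y b n c) = Y b n (Y a m c)
    + (\<Sum>i<K. (of_int m gchoose i) *\<^sub>C Y (Y a (int i) b) (m + n - int i) c)"
proof -
  have "Sum_any (\<lambda>i. (of_int m gchoose i) *\<^sub>C Y (Y a (int i) b) (m + n - int i) c) =
    (\<Sum>i<K. (of_int m gchoose i) *\<^sub>C Y (Y a (int i) b) (m + n - int i) c)"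
    by (rule Sum_any.expand_superset)
      (auto simp: not_le[symmetric] dest!: assms simp: Y_left_simps)
  then show ?thesis using commutator_formula[of a m b n c] by (simp add: algebra_simps)
qed

lemma locality:
  assumes "\<And>i. 0 \<le> i \<Longrightarrow> Y a i b = 0"
  shows "Y a m (Y b n c) = Y b n (Y a m c)"
  using commutator_formula_finite[of 0 a b m n c] assms by simp

lemma iterate_formula_finite:
  assumes "\<And>i. K \<le> i \<Longrightarrow> Y b (n + int i) c = 0" "\<And>i. K \<le> i \<Longrightarrow> Y a (int i) c = 0"
  shows "Y (Y a l b) n c = (\<Sum>i<K. ((-1) ^ i * (of_int l gchoose i)) *\<^sub>C
        (Y a (l - int i) (Y b (n + int i) c) - ((-1) powi l) *\<^sub>C Y b (l + n - int i) (Y a (int i) c)))"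
  unfolding iterate_formula[of a l b n c]
proof (rule Sum_any.expand_superset)
  show "{i. ((-1) ^ i * (of_int l gchoose i)) *\<^sub>C (Y a (l - int i) (Y b (n + int i) c)
      - ((-1) powi l) *\<^sub>C Y b (l + n - int i) (Y a (int i) c)) \<noteq> 0} \<subseteq> {..<K}"
  proof (rule subsetI, rule ccontr)
    fix i
    assume i: "i \<in> {i. ((-1) ^ i * (of_int l gchoose i)) *\<^sub>C (Y a (l - int i) (Y b (n + int i) c)
      - ((-1) powi l) *\<^sub>C Y b (l + n - int i) (Y a (int i) c)) \<noteq> 0}" and "i \<notin> {..<K}"
    then show False using assms[of i] by (simp add: Y_right_simps)
  qed
qed simp

lemma normal_ordered_product:
  "Y (Y a (- 1) b) n c =
    Sum_any (\<lambda>i::nat. Y a (- 1 - int i) (Y b (n + int i) c) + Y b (n - 1 - int i) (Y a (int i) c))"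
proof -
  have *: "(- 1) ^ i * ((- 1 :: complex) gchoose i) = 1" for i
    by (simp add: gchoose_minus_1 flip: power_mult_distrib)
  have "(- 1 + n - int i) = n - 1 - int i" for i by simp
  then show ?thesis
    using iterate_formula[of a "- 1" b n c]
    by (simp add: * scaleC_one power_int_minus)
qed

text \<open>In the iterate formula with \<open>b = \<one>\<close> only one summand survives: the one with \<open>i = - 1 - n\<close> if \<open>n < 0\<close>, and
the one with \<open>i = n - 1\<close> if \<open>n > 0\<close>.\<close>

lemma translation_covariance: "Y (Y a (- 2) vac) n c = - of_int n *\<^sub>C Y a (n - 1) c"
proof -
  have coeff: "(- 1) ^ i * ((- 2 :: complex) gchoose i) = of_nat (i + 1)" for i
    by (simp add: gchoose_minus_2 flip: power_mult_distrib mult.assoc)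
  let ?t = "\<lambda>i::nat. of_nat (i + 1) *\<^sub>C
     ((if n + int i = - 1 then Y a (- 2 - int i) c else 0)
      - (if n - 2 - int i = - 1 then Y a (int i) c else 0))"
  have "Y (Y a (- 2) vac) n c = Sum_any ?t"
    unfolding iterate_formula[of a "- 2" vac n c]
    by (rule arg_cong[of _ _ Sum_any], rule ext)
      (simp add: coeff vacuum' power_int_minus scaleC_one Y_right_simps algebra_simps
        del: of_nat_add of_nat_Suc)
  also have "\<dots> = - of_int n *\<^sub>C Y a (n - 1) c"
  proof -
    consider "n < 0" | "n = 0" | "n > 0" by linarith
    then show ?thesis
    proof cases
      case 1
      then have "Sum_any ?t = (\<Sum>i\<in>{nat (- 1 - n)}. ?t i)"
        by (intro Sum_any.expand_superset) (auto split: if_splits)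
      moreover have "?t (nat (- 1 - n)) = of_nat (nat (- 1 - n) + 1) *\<^sub>C Y a (n - 1) c"
        using 1 by simp
      moreover have "of_nat (nat (- 1 - n) + 1) = - complex_of_int n"
        using 1 by (simp add: of_nat_nat)
      ultimately show ?thesis by simp
    next
      case 2
      then have "Sum_any ?t = (\<Sum>i\<in>{}. ?t i)"
        by (intro Sum_any.expand_superset) (auto split: if_splits)
      with 2 show ?thesis by simp
    next
      case 3
      then have "Sum_any ?t = (\<Sum>i\<in>{nat (n - 1)}. ?t i)"
        by (intro Sum_any.expand_superset) (auto split: if_splits)
      moreover have "?t (nat (n - 1)) = - (of_nat (nat (n - 1) + 1) *\<^sub>C Y a (n - 1) c)"
        using 3 by simp
      moreover have "of_nat (nat (n - 1) + 1) = complex_of_int n"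
        using 3 by (simp add: of_nat_nat)
      ultimately show ?thesis by simp
    qed
  qed
  finally show ?thesis .
qed

lemma translation_product:
  "Y (Y b l v) (- 2) vac = Y b l (Y v (- 2) vac) - of_int l *\<^sub>C Y b (l - 1) v"
proof -
  have "Y v (- 2 + int i) vac = 0" if "2 \<le> i" for i
    using that by (intro creation_nonneg') auto
  then have "Y (Y b l v) (- 2) vac = (\<Sum>i<2. ((-1) ^ i * (of_int l gchoose i)) *\<^sub>C
      (Y b (l - int i) (Y v (- 2 + int i) vac)
       - ((-1) powi l) *\<^sub>C Y v (l + - 2 - int i) (Y b (int i) vac)))"
    by (intro iterate_formula_finite creation_nonneg') auto
  then show ?thesis
    by (simp add: lessThan_nat_numeral numeral_2_eq_2 creation_nonneg' creation' Y_right_simps scaleC_one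
        complex_vector.scale_minus_left)
qed

lemma Y_iterate_commuting:
  assumes "\<And>i. 0 \<le> i \<Longrightarrow> Y a i d = 0" "\<And>i. 0 \<le> i \<Longrightarrow> Y c i d = 0"
  shows "Y (Y a n c) (- 1) d = Y a n (Y c (- 1) d)"
proof -
  have "Y (Y a n c) (- 1) d = (\<Sum>i<1. ((-1) ^ i * (of_int n gchoose i)) *\<^sub>C
      (Y a (n - int i) (Y c (- 1 + int i) d) - ((-1) powi n) *\<^sub>C Y c (n + - 1 - int i) (Y a (int i) d)))"
    using assms by (intro iterate_formula_finite) auto
  then show ?thesis using assms(1)[of 0] by (simp add: scaleC_one Y_right_simps)
qed

text \<open>The normal ordered product \<open>(a\<^sub>-\<^sub>1 b)\<^sub>n\<close> is \<open>\<Sum>\<^sub>i a\<^sub>i b\<^sub>n\<^sub>-\<^sub>i\<^sub>-\<^sub>1\<close> when the modes of \<open>a\<close> and \<open>b\<close> commute. This is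
what makes \<open>a \<otimes> b \<mapsto> a\<^sub>-\<^sub>1 b\<close> a homomorphism from the tensor product.\<close>

lemma product_of_commuting_pairs:
  assumes "\<And>i. 0 \<le> i \<Longrightarrow> Y a i b = 0" "\<And>i. 0 \<le> i \<Longrightarrow> Y c i b = 0"
    and d: "\<And>i n. 0 \<le> i \<Longrightarrow> Y a i (Y b n d) = 0" "\<And>i n. 0 \<le> i \<Longrightarrow> Y c i (Y b n d) = 0"
  shows "Y (Y a (- 1) b) n (Y c (- 1) d) = Sum_any (\<lambda>i. Y (Y a i c) (- 1) (Y b (n - i - 1) d))"
proof -
  let ?T = "\<lambda>i. Y (Y a i c) (- 1) (Y b (n - i - 1) d)"
  obtain N1 where N1: "\<And>n. N1 \<le> n \<Longrightarrow> Y a n c = 0" using Y_truncated by blast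
  obtain N2 where N2: "\<And>n. N2 \<le> n \<Longrightarrow> Y b n d = 0" using Y_truncated by blast
  \<comment> \<open>Truncation for \<open>a\<close> bounds \<open>i\<close> above, truncation for \<open>b\<close> bounds it below.\<close>
  have "i \<in> {n - 1 - N2..N1}" if "?T i \<noteq> 0" for i
  proof (rule ccontr)
    assume "i \<notin> {n - 1 - N2..N1}"
    then consider "N1 \<le> i" | "N2 \<le> n - i - 1" by fastforce
    then show False
      using that N1 N2 by cases (simp_all add: Y_left_simps Y_right_simps)
  qed
  then have fin: "finite {i. ?T i \<noteq> 0}"
    by (rule_tac finite_subset[of _ "{n - 1 - N2..N1}"]) auto
  have T: "Y a j (Y b m (Y c (- 1) d)) = Y (Y a j c) (- 1) (Y b m d)" for j m
  proof -
    have "Y b m (Y c (- 1) d) = Y c (- 1) (Y b m d)"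
      using locality[of c b "- 1" m d] assms(2) by simp
    then show ?thesis using Y_iterate_commuting[of a "Y b m d" c j] d by simp
  qed
  have "Y (Y a (- 1) b) n (Y c (- 1) d) = Sum_any (\<lambda>i::nat. ?T (- 1 - int i) + ?T (int i))"
    unfolding normal_ordered_product
  proof (rule arg_cong[of _ _ Sum_any], rule ext)
    fix i :: nat
    have e: "n - (- 1 - int i) - 1 = n + int i" "n - int i - 1 = n - 1 - int i" by simp_all
    then show "Y a (- 1 - int i) (Y b (n + int i) (Y c (- 1) d))
        + Y b (n - 1 - int i) (Y a (int i) (Y c (- 1) d)) = ?T (- 1 - int i) + ?T (int i)"
      unfolding e using T[of "- 1 - int i" "n + int i"] T[of "int i" "n - 1 - int i"]
        locality[of a b "int i" "n - 1 - int i" "Y c (- 1) d"] assms(1) by simp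
  qed
  then show "Y (Y a (- 1) b) n (Y c (- 1) d) = Sum_any ?T"
    using Sum_any_int_eq_Sum_any_nat[OF fin] by simp
qed

subsection \<open>Subalgebras and commutants\<close>

abbreviation "gen \<equiv> generated_subalgebra UNIV Y vac"
abbreviation "Com \<equiv> commutant UNIV Y"
abbreviation "subalg \<equiv> vertex_subalgebra UNIV Y vac"

lemma subalg_vertex_algebra:
  assumes "subalg U" shows "vertex_algebra U Y vac"
proof
  show "clinear_on U (Y a n)" if "a \<in> U" for a n
    using Y_linear_right[of a n] by (simp add: clinear_on_def)
  show "clinear_on U (\<lambda>a. Y a n b)" if "b \<in> U" for b n
    using Y_linear_left[of b n] by (simp add: clinear_on_def)
qed (use assms truncation vacuum' creation' creation_nonneg' borcherds in
    \<open>auto simp: vertex_subalgebra_def\<close>)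

lemma subalg_gen: "subalg (gen S)"
  unfolding vertex_subalgebra_def generated_subalgebra_def
  by (auto intro!: complex_vector.subspace_Inter)

lemma gen_superset: "S \<subseteq> gen S"
  unfolding generated_subalgebra_def by blast

lemma gen_minimal: "subalg U \<Longrightarrow> S \<subseteq> U \<Longrightarrow> gen S \<subseteq> U"
  unfolding generated_subalgebra_def by blast

lemma commutant_iff: "v \<in> Com S \<longleftrightarrow> (\<forall>s\<in>S. \<forall>n\<ge>0. Y s n v = 0)"
  by (simp add: commutant_def)

lemma commutant_antimono: "S \<subseteq> T \<Longrightarrow> Com T \<subseteq> Com S"
  unfolding commutant_def by blast

lemma subalg_commutant: "subalg (Com S)"
  unfolding vertex_subalgebra_def
proof (intro conjI ballI allI)
  show "csubspace (Com S)"
    by (auto simp: complex_vector.subspace_def commutant_iff Y_right_simps)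
  show "vac \<in> Com S" by (simp add: commutant_iff creation_nonneg')
  fix a b n assume "a \<in> Com S" "b \<in> Com S"
  then have "Y s i a = 0" "Y s i b = 0" if "s \<in> S" "0 \<le> i" for s i
    using that by (auto simp: commutant_iff)
  then have "Y s m (Y a n b) = 0" if "s \<in> S" "0 \<le> m" for s m
    using that locality[of s a m n b] by (simp add: Y_right_simps)
  then show "Y a n b \<in> Com S" by (simp add: commutant_iff Y_right_simps)
qed simp

text \<open>By the iterate formula, \<open>(a\<^sub>l b)\<^sub>n v\<close> with \<open>n \<ge> 0\<close> only involves \<open>a\<^sub>i v\<close> and \<open>b\<^sub>n\<^sub>+\<^sub>i v\<close> with \<open>i \<ge> 0\<close>. This is what makes
the commutant of a set equal to that of the subalgebra it generates.\<close>

lemma subalg_annihilator: "subalg {s. \<forall>n\<ge>0. Y s n v = 0}"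
  unfolding vertex_subalgebra_def
proof (intro conjI ballI allI)
  show "csubspace {s. \<forall>n\<ge>0. Y s n v = 0}"
    by (auto simp: complex_vector.subspace_def Y_left_simps)
  show "vac \<in> {s. \<forall>n\<ge>0. Y s n v = 0}" by (simp add: vacuum')
  fix a b l assume a: "a \<in> {s. \<forall>n\<ge>0. Y s n v = 0}" and b: "b \<in> {s. \<forall>n\<ge>0. Y s n v = 0}"
  have "Y (Y a l b) n v = 0" if "0 \<le> n" for n
    using iterate_formula_finite[of 0 b n v a l] a b that by simp
  then show "Y a l b \<in> {s. \<forall>n\<ge>0. Y s n v = 0}" by simp
qed simp

lemma commutant_gen: "Com (gen S) = Com S"
proof
  show "Com (gen S) \<subseteq> Com S" by (intro commutant_antimono gen_superset)
  show "Com S \<subseteq> Com (gen S)"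
  proof
    fix v assume "v \<in> Com S"
    then have "gen S \<subseteq> {s. \<forall>n\<ge>0. Y s n v = 0}"
      by (intro gen_minimal subalg_annihilator) (auto simp: commutant_iff)
    then show "v \<in> Com (gen S)" by (auto simp: commutant_iff)
  qed
qed

subsection \<open>Conformal vectors\<close>

text \<open>The commutator formula turns the five products into the Virasoro relation, with central charge \<open>c\<close>.\<close>

lemma virasoro_relation:
  assumes "Y \<omega> 0 \<omega> = Y \<omega> (- 2) vac" "Y \<omega> 1 \<omega> = 2 *\<^sub>C \<omega>" "Y \<omega> 2 \<omega> = 0" "Y \<omega> 3 \<omega> = (c / 2) *\<^sub>C vac"
    and "\<And>n. 4 \<le> n \<Longrightarrow> Y \<omega> n \<omega> = 0"
  shows "Y \<omega> (m + 1) (Y \<omega> (n + 1) v) - Y \<omega> (n + 1) (Y \<omega> (m + 1) v) =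
      of_int (m - n) *\<^sub>C Y \<omega> (m + n + 1) v
        + (if m + n = 0 then (of_int (m ^ 3 - m) / 12 * c) *\<^sub>C v else 0)"
proof -
  let ?M = "of_int (m + 1) :: complex"
  have g3: "(?M gchoose 3) = of_int (m ^ 3 - m) / 6"
    by (simp add: gbinomial_prod_rev numeral_3_eq_3 fact_numeral power3_eq_cube field_simps)
  have tr: "Y (Y \<omega> (- 2) vac) (m + n + 2) v = - of_int (m + n + 2) *\<^sub>C Y \<omega> (m + n + 1) v"
    using translation_covariance[of \<omega> "m + n + 2" v] by (simp add: algebra_simps)
  have "Y \<omega> (m + 1) (Y \<omega> (n + 1) v) = Y \<omega> (n + 1) (Y \<omega> (m + 1) v)
      + (\<Sum>i<4. (?M gchoose i) *\<^sub>C Y (Y \<omega> (int i) \<omega>) (m + 1 + (n + 1) - int i) v)"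
    using assms(5) by (intro commutator_formula_finite) auto
  also have "(\<Sum>i<4. (?M gchoose i) *\<^sub>C Y (Y \<omega> (int i) \<omega>) (m + 1 + (n + 1) - int i) v) =
      Y (Y \<omega> 0 \<omega>) (m + n + 2) v + ?M *\<^sub>C Y (Y \<omega> 1 \<omega>) (m + n + 1) v
      + (?M gchoose 2) *\<^sub>C Y (Y \<omega> 2 \<omega>) (m + n) v + (?M gchoose 3) *\<^sub>C Y (Y \<omega> 3 \<omega>) (m + n - 1) v"
  proof -
    have e: "m + 1 + (n + 1) - int i = m + n + 2 - int i" for i by simp
    have "{..<4::nat} = {0, 1, 2, 3}" by auto
    then show ?thesis by (simp add: e scaleC_one algebra_simps)
  qed
  also have "\<dots> = (- of_int (m + n + 2) + 2 * ?M) *\<^sub>C Y \<omega> (m + n + 1) v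
      + (if m + n = 0 then (of_int (m ^ 3 - m) / 6 * (c / 2)) *\<^sub>C v else 0)"
    unfolding assms(1-4) tr Y_left_simps g3 scaleC_add_left[of "- of_int (m + n + 2)" "2 * ?M"] scaleC_scaleC
    by (simp add: vacuum' mult.commute)
  also have "- of_int (m + n + 2) + 2 * ?M = of_int (m - n)" by simp
  finally show ?thesis by (simp add: mult.commute)
qed

end

section \<open>Subalgebras attached to orthogonal projections\<close>

lemma fock_space_subset:
  assumes "csubspace S" "vac \<in> S" "\<And>u n x. u \<in> k \<Longrightarrow> x \<in> S \<Longrightarrow> J u n x \<in> S"
  shows "fock_space k J vac \<subseteq> S"
proof -
  have "foldr (\<lambda>(u, n). J u n) w vac \<in> S" if "set w \<subseteq> k \<times> UNIV" for w
    using that by (induction w) (use assms(2,3) in auto)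
  then show ?thesis
    unfolding fock_space_def by (intro complex_vector.span_minimal assms(1)) blast
qed

lemma subspace_equalizer:
  assumes "clinear f" "clinear g" shows "csubspace {x. f x = g x}"
  using assms
  by (simp add: complex_vector.subspace_def clinear_0 clinear_add clinear_scale)

locale heisenberg_setup =
  fixes B :: "'h::complex_vector \<Rightarrow> 'h \<Rightarrow> complex" and d :: nat and e :: "nat \<Rightarrow> 'h"
    and Y :: "'v::complex_vector \<Rightarrow> int \<Rightarrow> 'v \<Rightarrow> 'v" and vac :: 'v
    and act :: "'h affine \<Rightarrow> 'v \<Rightarrow> 'v" and h :: 'h
  assumes bilinear: "bilinear_form B" and symmetric: "symmetric_form B"
    and nondegenerate: "nondegenerate_on UNIV B"
    and orthonormal: "orthonormal_basis B d e"
    and heisenberg: "heisenberg_vertex_algebra UNIV B UNIV Y vac act"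
begin

text \<open>\<open>J u n\<close> is the operator \<open>u(n)\<close>, and \<open>hv u\<close> the vector \<open>u(-1)\<one>\<close> with which \<open>u\<close> is identified.\<close>

abbreviation "J u n \<equiv> act (loop u n)"
abbreviation "hv u \<equiv> act (loop u (- 1)) vac"

sublocale vertex_algebra_UNIV Y vac
  using heisenberg by (simp add: vertex_algebra_UNIV_def heisenberg_vertex_algebra_def)

lemmas B_simps = bilinear_form_simps[OF bilinear]

lemma B_sym: "B u v = B v u"
  using symmetric by (simp add: symmetric_form_def)

lemma B_eqI: assumes "\<And>u. B u v = B u w" shows "v = w"
proof -
  have "\<forall>u. B (v - w) u = 0" using assms B_sym by (simp add: B_simps)
  then have "v - w = 0" using nondegenerate unfolding nondegenerate_on_def by blast
  then show ?thesis by simp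
qed

lemma free_algebra_UNIV: "q \<in> free_algebra (affinization UNIV)"
  by (simp add: free_algebra_def)

lemma act_linear: "clinear (act x)"
  using heisenberg
  unfolding heisenberg_vertex_algebra_def induced_module_def clinear_on_UNIV_iff affinization_UNIV
  by blast

lemma eval_words_eq_0_iff:
  "eval_words act vac q = 0 \<longleftrightarrow>
     q \<in> cspan (induced_relators (affinization UNIV) (heis_bracket B) (affinization_nonneg UNIV) snd)"
  using heisenberg free_algebra_UNIV
  unfolding heisenberg_vertex_algebra_def induced_module_def by blast

lemma eval_words_surj: "range (eval_words act vac) = UNIV"
proof -
  have "free_algebra (affinization (UNIV :: 'h set)) = UNIV" using free_algebra_UNIV by blast
  then show ?thesis
    using heisenberg unfolding heisenberg_vertex_algebra_def induced_module_def by metis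
qed

lemma Y_hv: "Y (hv u) n v = J u n v"
  using heisenberg unfolding heisenberg_vertex_algebra_def by blast

lemma affine_rep: "affine_rep UNIV B act vac"
proof
  show "csubspace (UNIV :: 'h set)" by simp
  show "eval_words act vac q = 0"
    if "q \<in> induced_relators (affinization UNIV) (heis_bracket B) (affinization_nonneg UNIV) snd" for q
    using that by (simp add: eval_words_eq_0_iff complex_vector.span_base)
qed (use bilinear act_linear in \<open>auto simp: clinear_add clinear_scale\<close>)

lemma word_space_UNIV: "affine_rep.word_space UNIV act vac = UNIV"
proof -
  interpret affine_rep UNIV B act vac by (rule affine_rep)
  have "eval_words act vac q \<in> word_space" for q
    unfolding eval_words_eq_linear_extension
    by (intro in_subspace_linear_extension word_spaceI) (simp_all add: word_space_def)
  then show ?thesis using eval_words_surj by (metis UNIV_eq_I rangeE UNIV_I)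
qed

lemma fock_space_UNIV: "fock_space UNIV (\<lambda>u n. J u n) vac = UNIV"
  using affine_rep.fock_space_eq_word_space[OF affine_rep] word_space_UNIV by simp

lemma e_expansion: "(\<Sum>i=1..d. B u (e i) *\<^sub>C e i) = u"
  by (rule orthonormal_basis_expansion[OF bilinear orthonormal])

lemma heisenberg_rep_UNIV: "heisenberg_rep UNIV B (\<lambda>u n. J u n) vac e d"
  by (rule affine_rep.heisenberg_rep_act[OF affine_rep symmetric]) (simp_all only: e_expansion UNIV_I)

lemma vac_nonzero: "vac \<noteq> 0"
  using vacuum_word_not_in_relator_span[OF bilinear symmetric orthonormal]
    eval_words_eq_0_iff[of "word []"]
  by (simp add: eval_words_eq_linear_extension scaleC_one)

lemma J_add: "J (u + v) n x = J u n x + J v n x"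
  using heisenberg_rep.J_add[OF heisenberg_rep_UNIV] by (simp add: fock_space_UNIV)

lemma J_scale: "J (c *\<^sub>C u) n x = c *\<^sub>C J u n x"
  using heisenberg_rep.J_scale[OF heisenberg_rep_UNIV] by (simp add: fock_space_UNIV)

lemma J_linear_left: "clinear (\<lambda>u. J u n x)"
  by (rule clinearI) (simp_all add: J_add J_scale)

lemmas J_left_simps = J_add J_scale clinear_0[OF J_linear_left] clinear_diff[OF J_linear_left]
  clinear_sum[OF J_linear_left]

lemmas J_right_simps = clinear_add[OF act_linear] clinear_scale[OF act_linear]
  clinear_0[OF act_linear] clinear_diff[OF act_linear] clinear_sum[OF act_linear]

lemma J_commute:
  "J u m (J v n x) = J v n (J u m x) + (if m + n = 0 then of_int m * B u v else 0) *\<^sub>C x"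
  by (rule heisenberg_rep.J_commute[OF heisenberg_rep_UNIV]) (simp_all only: fock_space_UNIV UNIV_I)

lemma J_vac: "0 \<le> n \<Longrightarrow> J u n vac = 0"
  using heisenberg_rep.J_vac[OF heisenberg_rep_UNIV] by simp

lemma J_1_hv: "J u 1 (hv v) = B u v *\<^sub>C vac"
  by (simp add: J_commute[of u 1] J_vac J_right_simps)

lemma J_hv: "0 \<le> n \<Longrightarrow> J u n (hv v) = (if n = 1 then B u v else 0) *\<^sub>C vac"
  by (simp add: J_commute[of u n] J_vac J_right_simps)

lemma J_hv2:
  "0 \<le> n \<Longrightarrow> J u n (J v (- 1) (hv w)) =
    (if n = 1 then B u v *\<^sub>C hv w + B u w *\<^sub>C hv v else 0)"
  by (simp add: J_commute[of u n v] J_hv J_right_simps add.commute)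

lemma J_hv_derivative:
  "0 \<le> n \<Longrightarrow> J u n (J v (- 2) vac) = (if n = 2 then 2 * B u v else 0) *\<^sub>C vac"
  by (simp add: J_commute[of u n] J_vac J_right_simps)

lemma hv_inj: assumes "hv u = hv v" shows "u = v"
proof (rule B_eqI)
  fix w
  have "J w 1 (hv u) = J w 1 (hv v)" using assms by simp
  then show "B w u = B w v" by (simp add: J_1_hv vac_nonzero)
qed

text \<open>For self-adjoint \<open>P\<close>, the effect of the annihilation operators on
\<open>1/2 \<Sum>\<^sub>i e\<^sub>i(-1)(P e\<^sub>i)(-1)\<one> + b(-2)\<one>\<close>. Conformal vectors enter the commutator computations only through
these values. Here \<open>P\<close> is an arbitrary map: for the map attached to a
semi-conformal vector, self-adjointness and idempotency are consequences.\<close>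

definition quadratic_vector :: "('h \<Rightarrow> 'h) \<Rightarrow> 'h \<Rightarrow> 'v \<Rightarrow> bool" where
  "quadratic_vector P b \<omega> \<longleftrightarrow> (\<forall>u. J u 0 \<omega> = 0 \<and> J u 1 \<omega> = hv (P u) \<and>
     J u 2 \<omega> = (2 * B u b) *\<^sub>C vac \<and> (\<forall>n\<ge>3. J u n \<omega> = 0))"

lemma quadratic_vector_commutator:
  assumes "quadratic_vector P b \<omega>"
  shows "J u m (Y \<omega> n x) = Y \<omega> n (J u m x) + of_int m *\<^sub>C J (P u) (m + n - 1) x
    + (if m + n = 1 then of_int (m * (m - 1)) * B u b else 0) *\<^sub>C x"
proof -
  have "Y (hv u) m (Y \<omega> n x) = Y \<omega> n (Y (hv u) m x)
    + (\<Sum>i<3. (of_int m gchoose i) *\<^sub>C Y (Y (hv u) (int i) \<omega>) (m + n - int i) x)"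
    using assms by (intro commutator_formula_finite) (simp add: Y_hv quadratic_vector_def)
  moreover have "{..<3::nat} = {0, 1, 2}" by auto
  moreover have "(of_int m gchoose 2 :: complex) * 2 = of_int (m * (m - 1))"
    by (simp add: gbinomial_prod_rev numeral_2_eq_2 fact_numeral)
  ultimately show ?thesis
    using assms
    by (simp add: Y_hv quadratic_vector_def Y_left_simps vacuum' scaleC_scaleC add.assoc mult.assoc
        flip: mult.assoc[of _ 2])
qed

lemma quadratic_vector_commutator':
  assumes "quadratic_vector P b \<omega>"
  shows "Y \<omega> n (J u m x) = J u m (Y \<omega> n x) - of_int m *\<^sub>C J (P u) (m + n - 1) x
    - (if m + n = 1 then of_int (m * (m - 1)) * B u b else 0) *\<^sub>C x"
  using quadratic_vector_commutator[OF assms, of u m n x] by (simp add: algebra_simps)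

text \<open>For \<open>P = 1\<close> this is \<open>\<omega>\<^sub>h\<close>. In general it is the conformal vector attached to \<open>P h\<close> in the Heisenberg
vertex algebra of the image of \<open>P\<close>, written in the frame \<open>P e\<^sub>i\<close>.\<close>

definition omega :: "('h \<Rightarrow> 'h) \<Rightarrow> 'v" where
  "omega P = (1 / 2) *\<^sub>C (\<Sum>i=1..d. J (P (e i)) (- 1) (hv (P (e i)))) + J (P h) (- 2) vac"

definition image_algebra :: "('h \<Rightarrow> 'h) \<Rightarrow> 'v set" where
  "image_algebra P = gen (hv ` range P)"

end

locale heisenberg_projection = heisenberg_setup B d e Y vac act h
  for B :: "'h::complex_vector \<Rightarrow> 'h \<Rightarrow> complex" and d :: nat and e :: "nat \<Rightarrow> 'h"
    and Y :: "'v::complex_vector \<Rightarrow> int \<Rightarrow> 'v \<Rightarrow> 'v" and vac :: 'v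
    and act :: "'h affine \<Rightarrow> 'v \<Rightarrow> 'v" and h :: 'h +
  fixes P :: "'h \<Rightarrow> 'h"
  assumes P_linear: "clinear P" and P_idem: "P (P u) = P u" and P_adjoint: "B (P u) v = B u (P v)"
begin

lemmas P_simps = clinear_add[OF P_linear] clinear_scale[OF P_linear] clinear_0[OF P_linear]
  clinear_diff[OF P_linear] clinear_sum[OF P_linear]

lemma range_P: "u \<in> range P \<longleftrightarrow> P u = u"
  using P_idem by (metis rangeE rangeI)

lemma subspace_range_P: "csubspace (range P)"
  by (auto simp: complex_vector.subspace_def range_P P_simps)

lemma P_expansion: "(\<Sum>i=1..d. B u (P (e i)) *\<^sub>C P (e i)) = P u"
proof -
  have "(\<Sum>i=1..d. B u (P (e i)) *\<^sub>C P (e i)) = P (\<Sum>i=1..d. B (P u) (e i) *\<^sub>C e i)"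
    by (simp add: P_simps P_adjoint)
  then show ?thesis by (simp only: e_expansion P_idem)
qed

lemma complement: "heisenberg_projection B d e Y vac act (\<lambda>u. u - P u)"
proof
  show "B (u - P u) v = B u (v - P v)" for u v by (simp add: B_simps P_adjoint)
qed (simp_all add: P_simps P_idem complex_vector.scale_right_diff_distrib)

lemma range_complement: "u \<in> range (\<lambda>u. u - P u) \<longleftrightarrow> P u = 0"
  using heisenberg_projection.range_P[OF complement, of u] by auto

sublocale rep: heisenberg_rep "range P" B "\<lambda>u n. J u n" vac "\<lambda>i. P (e i)" d
proof (rule heisenberg_rep.intro)
  show "(\<Sum>i=1..d. B u (P (e i)) *\<^sub>C P (e i)) = u" if "u \<in> range P" for u
    using that by (simp only: P_expansion range_P)
qed (rule act_linear J_add J_scale J_commute J_vac subspace_range_P B_sym rangeI | assumption)+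

lemma omega_quadratic: "quadratic_vector P (P h) (omega P)"
  unfolding quadratic_vector_def
proof (intro allI conjI impI)
  fix u
  show "J u 0 (omega P) = 0" "J u 2 (omega P) = (2 * B u (P h)) *\<^sub>C vac"
    by (simp_all add: omega_def J_right_simps J_hv2 J_hv_derivative)
  show "J u n (omega P) = 0" if "3 \<le> n" for n
    using that by (simp add: omega_def J_right_simps J_hv2 J_hv_derivative)
  have "J u 1 (omega P) = (1 / 2) *\<^sub>C (\<Sum>i=1..d. 2 *\<^sub>C (B u (P (e i)) *\<^sub>C hv (P (e i))))"
    by (simp add: omega_def J_right_simps J_hv2 J_hv_derivative scaleC_scaleC flip: scaleC_add_left)
  also have "\<dots> = hv (\<Sum>i=1..d. B u (P (e i)) *\<^sub>C P (e i))"
    by (simp add: complex_vector.scale_sum_right scaleC_scaleC J_left_simps)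
  finally show "J u 1 (omega P) = hv (P u)" by (simp only: P_expansion)
qed

lemmas omega_commutator = quadratic_vector_commutator'[OF omega_quadratic]

lemma subspace_image_algebra: "csubspace (image_algebra P)" and vac_in_image_algebra: "vac \<in> image_algebra P"
  and Y_closed_image_algebra: "\<lbrakk>a \<in> image_algebra P; b \<in> image_algebra P\<rbrakk> \<Longrightarrow> Y a n b \<in> image_algebra P"
  using subalg_gen[of "hv ` range P"] by (auto simp: vertex_subalgebra_def image_algebra_def)

lemma hv_in_image_algebra: "u \<in> range P \<Longrightarrow> hv u \<in> image_algebra P"
  unfolding image_algebra_def by (intro subsetD[OF gen_superset] imageI)

lemma J_in_image_algebra: "u \<in> range P \<Longrightarrow> x \<in> image_algebra P \<Longrightarrow> J u n x \<in> image_algebra P"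
  using Y_closed_image_algebra[OF hv_in_image_algebra, of u x n] by (simp add: Y_hv)

lemma fock_subset_image_algebra: "fock_space (range P) (\<lambda>u n. J u n) vac \<subseteq> image_algebra P"
  by (intro fock_space_subset subspace_image_algebra vac_in_image_algebra J_in_image_algebra)

lemma omega_in_image_algebra: "omega P \<in> image_algebra P"
  unfolding omega_def
  by (intro complex_vector.subspace_add complex_vector.subspace_scale complex_vector.subspace_sum
      subspace_image_algebra J_in_image_algebra vac_in_image_algebra rangeI)

text \<open>The frames of the image and of the kernel together. Its creation monomials are eigenvectors both for
  the degree in the modes from the image and for that in the modes from the kernel.\<close>

definition mixed_frame :: "nat \<Rightarrow> 'h" where
  "mixed_frame i = (if i \<le> d then P (e i) else e (i - d) - P (e (i - d)))"

lemma mixed_rep: "heisenberg_rep UNIV B (\<lambda>u n. J u n) vac mixed_frame (2 * d)"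
proof (rule heisenberg_rep.intro)
  fix u
  have "{1..2 * d} = {1..d} \<union> (\<lambda>i. i + d) ` {1..d}"
    by (auto simp: image_iff)
  then have "(\<Sum>i=1..2 * d. B u (mixed_frame i) *\<^sub>C mixed_frame i) =
     (\<Sum>i=1..d. B u (mixed_frame i) *\<^sub>C mixed_frame i)
     + (\<Sum>i\<in>(\<lambda>i. i + d) ` {1..d}. B u (mixed_frame i) *\<^sub>C mixed_frame i)"
    by (simp only:) (intro sum.union_disjoint, auto)
  also have "\<dots> = (\<Sum>i=1..d. B u (P (e i)) *\<^sub>C P (e i)) + (\<Sum>i=1..d. B u (e i - P (e i)) *\<^sub>C (e i - P (e i)))"
    by (subst sum.reindex) (simp_all add: mixed_frame_def)
  also have "\<dots> = u"
    unfolding P_expansion heisenberg_projection.P_expansion[OF complement] by simp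
  finally show "(\<Sum>i=1..2 * d. B u (mixed_frame i) *\<^sub>C mixed_frame i) = u" .
qed (rule act_linear J_add J_scale J_commute J_vac complex_vector.subspace_UNIV B_sym UNIV_I | assumption)+

definition mixed_degree :: "(nat \<times> nat) list \<Rightarrow> nat" where
  "mixed_degree w = (\<Sum>(i, n)\<leftarrow>w. if i \<le> d then 0 else n)"

text \<open>On creation monomials in the mixed frame, \<open>(\<omega>\<^sub>Q)\<^sub>1\<close> with \<open>Q = 1 - P\<close> is the degree in the modes from \<open>Q \<hh>\<close>.\<close>

lemma omega_complement_kernel:
  assumes "Y (omega (\<lambda>u. u - P u)) 1 x = 0"
  shows "x \<in> fock_space (range P) (\<lambda>u n. J u n) vac"
proof -
  interpret Q: heisenberg_projection B d e Y vac act h "\<lambda>u. u - P u" by (rule complement)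
  interpret m: heisenberg_rep UNIV B "\<lambda>u n. J u n" vac mixed_frame "2 * d" by (rule mixed_rep)
  let ?L = "Y (omega (\<lambda>u. u - P u)) 1"
  have L: "?L (m.creation_monomial w) = of_nat (mixed_degree w) *\<^sub>C m.creation_monomial w"
    if "w \<in> m.creation_words" for w
    using that
  proof (induction rule: m.creation_words_induct)
    case Nil
    then show ?case by (simp add: mixed_degree_def creation_nonneg')
  next
    case (Cons i n w)
    have "mixed_frame i - P (mixed_frame i) = (if i \<le> d then 0 else mixed_frame i)"
      by (simp add: mixed_frame_def P_simps P_idem)
    with Cons show ?case
      by (simp add: Q.omega_commutator J_left_simps J_right_simps mixed_degree_def
          scaleC_add_left)
  qed
  have "x \<in> cspan (m.creation_monomial ` m.creation_words)"
    using m.fock_space_eq_creation_span fock_space_UNIV by simp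
  moreover have "?L x = 0 *\<^sub>C x" using assms by simp
  ultimately have "x \<in> cspan (m.creation_monomial ` {w \<in> m.creation_words. (of_nat (mixed_degree w) :: complex) = 0})"
    using L by (intro eigenvector_in_span_of_eigenvectors[OF clinear_Y_right]) auto
  moreover have "m.creation_monomial w \<in> fock_space (range P) (\<lambda>u n. J u n) vac"
    if "w \<in> m.creation_words" "mixed_degree w = 0" for w
    using that
  proof (induction rule: m.creation_words_induct)
    case Nil
    then show ?case by (simp add: fock_space_vac)
  next
    case (Cons i n w)
    then have "i \<le> d" "mixed_degree w = 0" by (auto simp: mixed_degree_def split: if_splits)
    moreover from this have "mixed_frame i = P (e i)" by (simp add: mixed_frame_def)
    ultimately show ?case using Cons by (simp add: rep.J_closed)
  qed
  then have "cspan (m.creation_monomial ` {w \<in> m.creation_words. (of_nat (mixed_degree w) :: complex) = 0})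
     \<subseteq> fock_space (range P) (\<lambda>u n. J u n) vac"
    by (intro complex_vector.span_minimal subspace_fock_space) auto
  ultimately show ?thesis by blast
qed

lemma image_algebra_subset_commutant: "image_algebra P \<subseteq> Com (image_algebra (\<lambda>u. u - P u))"
proof -
  have "B (u - P u) (P v) = 0" for u v by (simp add: B_simps P_adjoint P_idem)
  then have "hv ` range P \<subseteq> Com (hv ` range (\<lambda>u. u - P u))"
    by (auto simp: commutant_iff Y_hv J_hv)
  then show ?thesis
    unfolding image_algebra_def commutant_gen by (intro gen_minimal subalg_commutant)
qed

lemma commutant_omega_subset_fock:
  "Com {omega (\<lambda>u. u - P u)} \<subseteq> fock_space (range P) (\<lambda>u n. J u n) vac"
  by (auto simp: commutant_iff intro: omega_complement_kernel)

lemma commutant_image_algebra_subset: "Com (image_algebra (\<lambda>u. u - P u)) \<subseteq> Com {omega (\<lambda>u. u - P u)}"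
  using heisenberg_projection.omega_in_image_algebra[OF complement] by (intro commutant_antimono) simp

text \<open>The circle of inclusions; in particular the span of the monomials in modes from the image is closed
under all products, which is not obvious from the definition.\<close>

lemma image_algebra_eq_fock: "image_algebra P = fock_space (range P) (\<lambda>u n. J u n) vac"
  and image_algebra_eq_commutant: "image_algebra P = Com (image_algebra (\<lambda>u. u - P u))"
  and image_algebra_eq_commutant_omega: "image_algebra P = Com (gen {omega (\<lambda>u. u - P u)})"
  unfolding commutant_gen
  using fock_subset_image_algebra image_algebra_subset_commutant commutant_omega_subset_fock commutant_image_algebra_subset by blast+

text \<open>Both sides have the same commutator with \<open>u(n)\<close> for \<open>u\<close> in the image, and both kill the vacuum.\<close>

lemma omega_0: assumes "a \<in> image_algebra P" shows "Y (omega P) 0 a = Y a (- 2) vac"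
proof -
  have "fock_space (range P) (\<lambda>u n. J u n) vac \<subseteq> {a. Y (omega P) 0 a = Y a (- 2) vac}"
  proof (rule fock_space_subset)
    show "csubspace {a. Y (omega P) 0 a = Y a (- 2) vac}"
      by (rule subspace_equalizer[OF clinear_Y_right clinear_Y_left])
    show "vac \<in> {a. Y (omega P) 0 a = Y a (- 2) vac}" by (simp add: creation_nonneg' vacuum')
    fix u n x assume u: "u \<in> range P" and x: "x \<in> {a. Y (omega P) 0 a = Y a (- 2) vac}"
    show "J u n x \<in> {a. Y (omega P) 0 a = Y a (- 2) vac}"
      using u x translation_product[of "hv u" n x]
      by (auto simp: omega_commutator range_P Y_hv)
  qed
  then show ?thesis using assms image_algebra_eq_fock by auto
qed

lemma omega_1_monomial:
  assumes "w \<in> rep.creation_words"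
  shows "Y (omega P) 1 (rep.creation_monomial w) =
    of_nat (rep.word_degree w) *\<^sub>C rep.creation_monomial w"
  using assms
  by (induction rule: rep.creation_words_induct)
    (simp_all add: creation_nonneg' omega_commutator P_idem J_right_simps scaleC_add_left)

lemma weight_space_eq:
  "weight_space (image_algebra P) Y (omega P) n =
    cspan (rep.creation_monomial ` {w \<in> rep.creation_words. int (rep.word_degree w) = n})"
proof -
  have eq: "{w \<in> rep.creation_words. int (rep.word_degree w) = n} =
      {w \<in> rep.creation_words. (of_nat (rep.word_degree w) :: complex) = of_int n}"
    by (metis (mono_tags, lifting) of_int_eq_iff of_int_of_nat_eq)
  show ?thesis
  proof
    show "weight_space (image_algebra P) Y (omega P) n \<subseteq>
      cspan (rep.creation_monomial ` {w \<in> rep.creation_words. int (rep.word_degree w) = n})"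
      unfolding eq weight_space_def image_algebra_eq_fock rep.fock_space_eq_creation_span
      by (auto intro!: eigenvector_in_span_of_eigenvectors[OF clinear_Y_right] omega_1_monomial)
    show "cspan (rep.creation_monomial ` {w \<in> rep.creation_words. int (rep.word_degree w) = n})
      \<subseteq> weight_space (image_algebra P) Y (omega P) n"
    proof (rule complex_vector.span_minimal)
      show "csubspace (weight_space (image_algebra P) Y (omega P) n)"
        using subspace_image_algebra
        by (auto simp: complex_vector.subspace_def weight_space_def Y_right_simps scaleC_add_right
            scaleC_scaleC mult.commute)
      show "rep.creation_monomial ` {w \<in> rep.creation_words. int (rep.word_degree w) = n}
        \<subseteq> weight_space (image_algebra P) Y (omega P) n"
        using rep.creation_monomial_in_M
        by (auto simp: weight_space_def omega_1_monomial image_algebra_eq_fock)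
    qed
  qed
qed

lemma finite_words_of_degree: "finite {w \<in> rep.creation_words. int (rep.word_degree w) = n}"
proof (rule finite_subset)
  let ?A = "{1..d} \<times> {0..nat n}"
  show "finite {w. set w \<subseteq> ?A \<and> length w \<le> nat n}"
    by (rule finite_lists_length_le) simp
  have "set w \<subseteq> {1..d} \<times> {0..rep.word_degree w} \<and> length w \<le> rep.word_degree w"
    if "w \<in> rep.creation_words" for w
    using that by (induction rule: rep.creation_words_induct) fastforce+
  then show "{w \<in> rep.creation_words. int (rep.word_degree w) = n} \<subseteq> {w. set w \<subseteq> ?A \<and> length w \<le> nat n}"
    by fastforce
qed

lemma omega_hv:
  assumes "v \<in> range P" "0 \<le> n"
  shows "Y (omega P) n (hv v) = J v (n - 2) vac - (if n = 2 then 2 * B v (P h) else 0) *\<^sub>C vac"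
  using assms
  by (simp add: omega_commutator range_P creation_nonneg' J_right_simps complex_vector.scale_minus_left scaleC_one)

lemma omega_hv2:
  assumes "v \<in> range P" "1 \<le> n"
  shows "Y (omega P) n (J v (- 1) (hv v)) =
    (if n = 1 then 2 *\<^sub>C J v (- 1) (hv v) else if n = 2 then - (4 * B v (P h)) *\<^sub>C hv v
     else if n = 3 then B v v *\<^sub>C vac else 0)"
proof -
  have two: "x + x = 2 *\<^sub>C x" for x :: 'v
    using scaleC_add_left[of 1 1 x] by (simp add: scaleC_one)
  have four: "- (2 * c) *\<^sub>C x - (2 * c) *\<^sub>C x = - (4 * c) *\<^sub>C x" for x :: 'v and c
  proof -
    have "- (2 * c) *\<^sub>C x - (2 * c) *\<^sub>C x = (- (2 * c) - 2 * c) *\<^sub>C x"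
      by (simp only: complex_vector.scale_left_diff_distrib)
    then show ?thesis by simp
  qed
  have J0: "J v (n - 2) vac = (if n = 1 then hv v else 0)"
    using assms J_vac[of "n - 2" v] by auto
  have J1: "J v (n - 2) (hv v) = (if n = 1 then J v (- 1) (hv v) else if n = 3 then B v v *\<^sub>C vac else 0)"
    using assms J_hv[of "n - 2" v v] by auto
  have "Y (omega P) n (J v (- 1) (hv v)) = J v (- 1) (Y (omega P) n (hv v)) + J v (n - 2) (hv v)
      - (if n = 2 then 2 * B v (P h) else 0) *\<^sub>C hv v"
    using assms by (simp add: omega_commutator range_P complex_vector.scale_minus_left scaleC_one)
  then show ?thesis
    using assms four[of "B v (P h)" "hv v"]
    by (auto simp: omega_hv J0 J1 J_right_simps two complex_vector.scale_minus_left)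
qed

lemma omega_hv_derivative:
  assumes "v \<in> range P" "1 \<le> n"
  shows "Y (omega P) n (J v (- 2) vac) =
    (if n = 1 then 2 *\<^sub>C J v (- 2) vac else if n = 2 then 2 *\<^sub>C hv v
     else if n = 3 then - (6 * B v (P h)) *\<^sub>C vac else 0)"
proof -
  have J0: "J v (n - 3) vac = (if n = 1 then J v (- 2) vac else if n = 2 then hv v else 0)"
    using assms J_vac[of "n - 3" v] by auto
  show ?thesis
    using assms
    by (simp add: omega_commutator range_P creation_nonneg' J_right_simps J0)
qed

text \<open>The central charge is \<open>tr P - 12 \<langle>P h, P h\<rangle>\<close>.\<close>

lemma omega_OPE:
  shows "Y (omega P) 0 (omega P) = Y (omega P) (- 2) vac"
    and "Y (omega P) 1 (omega P) = 2 *\<^sub>C omega P"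
    and "Y (omega P) 2 (omega P) = 0"
    and "Y (omega P) 3 (omega P) = (((\<Sum>i=1..d. B (P (e i)) (P (e i))) - 12 * B (P h) (P h)) / 2) *\<^sub>C vac"
    and "4 \<le> n \<Longrightarrow> Y (omega P) n (omega P) = 0"
proof -
  have expand: "Y (omega P) n (omega P) =
     (1 / 2) *\<^sub>C (\<Sum>i=1..d. Y (omega P) n (J (P (e i)) (- 1) (hv (P (e i))))) + Y (omega P) n (J (P h) (- 2) vac)" for n
    by (subst (2) omega_def) (simp add: Y_right_simps)
  show "Y (omega P) 0 (omega P) = Y (omega P) (- 2) vac" by (rule omega_0[OF omega_in_image_algebra])
  have "2 *\<^sub>C omega P = (\<Sum>i=1..d. J (P (e i)) (- 1) (hv (P (e i)))) + 2 *\<^sub>C J (P h) (- 2) vac"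
    by (simp add: omega_def scaleC_add_right scaleC_scaleC scaleC_one)
  then show "Y (omega P) 1 (omega P) = 2 *\<^sub>C omega P"
    unfolding expand
    by (simp add: omega_hv2 omega_hv_derivative scaleC_scaleC scaleC_one
        flip: complex_vector.scale_sum_right)
  have "(1 / 2) *\<^sub>C (\<Sum>i=1..d. - (4 * B (P (e i)) (P h)) *\<^sub>C hv (P (e i)))
     = - 2 *\<^sub>C hv (\<Sum>i=1..d. B (P h) (P (e i)) *\<^sub>C P (e i))"
    by (simp add: J_left_simps complex_vector.scale_sum_right scaleC_scaleC B_sym[of "P h"])
  then show "Y (omega P) 2 (omega P) = 0"
    unfolding expand P_expansion by (simp add: omega_hv2 omega_hv_derivative P_idem)
  show "Y (omega P) 3 (omega P) = (((\<Sum>i=1..d. B (P (e i)) (P (e i))) - 12 * B (P h) (P h)) / 2) *\<^sub>C vac"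
    unfolding expand
    by (simp add: omega_hv2 omega_hv_derivative diff_divide_distrib complex_vector.scale_left_diff_distrib
        scaleC_scaleC flip: complex_vector.scale_sum_left)
  show "Y (omega P) n (omega P) = 0" if "4 \<le> n"
    unfolding expand using that by (simp add: omega_hv2 omega_hv_derivative)
qed

lemma vertex_operator_algebra_image_algebra: "vertex_operator_algebra (image_algebra P) Y vac (omega P)"
proof -
  interpret U: vertex_algebra "image_algebra P" Y vac
    unfolding image_algebra_def by (intro subalg_vertex_algebra subalg_gen)
  show ?thesis
  proof
    show "omega P \<in> image_algebra P" by (rule omega_in_image_algebra)
    show "\<exists>c::complex. \<forall>m n. \<forall>v\<in>image_algebra P.
      Y (omega P) (m + 1) (Y (omega P) (n + 1) v) - Y (omega P) (n + 1) (Y (omega P) (m + 1) v) =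
      of_int (m - n) *\<^sub>C Y (omega P) (m + n + 1) v
        + (if m + n = 0 then (of_int (m ^ 3 - m) / 12 * c) *\<^sub>C v else 0)"
      using virasoro_relation[OF omega_OPE] by blast
    show "Y (Y (omega P) 0 a) n b = - of_int n *\<^sub>C Y a (n - 1) b" if "a \<in> image_algebra P" for a b n
      using omega_0[OF that] translation_covariance by simp
    show "\<exists>B. finite B \<and> weight_space (image_algebra P) Y (omega P) n = cspan B" for n
      using weight_space_eq finite_words_of_degree by blast
    show "\<exists>N. \<forall>n<N. weight_space (image_algebra P) Y (omega P) n = {0}"
      by (intro exI[of _ 0]) (auto simp: weight_space_eq)
    show "image_algebra P = cspan (\<Union>n. weight_space (image_algebra P) Y (omega P) n)"
    proof
      have "rep.creation_monomial w \<in> (\<Union>n. weight_space (image_algebra P) Y (omega P) n)"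
        if "w \<in> rep.creation_words" for w
        using that unfolding weight_space_eq by (auto intro!: complex_vector.span_base)
      then show "image_algebra P \<subseteq> cspan (\<Union>n. weight_space (image_algebra P) Y (omega P) n)"
        unfolding image_algebra_eq_fock rep.fock_space_eq_creation_span
        by (intro complex_vector.span_mono) (auto simp: image_algebra_eq_fock rep.fock_space_eq_creation_span)
      show "cspan (\<Union>n. weight_space (image_algebra P) Y (omega P) n) \<subseteq> image_algebra P"
        by (intro complex_vector.span_minimal subspace_image_algebra) (auto simp: weight_space_def)
    qed
  qed
qed

end

section \<open>The induced module of a nondegenerate subspace\<close>

definition letter_mult :: "'g \<Rightarrow> ('g list \<Rightarrow>\<^sub>0 complex) \<Rightarrow> ('g list \<Rightarrow>\<^sub>0 complex)" where
  "letter_mult x = linear_extension (\<lambda>w. word (x # w))"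

lemma clinear_letter_mult: "clinear (letter_mult x)"
  unfolding letter_mult_def by (rule clinear_linear_extension)

lemma letter_mult_word [simp]: "letter_mult x (word w) = word (x # w)"
  by (simp add: letter_mult_def scaleC_one)

lemma foldr_letter_mult_word: "foldr letter_mult w (word w') = word (w @ w')"
  by (induction w) simp_all

lemma subspace_free_algebra: "csubspace (free_algebra g)"
proof (rule complex_vector.subspaceI)
  show "x + y \<in> free_algebra g" if "x \<in> free_algebra g" "y \<in> free_algebra g" for x y
    using that Poly_Mapping.keys_add[of x y] unfolding free_algebra_def by auto
  show "c *\<^sub>C x \<in> free_algebra g" if "x \<in> free_algebra g" for c x
  proof -
    have "Poly_Mapping.keys (c *\<^sub>C x) \<subseteq> Poly_Mapping.keys x"
      by (auto simp: in_keys_iff lookup_scaleC scaleC_complex_def)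
    then show ?thesis using that unfolding free_algebra_def by auto
  qed
qed (simp add: free_algebra_def)

lemma word_in_free_algebra: "w \<in> lists g \<Longrightarrow> word w \<in> free_algebra g"
  by (simp add: free_algebra_def)

lemma induced_relators_cases:
  assumes "q \<in> induced_relators g br p \<chi>"
  obtains (add) u w x y where "q = word (u @ [x + y] @ w) - word (u @ [x] @ w) - word (u @ [y] @ w)"
      "u \<in> lists g" "w \<in> lists g" "x \<in> g" "y \<in> g"
    | (scale) u w c x where "q = word (u @ [c *\<^sub>C x] @ w) - c *\<^sub>C word (u @ [x] @ w)"
      "u \<in> lists g" "w \<in> lists g" "x \<in> g"
    | (bracket) u w x y where "q = word (u @ [x, y] @ w) - word (u @ [y, x] @ w) - word (u @ [br x y] @ w)"
      "u \<in> lists g" "w \<in> lists g" "x \<in> g" "y \<in> g"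
    | (induced) u w where "q = word (u @ w) - prod_list (map \<chi> w) *\<^sub>C word u" "u \<in> lists g" "w \<in> lists p"
proof -
  from assms show thesis
    unfolding induced_relators_def enveloping_relators_def
  proof (elim UnE CollectE exE conjE)
  qed (rule that; assumption)+
qed

lemma induced_relators_mono:
  assumes "g \<subseteq> g'" "p \<subseteq> p'"
  shows "induced_relators g br p \<chi> \<subseteq> induced_relators g' br p' \<chi>"
proof
  have l: "lists g \<subseteq> lists g'" "lists p \<subseteq> lists p'"
    using assms by (auto intro: lists_mono)
  fix q assume "q \<in> induced_relators g br p \<chi>"
  then show "q \<in> induced_relators g' br p' \<chi>"
  proof (cases rule: induced_relators_cases)
    case add
    then show ?thesis unfolding add(1) using l assms by (intro relator_add) blast+
  next
    case scale
    then show ?thesis unfolding scale(1) using l assms by (intro relator_scale) blast+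
  next
    case bracket
    then show ?thesis unfolding bracket(1) using l assms by (intro relator_bracket) blast+
  next
    case induced
    then show ?thesis unfolding induced(1) using l by (intro relator_induced) blast+
  qed
qed

lemma induced_relators_in_free_algebra:
  assumes "csubspace g" "p \<subseteq> g" "\<And>x y. x \<in> g \<Longrightarrow> y \<in> g \<Longrightarrow> br x y \<in> g"
    and "q \<in> induced_relators g br p \<chi>"
  shows "q \<in> free_algebra g"
proof -
  note sub = complex_vector.subspace_diff[OF subspace_free_algebra]
    complex_vector.subspace_scale[OF subspace_free_algebra] word_in_free_algebra
  note g = complex_vector.subspace_add[OF assms(1)] complex_vector.subspace_scale[OF assms(1)] assms(3)
  show ?thesis
    using assms(4)
  proof (cases rule: induced_relators_cases)
    case add
    then show ?thesis unfolding add(1) by (intro sub) (simp_all add: g)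
  next
    case scale
    then show ?thesis unfolding scale(1) by (intro sub) (simp_all add: g)
  next
    case bracket
    then show ?thesis unfolding bracket(1) by (intro sub) (simp_all add: g)
  next
    case induced
    then show ?thesis
      unfolding induced(1) using assms(2) by (intro sub) auto
  qed
qed

lemma letter_mult_induced_relators:
  assumes "x \<in> g" "q \<in> induced_relators g br p \<chi>"
  shows "letter_mult x q \<in> induced_relators g br p \<chi>"
proof -
  note lin = clinear_diff[OF clinear_letter_mult] clinear_scale[OF clinear_letter_mult] letter_mult_word
  show ?thesis
    using assms(2)
  proof (cases rule: induced_relators_cases)
    case (add u w y z)
    then show ?thesis
      unfolding add(1) lin append_Cons[symmetric] using assms(1) by (intro relator_add) simp_all
  next
    case (scale u w c y)
    then show ?thesis
      unfolding scale(1) lin append_Cons[symmetric] using assms(1) by (intro relator_scale) simp_all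
  next
    case (bracket u w y z)
    then show ?thesis
      unfolding bracket(1) lin append_Cons[symmetric] using assms(1) by (intro relator_bracket) simp_all
  next
    case (induced u w)
    then show ?thesis
      unfolding induced(1) lin append_Cons[symmetric] using assms(1) by (intro relator_induced) simp_all
  qed
qed

lemma eval_words_letter_mult:
  assumes "clinear (act x)"
  shows "eval_words act m (letter_mult x q) = act x (eval_words act m q)"
proof -
  have "eval_words act m (letter_mult x q) = linear_extension (\<lambda>w. act x (foldr act w m)) q"
    unfolding letter_mult_def eval_words_eq_linear_extension
    by (simp add: clinear_comp_linear_extension[OF clinear_linear_extension] scaleC_one)
  then show ?thesis
    by (simp add: eval_words_eq_linear_extension clinear_comp_linear_extension[OF assms])
qed

context heisenberg_projection
begin

abbreviation "k \<equiv> range P"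
abbreviation "relators_k \<equiv> induced_relators (affinization k) (heis_bracket B) (affinization_nonneg k) snd"
abbreviation "relators_h \<equiv> induced_relators (affinization UNIV) (heis_bracket B) (affinization_nonneg UNIV) snd"

lemma relators_k_subset: "relators_k \<subseteq> relators_h"
  by (intro induced_relators_mono affinization_mono affinization_nonneg_mono) auto

lemma bracket_in_affinization_k: "heis_bracket B x y \<in> affinization k"
  by (simp add: heis_bracket_def central_in_affinization[OF subspace_range_P])

lemma relators_k_in_free_algebra: "q \<in> relators_k \<Longrightarrow> q \<in> free_algebra (affinization k)"
  by (rule induced_relators_in_free_algebra)
    (auto intro: subspace_affinization subspace_range_P bracket_in_affinization_k
      simp: affinization_nonneg_def)

lemma affine_rep_k: "affine_rep k B act vac"
proof (rule affine_rep.intro)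
  show "eval_words act vac q = 0" if "q \<in> relators_k" for q
    using that relators_k_subset eval_words_eq_0_iff complex_vector.span_base by blast
qed (rule subspace_range_P bilinear act_linear)+

text \<open>The quotient of the free algebra of the image by its own relations is realized inside the free algebra
by a projection \<open>\<pi>\<close>. If \<open>\<pi> q\<close> were nonzero, some annihilation word \<open>w\<close> would send it to a nonzero
multiple \<open>c\<close> of the vacuum, so \<open>w q\<close> would agree with \<open>c\<close> modulo the relations; these hold in the ambient
vertex algebra, where \<open>q\<close> and hence \<open>w q\<close> evaluate to zero while the vacuum does not vanish.\<close>

lemma eval_words_kernel:
  assumes q: "q \<in> free_algebra (affinization k)" and eval: "eval_words act vac q = 0"
  shows "q \<in> cspan relators_k"
proof (rule ccontr)
  assume not_in: "q \<notin> cspan relators_k"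
  obtain \<pi> :: "('h affine list \<Rightarrow>\<^sub>0 complex) \<Rightarrow> ('h affine list \<Rightarrow>\<^sub>0 complex)"
    where pi: "clinear \<pi>" "\<And>x. \<pi> x = 0 \<longleftrightarrow> x \<in> cspan relators_k" "\<And>x. x - \<pi> x \<in> cspan relators_k"
    by (rule exists_projection_with_kernel[OF complex_vector.subspace_span[of relators_k]]) (rule that)
  define act' where "act' = (\<lambda>x v. \<pi> (letter_mult x v))"
  define vac' where "vac' = \<pi> (word [])"
  have act'_linear: "clinear (act' x)" for x
    unfolding act'_def
    by (intro clinearI) (simp_all add: clinear_add[OF pi(1)] clinear_scale[OF pi(1)]
        clinear_add[OF clinear_letter_mult] clinear_scale[OF clinear_letter_mult])
  have act'_pi: "act' x (\<pi> v) = \<pi> (letter_mult x v)" if "x \<in> affinization k" for x v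
  proof -
    have "letter_mult x (v - \<pi> v) \<in> cspan relators_k"
      by (rule clinear_span_subset[OF clinear_letter_mult complex_vector.subspace_span _ pi(3)])
        (intro complex_vector.span_base letter_mult_induced_relators that)
    then have "\<pi> (letter_mult x (v - \<pi> v)) = 0" by (simp only: pi(2))
    then show ?thesis
      by (simp add: act'_def clinear_diff[OF clinear_letter_mult] clinear_diff[OF pi(1)])
  qed
  have foldr_act': "foldr act' w (\<pi> v) = \<pi> (foldr letter_mult w v)"
    if "w \<in> lists (affinization k)" for w v
    using that by (induction w) (simp_all add: act'_pi)
  have eval': "eval_words act' vac' p = \<pi> p" if "p \<in> free_algebra (affinization k)" for p
  proof -
    have "eval_words act' vac' p = linear_extension (\<lambda>w. \<pi> (word w)) p"
      unfolding eval_words_def linear_extension_def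
    proof (rule sum.cong[OF refl])
      fix w assume "w \<in> Poly_Mapping.keys p"
      then have "w \<in> lists (affinization k)" using that by (auto simp: free_algebra_def)
      then show "Poly_Mapping.lookup p w *\<^sub>C foldr act' w vac' = Poly_Mapping.lookup p w *\<^sub>C \<pi> (word w)"
        by (simp add: vac'_def foldr_act' foldr_letter_mult_word)
    qed
    also have "\<dots> = \<pi> p" by (rule clinear_eq_linear_extension[OF pi(1), symmetric])
    finally show ?thesis .
  qed
  interpret r: affine_rep k B act' vac'
  proof (rule affine_rep.intro)
    show "eval_words act' vac' p = 0" if "p \<in> relators_k" for p
      using that by (simp add: eval' relators_k_in_free_algebra pi(2) complex_vector.span_base)
  qed (rule subspace_range_P bilinear act'_linear)+
  interpret h: heisenberg_rep k B "\<lambda>u n. act' (loop u n)" vac' "\<lambda>i. P (e i)" d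
    by (rule r.heisenberg_rep_act[OF symmetric rep.f_in rep.frame])
  have "\<pi> q \<in> r.word_space"
    unfolding eval'[OF q, symmetric] eval_words_eq_linear_extension
    using q by (intro in_subspace_linear_extension r.word_spaceI)
      (auto simp: r.word_space_def free_algebra_def)
  then have "\<pi> q \<in> h.M" by (simp add: r.fock_space_eq_word_space)
  moreover have "\<pi> q \<noteq> 0" using not_in pi(2) by simp
  ultimately obtain w c where w: "set w \<subseteq> k \<times> {0<..}" "c \<noteq> 0"
      "foldr (\<lambda>(u, n). act' (loop u n)) w (\<pi> q) = c *\<^sub>C vac'"
    by (rule h.annihilates_to_vac)
  define ws where "ws = map (\<lambda>(u, n). loop u n) w"
  have ws: "ws \<in> lists (affinization k)"
    using w(1) unfolding ws_def
    by (induction w) (auto intro!: loop_in_affinization subspace_range_P)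
  have "foldr (\<lambda>(u, n). act' (loop u n)) w x = foldr act' ws x" for x
    unfolding ws_def foldr_map by (rule arg_cong[of _ _ "\<lambda>g. foldr g w x"]) (auto simp: fun_eq_iff)
  then have "\<pi> (foldr letter_mult ws q) = c *\<^sub>C \<pi> (word [])"
    using w(3) foldr_act'[OF ws] by (simp add: vac'_def)
  then have "\<pi> (foldr letter_mult ws q - c *\<^sub>C word []) = 0"
    by (simp add: clinear_diff[OF pi(1)] clinear_scale[OF pi(1)])
  then have "foldr letter_mult ws q - c *\<^sub>C word [] \<in> cspan relators_h"
    using pi(2) complex_vector.span_mono[OF relators_k_subset] by auto
  then have "eval_words act vac (foldr letter_mult ws q - c *\<^sub>C word []) = 0"
    by (simp only: eval_words_eq_0_iff)
  moreover have "eval_words act vac (foldr letter_mult ws q) = 0"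
  proof (induction ws)
    case Nil
    then show ?case using eval by simp
  next
    case (Cons x ws)
    then show ?case by (simp add: eval_words_letter_mult act_linear clinear_0[OF act_linear])
  qed
  ultimately have "c *\<^sub>C vac = 0"
    by (simp add: eval_words_eq_linear_extension clinear_diff[OF clinear_linear_extension] clinear_scale[OF clinear_linear_extension]
        scaleC_one)
  then show False using w(2) vac_nonzero by simp
qed

lemma nondegenerate_range_P: "nondegenerate_on k B"
  unfolding nondegenerate_on_def
proof (intro ballI impI)
  fix u assume u: "u \<in> k" "\<forall>v\<in>k. B u v = 0"
  show "u = 0"
  proof (rule B_eqI)
    fix v
    have "B u v = B u (P v)" using u(1) P_adjoint[of u v] by (simp add: range_P)
    then show "B v u = B v 0" using u(2) B_sym by (simp add: B_simps)
  qed
qed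

theorem heisenberg_vertex_algebra_image_algebra: "heisenberg_vertex_algebra k B (image_algebra P) Y vac act"
proof -
  interpret r: affine_rep k B act vac by (rule affine_rep_k)
  have image_algebra: "image_algebra P = r.word_space" by (simp add: image_algebra_eq_fock r.fock_space_eq_word_space)
  have sub: "csubspace r.word_space" by (simp add: r.word_space_def)
  have "eval_words act vac ` free_algebra (affinization k) = image_algebra P"
  proof
    show "eval_words act vac ` free_algebra (affinization k) \<subseteq> image_algebra P"
      unfolding image_algebra eval_words_eq_linear_extension
      by (auto intro!: in_subspace_linear_extension r.word_spaceI sub simp: free_algebra_def)
    show "image_algebra P \<subseteq> eval_words act vac ` free_algebra (affinization k)"
      unfolding image_algebra r.word_space_def
    proof (rule complex_vector.span_minimal)
      show "{foldr act w vac |w. w \<in> lists (affinization k)} \<subseteq> eval_words act vac ` free_algebra (affinization k)"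
        using word_in_free_algebra r.eval_diff(4) by (fastforce intro: image_eqI[OF sym])
      show "csubspace (eval_words act vac ` free_algebra (affinization k))"
        unfolding eval_words_eq_linear_extension
        by (rule complex_vector_pair.linear_subspace_image[OF clinear_linear_extension subspace_free_algebra])
    qed
  qed
  moreover have "eval_words act vac q = 0 \<longleftrightarrow> q \<in> cspan relators_k" if "q \<in> free_algebra (affinization k)" for q
    using eval_words_kernel[OF that] eval_words_eq_0_iff complex_vector.span_mono[OF relators_k_subset]
    by blast
  moreover have "act x ` image_algebra P \<subseteq> image_algebra P" if "x \<in> affinization k" for x
    unfolding image_algebra using r.act_closed that by blast
  moreover have "clinear_on (image_algebra P) (act x)" for x
    by (simp add: clinear_on_def J_right_simps)
  ultimately have "induced_module (affinization k) (heis_bracket B) (affinization_nonneg k) snd (image_algebra P) act vac"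
    unfolding induced_module_def using subspace_image_algebra vac_in_image_algebra by blast
  moreover have "vertex_algebra (image_algebra P) Y vac"
    unfolding image_algebra_def by (intro subalg_vertex_algebra subalg_gen)
  ultimately show ?thesis
    unfolding heisenberg_vertex_algebra_def
    using subspace_range_P nondegenerate_range_P Y_hv by blast
qed

end

section \<open>Tensor products\<close>

lemma pure_tensor_add_left: "(a + a') \<otimes>\<^sub>C b = a \<otimes>\<^sub>C b + a' \<otimes>\<^sub>C b"
proof transfer
  fix a a' :: 'a and b :: 'b
  have "Poly_Mapping.single (a + a', b) 1 - Poly_Mapping.single (a, b) 1 - Poly_Mapping.single (a', b) 1
      \<in> cspan (tensor_relators :: ('a \<times> 'b \<Rightarrow>\<^sub>0 complex) set)"
    by (rule complex_vector.span_base) (unfold tensor_relators_def, blast)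
  then show "tensor_eq (Poly_Mapping.single (a + a', b) 1)
     (Poly_Mapping.single (a, b) 1 + Poly_Mapping.single (a', b) 1)"
    by (simp add: tensor_eq_def diff_diff_eq)
qed

lemma pure_tensor_add_right: "a \<otimes>\<^sub>C (b + b') = a \<otimes>\<^sub>C b + a \<otimes>\<^sub>C b'"
proof transfer
  fix a :: 'a and b b' :: 'b
  have "Poly_Mapping.single (a, b + b') 1 - Poly_Mapping.single (a, b) 1 - Poly_Mapping.single (a, b') 1
      \<in> cspan (tensor_relators :: ('a \<times> 'b \<Rightarrow>\<^sub>0 complex) set)"
    by (rule complex_vector.span_base) (unfold tensor_relators_def, blast)
  then show "tensor_eq (Poly_Mapping.single (a, b + b') 1)
     (Poly_Mapping.single (a, b) 1 + Poly_Mapping.single (a, b') 1)"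
    by (simp add: tensor_eq_def diff_diff_eq)
qed

lemma pure_tensor_scale_left: "(c *\<^sub>C a) \<otimes>\<^sub>C b = c *\<^sub>C (a \<otimes>\<^sub>C b)"
  by transfer (unfold tensor_eq_def tensor_relators_def, rule complex_vector.span_base, blast)

lemma pure_tensor_scale_right: "a \<otimes>\<^sub>C (c *\<^sub>C b) = c *\<^sub>C (a \<otimes>\<^sub>C b)"
  by transfer (unfold tensor_eq_def tensor_relators_def, rule complex_vector.span_base, blast)

lemma pure_tensor_0_left: "0 \<otimes>\<^sub>C b = 0"
  using pure_tensor_scale_left[of 0 0 b] by simp

lemma pure_tensor_0_right: "a \<otimes>\<^sub>C 0 = 0"
  using pure_tensor_scale_right[of a 0 0] by simp

definition tensor_lift ::
  "('a::complex_vector \<Rightarrow> 'b::complex_vector \<Rightarrow> 'c::complex_vector) \<Rightarrow> ('a, 'b) tensor \<Rightarrow> 'c" where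
  "tensor_lift \<beta> t = linear_extension (case_prod \<beta>) (rep_tensor t)"

context
  fixes \<beta> :: "'a::complex_vector \<Rightarrow> 'b::complex_vector \<Rightarrow> 'c::complex_vector"
  assumes lin: "\<And>a. clinear (\<beta> a)" "\<And>b. clinear (\<lambda>a. \<beta> a b)"
begin

lemma tensor_lift_abs: "tensor_lift \<beta> (abs_tensor p) = linear_extension (case_prod \<beta>) p"
proof -
  have "linear_extension (case_prod \<beta>) r = 0" if "r \<in> tensor_relators" for r
    using that clinear_add[OF lin(1)] clinear_add[OF lin(2)] clinear_scale[OF lin(1)] clinear_scale[OF lin(2)]
    by (auto simp: tensor_relators_def clinear_diff[OF clinear_linear_extension] clinear_scale[OF clinear_linear_extension]
        scaleC_one)
  then have *: "linear_extension (case_prod \<beta>) r = 0" if "r \<in> cspan tensor_relators" for r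
    using clinear_eq_on_span[OF clinear_linear_extension complex_vector_pair.linear_zero _ that] by blast
  have "tensor_eq (rep_tensor (abs_tensor p)) p"
    by (rule Quotient3_rep_abs[OF Quotient3_tensor]) (simp add: tensor_eq_def complex_vector.span_zero)
  then show ?thesis
    using *[of "rep_tensor (abs_tensor p) - p"]
    by (simp add: tensor_lift_def tensor_eq_def clinear_diff[OF clinear_linear_extension])
qed

lemma tensor_lift_pure: "tensor_lift \<beta> (a \<otimes>\<^sub>C b) = \<beta> a b"
  by (simp add: pure_tensor.abs_eq tensor_lift_abs scaleC_one)

lemma clinear_tensor_lift: "clinear (tensor_lift \<beta>)"
proof (rule clinearI)
  fix x y :: "('a, 'b) tensor" and c
  obtain p q where "x = abs_tensor p" "y = abs_tensor q"
    by (metis Quotient3_abs_rep[OF Quotient3_tensor])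
  then show "tensor_lift \<beta> (x + y) = tensor_lift \<beta> x + tensor_lift \<beta> y"
    "tensor_lift \<beta> (c *\<^sub>C x) = c *\<^sub>C tensor_lift \<beta> x"
    by (simp_all add: plus_tensor.abs_eq scaleC_tensor.abs_eq tensor_lift_abs
        clinear_add[OF clinear_linear_extension] clinear_scale[OF clinear_linear_extension])
qed

end

lemma subspace_tensor_space: "csubspace (tensor_space V W)"
  by (simp add: tensor_space_def)

lemma pure_in_tensor_space: "v \<in> V \<Longrightarrow> w \<in> W \<Longrightarrow> v \<otimes>\<^sub>C w \<in> tensor_space V W"
  unfolding tensor_space_def by (rule complex_vector.span_base) blast

text \<open>The coefficients are kept zero outside \<open>t\<close> in the proof, so that two such sums can be added over the
union of their index sets.\<close>

lemma tensor_space_expansion: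
  assumes V: "csubspace V" and x: "x \<in> tensor_space V (cspan S)"
  obtains t a where "finite t" "t \<subseteq> S" "\<And>b. a b \<in> V" "x = (\<Sum>b\<in>t. a b \<otimes>\<^sub>C b)"
proof -
  define E where "E = {x. \<exists>t a. finite t \<and> t \<subseteq> S \<and> (\<forall>b. a b \<in> V) \<and> (\<forall>b. b \<notin> t \<longrightarrow> a b = 0)
    \<and> x = (\<Sum>b\<in>t. a b \<otimes>\<^sub>C b)}"
  have E: "csubspace E"
  proof (rule complex_vector.subspaceI)
    show "0 \<in> E" unfolding E_def using complex_vector.subspace_0[OF V]
      by (intro CollectI exI[of _ "{}"] exI[of _ "\<lambda>_. 0"]) simp
    show "x + y \<in> E" if "x \<in> E" "y \<in> E" for x y
    proof -
      obtain t a where ta: "finite t" "t \<subseteq> S" "\<And>b. a b \<in> V" "\<And>b. b \<notin> t \<Longrightarrow> a b = 0" "x = (\<Sum>b\<in>t. a b \<otimes>\<^sub>C b)"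
        using \<open>x \<in> E\<close> unfolding E_def by blast
      obtain s c where sc: "finite s" "s \<subseteq> S" "\<And>b. c b \<in> V" "\<And>b. b \<notin> s \<Longrightarrow> c b = 0" "y = (\<Sum>b\<in>s. c b \<otimes>\<^sub>C b)"
        using \<open>y \<in> E\<close> unfolding E_def by blast
      have "x = (\<Sum>b\<in>t \<union> s. a b \<otimes>\<^sub>C b)"
        unfolding ta(5) using ta(1,4) sc(1) by (intro sum.mono_neutral_left) (auto simp: pure_tensor_0_left)
      moreover have "y = (\<Sum>b\<in>t \<union> s. c b \<otimes>\<^sub>C b)"
        unfolding sc(5) using sc(1,4) ta(1) by (intro sum.mono_neutral_left) (auto simp: pure_tensor_0_left)
      ultimately have "x + y = (\<Sum>b\<in>t \<union> s. (a b + c b) \<otimes>\<^sub>C b)"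
        by (simp only: pure_tensor_add_left sum.distrib)
      then show ?thesis
        unfolding E_def using ta(1-4) sc(1-4) complex_vector.subspace_add[OF V]
        by (intro CollectI exI[of _ "t \<union> s"] exI[of _ "\<lambda>b. a b + c b"]) simp
    qed
    show "r *\<^sub>C x \<in> E" if "x \<in> E" for r x
    proof -
      obtain t a where ta: "finite t" "t \<subseteq> S" "\<And>b. a b \<in> V" "\<And>b. b \<notin> t \<Longrightarrow> a b = 0" "x = (\<Sum>b\<in>t. a b \<otimes>\<^sub>C b)"
        using \<open>x \<in> E\<close> unfolding E_def by blast
      have "r *\<^sub>C x = (\<Sum>b\<in>t. (r *\<^sub>C a b) \<otimes>\<^sub>C b)"
        by (simp add: ta(5) complex_vector.scale_sum_right pure_tensor_scale_left)
      then show ?thesis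
        unfolding E_def using ta(1-4) complex_vector.subspace_scale[OF V]
        by (intro CollectI exI[of _ t] exI[of _ "\<lambda>b. r *\<^sub>C a b"]) simp
    qed
  qed
  have single: "v \<otimes>\<^sub>C b \<in> E" if "v \<in> V" "b \<in> S" for v b
    unfolding E_def using that complex_vector.subspace_0[OF V]
    by (intro CollectI exI[of _ "{b}"] exI[of _ "\<lambda>b'. if b' = b then v else 0"]) simp
  have pure: "v \<otimes>\<^sub>C w \<in> E" if v: "v \<in> V" and w: "w \<in> cspan S" for v w
    using w
  proof (induction rule: complex_vector.span_induct_alt)
    case base
    then show ?case using complex_vector.subspace_0[OF E] by (simp add: pure_tensor_0_right)
  next
    case (step c b y)
    then show ?case
      using single[OF v] E
      by (simp add: pure_tensor_add_right pure_tensor_scale_right complex_vector.subspace_add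
          complex_vector.subspace_scale)
  qed
  have "tensor_space V (cspan S) \<subseteq> E"
    unfolding tensor_space_def using pure by (intro complex_vector.span_minimal E) blast
  then have "x \<in> E" using x by blast
  then show thesis unfolding E_def using that by blast
qed

text \<open>The pure tensors span, so bilinearity leaves only one choice; the work is to turn this into the
description operator used in the definition.\<close>

lemma tensor_Y_unique:
  assumes right: "\<And>x n. x \<in> tensor_space V W \<Longrightarrow> clinear_on (tensor_space V W) (Z x n)"
    and left: "\<And>y n. y \<in> tensor_space V W \<Longrightarrow> clinear_on (tensor_space V W) (\<lambda>x. Z x n y)"
    and outside: "\<And>x n y. x \<notin> tensor_space V W \<or> y \<notin> tensor_space V W \<Longrightarrow> Z x n y = 0"
    and pure: "\<And>a b c d n. \<lbrakk>a \<in> V; c \<in> V; b \<in> W; d \<in> W\<rbrakk> \<Longrightarrow>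
      Z (a \<otimes>\<^sub>C b) n (c \<otimes>\<^sub>C d) = Sum_any (\<lambda>i::int. Y a i c \<otimes>\<^sub>C Y' b (n - i - 1) d)"
  shows "tensor_Y V Y W Y' = Z"
  unfolding tensor_Y_def
proof (rule the_equality)
  let ?T = "tensor_space V W"
  let ?p = "{v \<otimes>\<^sub>C w | v w. v \<in> V \<and> w \<in> W}"
  show "(\<forall>x\<in>?T. \<forall>n. clinear_on ?T (Z x n)) \<and> (\<forall>y\<in>?T. \<forall>n. clinear_on ?T (\<lambda>x. Z x n y)) \<and>
     (\<forall>x n y. x \<notin> ?T \<or> y \<notin> ?T \<longrightarrow> Z x n y = 0) \<and>
     (\<forall>a\<in>V. \<forall>c\<in>V. \<forall>b\<in>W. \<forall>d\<in>W. \<forall>n.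
        Z (a \<otimes>\<^sub>C b) n (c \<otimes>\<^sub>C d) = Sum_any (\<lambda>i::int. Y a i c \<otimes>\<^sub>C Y' b (n - i - 1) d))"
    using assms by blast
  fix Z'
  assume Z': "(\<forall>x\<in>?T. \<forall>n. clinear_on ?T (Z' x n)) \<and> (\<forall>y\<in>?T. \<forall>n. clinear_on ?T (\<lambda>x. Z' x n y)) \<and>
     (\<forall>x n y. x \<notin> ?T \<or> y \<notin> ?T \<longrightarrow> Z' x n y = 0) \<and>
     (\<forall>a\<in>V. \<forall>c\<in>V. \<forall>b\<in>W. \<forall>d\<in>W. \<forall>n.
        Z' (a \<otimes>\<^sub>C b) n (c \<otimes>\<^sub>C d) = Sum_any (\<lambda>i::int. Y a i c \<otimes>\<^sub>C Y' b (n - i - 1) d))"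
  have eq_on: "f x = g x"
    if f: "clinear_on ?T f" and g: "clinear_on ?T g" and fg: "\<And>x. x \<in> ?p \<Longrightarrow> f x = g x" and x: "x \<in> ?T"
    for f g :: "('a, 'b) tensor \<Rightarrow> ('a, 'b) tensor" and x
  proof -
    have "csubspace {x \<in> ?T. f x = g x}"
    proof (rule complex_vector.subspaceI)
      have "f (0 *\<^sub>C 0) = 0 *\<^sub>C f 0" "g (0 *\<^sub>C 0) = 0 *\<^sub>C g 0"
        using f g complex_vector.subspace_0[OF subspace_tensor_space] unfolding clinear_on_def by blast+
      then show "0 \<in> {x \<in> ?T. f x = g x}"
        using complex_vector.subspace_0[OF subspace_tensor_space] by simp
      show "x + y \<in> {x \<in> ?T. f x = g x}" if "x \<in> {x \<in> ?T. f x = g x}" "y \<in> {x \<in> ?T. f x = g x}" for x y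
        using that f g unfolding clinear_on_def
        by (auto intro: complex_vector.subspace_add[OF subspace_tensor_space])
      show "c *\<^sub>C x \<in> {x \<in> ?T. f x = g x}" if "x \<in> {x \<in> ?T. f x = g x}" for c x
        using that f g unfolding clinear_on_def
        by (auto intro: complex_vector.subspace_scale[OF subspace_tensor_space])
    qed
    moreover have "?p \<subseteq> {x \<in> ?T. f x = g x}" using fg pure_in_tensor_space by fastforce
    ultimately have "cspan ?p \<subseteq> {x \<in> ?T. f x = g x}" by (intro complex_vector.span_minimal)
    then show ?thesis using x unfolding tensor_space_def by blast
  qed
  show "Z' = Z"
  proof (intro ext)
    fix x n y
    show "Z' x n y = Z x n y"
    proof (cases "x \<in> ?T \<and> y \<in> ?T")
      case False
      then show ?thesis using Z' outside by metis
    next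
      case True
      have pp: "Z' x n y = Z x n y" if "x \<in> ?p" "y \<in> ?p" for x y
        using that Z' pure by auto
      have "?p \<subseteq> ?T" using pure_in_tensor_space by blast
      then have "Z' x n y = Z x n y" if "x \<in> ?p" for x
        using eq_on[of "Z' x n" "Z x n" y] Z' right pp that True by blast
      then show ?thesis
        using eq_on[of "\<lambda>x. Z' x n y" "\<lambda>x. Z x n y" x] Z' left True by blast
    qed
  qed
qed

text \<open>Transport along a linear injection. No axiom has to be verified in the tensor product directly:
its structure comes from the ambient algebra.\<close>

lemma vertex_operator_algebra_transport:
  assumes "vertex_operator_algebra UNIV Y vac \<omega>" and F: "clinear F" "\<And>x. F x = 0 \<Longrightarrow> x = 0"
    and hom: "\<And>a n b. Y' (F a) n (F b) = F (Y a n b)"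
  shows "vertex_operator_algebra (range F) Y' (F vac) (F \<omega>)"
proof -
  interpret V: vertex_operator_algebra UNIV Y vac \<omega> by fact
  have inj: "F x = F y \<longleftrightarrow> x = y" for x y
    using F(2)[of "x - y"] by (auto simp: clinear_diff[OF F(1)])
  have F0: "F x = 0 \<longleftrightarrow> x = 0" for x using F(2) clinear_0[OF F(1)] by auto
  note push = hom clinear_add[OF F(1), symmetric] clinear_scale[OF F(1), symmetric]
    clinear_diff[OF F(1), symmetric]
  have ws: "weight_space (range F) Y' (F \<omega>) n = F ` weight_space UNIV Y \<omega> n" for n
    by (auto simp: weight_space_def push inj)
  show ?thesis
  proof
    show "csubspace (range F)"
      by (rule complex_vector_pair.linear_subspace_image[OF F(1)]) simp
    show "clinear_on (range F) (Y' a n)" if "a \<in> range F" for a n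
      using that V.Y_linear_right[of _ n] by (auto simp: clinear_on_def push inj)
    show "clinear_on (range F) (\<lambda>a. Y' a n b)" if "b \<in> range F" for b n
      using that V.Y_linear_left[of _ n] by (auto simp: clinear_on_def push inj)
    show "\<exists>N. \<forall>n\<ge>N. Y' a n b = 0" if "a \<in> range F" "b \<in> range F" for a b
      using that V.truncation by (auto simp: push F0)
    show "Y' (F vac) n a = (if n = - 1 then a else 0)" if "a \<in> range F" for n a
      using that V.vacuum by (auto simp: push F0)
    show "Y' a (- 1) (F vac) = a" if "a \<in> range F" for a
      using that V.creation by (auto simp: push)
    show "Y' a n (F vac) = 0" if "a \<in> range F" "0 \<le> n" for a n
      using that V.creation_nonneg by (auto simp: push F0)
    show "Sum_any (\<lambda>i::nat. (of_int m gchoose i) *\<^sub>C Y' (Y' a (l + int i) b) (m + n - int i) c) =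
      Sum_any (\<lambda>i::nat. ((-1) ^ i * (of_int l gchoose i)) *\<^sub>C
        (Y' a (l + m - int i) (Y' b (n + int i) c)
          - ((-1) powi l) *\<^sub>C Y' b (l + n - int i) (Y' a (m + int i) c)))"
      if "a \<in> range F" "b \<in> range F" "c \<in> range F" for a b c l m n
    proof -
      from that obtain a' b' c' where "a = F a'" "b = F b'" "c = F c'" by blast
      then show ?thesis
        using V.borcherds[of a' b' c' m l n]
        by (simp add: push clinear_Sum_any[OF F, symmetric])
    qed
    show "\<exists>c::complex. \<forall>m n. \<forall>v\<in>range F.
      Y' (F \<omega>) (m + 1) (Y' (F \<omega>) (n + 1) v) - Y' (F \<omega>) (n + 1) (Y' (F \<omega>) (m + 1) v) =
      of_int (m - n) *\<^sub>C Y' (F \<omega>) (m + n + 1) v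
        + (if m + n = 0 then (of_int (m ^ 3 - m) / 12 * c) *\<^sub>C v else 0)"
    proof -
      obtain c where c: "\<And>m n v.
        Y \<omega> (m + 1) (Y \<omega> (n + 1) v) - Y \<omega> (n + 1) (Y \<omega> (m + 1) v) =
        of_int (m - n) *\<^sub>C Y \<omega> (m + n + 1) v
          + (if m + n = 0 then (of_int (m ^ 3 - m) / 12 * c) *\<^sub>C v else 0)"
        using V.virasoro by blast
      show ?thesis
      proof (intro exI[of _ c] allI ballI)
        fix m n v assume "v \<in> range F"
        then obtain v' where v: "v = F v'" by blast
        have "(if m + n = 0 then (of_int (m ^ 3 - m) / 12 * c) *\<^sub>C v else 0) =
            F (if m + n = 0 then (of_int (m ^ 3 - m) / 12 * c) *\<^sub>C v' else 0)"
          by (simp add: v clinear_scale[OF F(1)] clinear_0[OF F(1)])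
        then show "Y' (F \<omega>) (m + 1) (Y' (F \<omega>) (n + 1) v) - Y' (F \<omega>) (n + 1) (Y' (F \<omega>) (m + 1) v) =
          of_int (m - n) *\<^sub>C Y' (F \<omega>) (m + n + 1) v
          + (if m + n = 0 then (of_int (m ^ 3 - m) / 12 * c) *\<^sub>C v else 0)"
          unfolding v push by (simp only: c push)
      qed
    qed
    show "Y' (Y' (F \<omega>) 0 a) n b = - of_int n *\<^sub>C Y' a (n - 1) b"
      if "a \<in> range F" "b \<in> range F" for a b n
    proof -
      from that obtain a' b' where "a = F a'" "b = F b'" by blast
      then show ?thesis using V.derivative[of a' b' n] by (simp only: push UNIV_I simp_thms)
    qed
    show "range F = cspan (\<Union>n. weight_space (range F) Y' (F \<omega>) n)"
      unfolding ws image_UN[symmetric] complex_vector_pair.linear_span_image[OF F(1)] V.grading[symmetric] ..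
    show "\<exists>B. finite B \<and> weight_space (range F) Y' (F \<omega>) n = cspan B" for n
    proof -
      obtain B where "finite B" "weight_space UNIV Y \<omega> n = cspan B" using V.weight_space_finite by blast
      then show ?thesis
        by (intro exI[of _ "F ` B"]) (simp add: ws complex_vector_pair.linear_span_image[OF F(1)])
    qed
    show "\<exists>N. \<forall>n<N. weight_space (range F) Y' (F \<omega>) n = {0}"
    proof -
      obtain N where N: "\<And>n. n < N \<Longrightarrow> weight_space UNIV Y \<omega> n = {0}" using V.weight_bounded_below by blast
      then show ?thesis by (intro exI[of _ N]) (simp add: ws clinear_0[OF F(1)])
    qed
  qed (use hom V.conformal_closed in auto)
qed

context vertex_algebra_UNIV
begin

definition multiply :: "('v, 'v) tensor \<Rightarrow> 'v" where
  "multiply = tensor_lift (\<lambda>a b. Y a (- 1) b)"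

lemma multiply_pure: "multiply (a \<otimes>\<^sub>C b) = Y a (- 1) b"
  unfolding multiply_def by (rule tensor_lift_pure) (rule clinear_Y_right clinear_Y_left)+

lemma clinear_multiply: "clinear multiply"
  unfolding multiply_def by (rule clinear_tensor_lift) (rule clinear_Y_right clinear_Y_left)+

text \<open>The inverse of \<open>multiply\<close> transports the vertex operators of \<open>V\<close> to the tensor product, and
\<open>product_of_commuting_pairs\<close> identifies the result with \<open>tensor_Y\<close>.\<close>

lemma tensor_decomposition:
  assumes U: "subalg U" "subalg W" and comm: "\<And>a b i. \<lbrakk>a \<in> U; b \<in> W; 0 \<le> i\<rbrakk> \<Longrightarrow> Y a i b = 0"
    and inj: "\<And>t. \<lbrakk>t \<in> tensor_space U W; multiply t = 0\<rbrakk> \<Longrightarrow> t = 0"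
    and surj: "multiply ` tensor_space U W = UNIV"
    and voa: "vertex_operator_algebra UNIV Y vac (\<omega>1 + \<omega>2)" and \<omega>: "\<omega>1 \<in> U" "\<omega>2 \<in> W"
  shows "voa_isomorphic UNIV Y vac (\<omega>1 + \<omega>2) (tensor_space U W) (tensor_Y U Y W Y)
    (vac \<otimes>\<^sub>C vac) (\<omega>1 \<otimes>\<^sub>C vac + vac \<otimes>\<^sub>C \<omega>2)"
proof -
  let ?T = "tensor_space U W"
  note subT = complex_vector.subspace_add[OF subspace_tensor_space]
    complex_vector.subspace_diff[OF subspace_tensor_space] complex_vector.subspace_scale[OF subspace_tensor_space]
  have inj_on: "inj_on multiply ?T"
  proof (rule inj_onI)
    fix x y assume "x \<in> ?T" "y \<in> ?T" "multiply x = multiply y"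
    then have "x - y = 0" by (intro inj) (simp_all add: subT clinear_diff[OF clinear_multiply])
    then show "x = y" by simp
  qed
  define F where "F = the_inv_into ?T multiply"
  have F_in: "F v \<in> ?T" and mF: "multiply (F v) = v" for v
    unfolding F_def using the_inv_into_into[OF inj_on _ order_refl] f_the_inv_into_f[OF inj_on] surj by simp_all
  have Fm: "F (multiply t) = t" if "t \<in> ?T" for t
    unfolding F_def using the_inv_into_f_f[OF inj_on that] .
  have F_lin: "clinear F"
  proof (rule clinearI)
    fix x y c
    have "F (multiply (F x + F y)) = F x + F y" "F (multiply (c *\<^sub>C F x)) = c *\<^sub>C F x"
      by (intro Fm subT F_in)+
    then show "F (x + y) = F x + F y" "F (c *\<^sub>C x) = c *\<^sub>C F x"
      by (simp_all add: clinear_add[OF clinear_multiply] clinear_scale[OF clinear_multiply] mF)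
  qed
  have F_0: "x = 0" if "F x = 0" for x
    using mF[of x] that by (simp add: clinear_0[OF clinear_multiply])
  have range_F: "range F = ?T"
    using F_in Fm by (auto simp: image_iff) metis
  define Z where "Z = (\<lambda>x n y. if x \<in> ?T \<and> y \<in> ?T then F (Y (multiply x) n (multiply y)) else 0)"
  have "tensor_Y U Y W Y = Z"
  proof (rule tensor_Y_unique)
    show "clinear_on ?T (Z x n)" if "x \<in> ?T" for x n
      using that by (simp add: clinear_on_def Z_def subT clinear_add[OF clinear_multiply]
          clinear_scale[OF clinear_multiply] Y_right_simps clinear_add[OF F_lin] clinear_scale[OF F_lin])
    show "clinear_on ?T (\<lambda>x. Z x n y)" if "y \<in> ?T" for y n
      using that by (simp add: clinear_on_def Z_def subT clinear_add[OF clinear_multiply]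
          clinear_scale[OF clinear_multiply] Y_left_simps clinear_add[OF F_lin] clinear_scale[OF F_lin])
    show "Z x n y = 0" if "x \<notin> ?T \<or> y \<notin> ?T" for x n y
      using that by (auto simp: Z_def)
    fix a b c d n assume mem: "a \<in> U" "c \<in> U" "b \<in> W" "d \<in> W"
    have UW: "Y a i c \<in> U" "Y b i d \<in> W" for i
      using U mem by (simp_all add: vertex_subalgebra_def)
    let ?S = "\<lambda>i. Y a i c \<otimes>\<^sub>C Y b (n - i - 1) d"
    have S: "F (Y (Y a i c) (- 1) (Y b (n - i - 1) d)) = ?S i" for i
      using Fm[OF pure_in_tensor_space[OF UW], of i "n - i - 1"] by (simp add: multiply_pure)
    have "Z (a \<otimes>\<^sub>C b) n (c \<otimes>\<^sub>C d) = F (Y (Y a (- 1) b) n (Y c (- 1) d))"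
      using mem by (simp add: Z_def pure_in_tensor_space multiply_pure)
    also have "\<dots> = F (Sum_any (\<lambda>i. Y (Y a i c) (- 1) (Y b (n - i - 1) d)))"
      using comm mem UW by (subst product_of_commuting_pairs) simp_all
    also have "\<dots> = Sum_any ?S"
      by (simp add: clinear_Sum_any[OF F_lin F_0] S)
    finally show "Z (a \<otimes>\<^sub>C b) n (c \<otimes>\<^sub>C d) = Sum_any ?S" .
  qed
  then have hom: "tensor_Y U Y W Y (F a) n (F b) = F (Y a n b)" for a n b
    by (simp add: Z_def F_in mF)
  have vac: "vac \<in> U" "vac \<in> W" using U by (simp_all add: vertex_subalgebra_def)
  have F_vac: "F vac = vac \<otimes>\<^sub>C vac"
    using Fm[OF pure_in_tensor_space[OF vac]] by (simp add: multiply_pure vacuum')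
  have "\<omega>1 \<otimes>\<^sub>C vac + vac \<otimes>\<^sub>C \<omega>2 \<in> ?T"
    using vac \<omega> by (intro subT pure_in_tensor_space)
  from Fm[OF this] have F_\<omega>: "F (\<omega>1 + \<omega>2) = \<omega>1 \<otimes>\<^sub>C vac + vac \<otimes>\<^sub>C \<omega>2"
    by (simp add: clinear_add[OF clinear_multiply] multiply_pure vacuum' creation')
  have "vertex_operator_algebra (range F) (tensor_Y U Y W Y) (F vac) (F (\<omega>1 + \<omega>2))"
  proof (rule vertex_operator_algebra_transport[OF voa F_lin])
    show "x = 0" if "F x = 0" for x using that by (rule F_0)
    show "tensor_Y U Y W Y (F a) n (F b) = F (Y a n b)" for a n b by (rule hom)
  qed
  then have "vertex_operator_algebra ?T (tensor_Y U Y W Y) (vac \<otimes>\<^sub>C vac) (\<omega>1 \<otimes>\<^sub>C vac + vac \<otimes>\<^sub>C \<omega>2)"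
    by (simp only: range_F F_vac F_\<omega>)
  moreover have "bij_betw F UNIV ?T"
    unfolding bij_betw_def range_F by (auto intro: inj_on_inverseI[of _ multiply] mF)
  ultimately show ?thesis
    unfolding voa_isomorphic_def using voa F_lin F_vac F_\<omega> hom
    by (auto simp: clinear_on_UNIV_iff)
qed

end

context heisenberg_projection
begin

abbreviation (input) "Q \<equiv> (\<lambda>u. u - P u)"

lemma complement_commutes: "\<lbrakk>a \<in> image_algebra Q; b \<in> image_algebra P; 0 \<le> i\<rbrakk> \<Longrightarrow> Y a i b = 0"
  using image_algebra_eq_commutant by (auto simp: commutant_iff)

lemma complement_commutes': "\<lbrakk>a \<in> image_algebra P; b \<in> image_algebra Q; 0 \<le> i\<rbrakk> \<Longrightarrow> Y a i b = 0"
  using heisenberg_projection.image_algebra_eq_commutant[OF complement] by (auto simp: commutant_iff)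

lemma J_complement_multiply:
  assumes "u \<in> range Q" "a \<in> image_algebra Q" "b \<in> image_algebra P"
  shows "J u n (Y a (- 1) b) = Y (J u n a) (- 1) b"
proof -
  have "Y (hv u) i b = 0" "Y a i b = 0" if "0 \<le> i" for i
    using assms that heisenberg_projection.hv_in_image_algebra[OF complement assms(1)]
    by (simp_all only: complement_commutes)
  then show ?thesis using Y_iterate_commuting[of "hv u" b a n] by (simp add: Y_hv)
qed

lemma J_multiply:
  assumes "u \<in> range P" "a \<in> image_algebra Q" "b \<in> image_algebra P"
  shows "J u n (Y a (- 1) b) = Y a (- 1) (J u n b)"
proof -
  have "Y (hv u) i a = 0" if "0 \<le> i" for i
    using assms that hv_in_image_algebra[OF assms(1)] by (simp only: complement_commutes')
  then show ?thesis using locality[of "hv u" a n "- 1" b] by (simp add: Y_hv)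
qed

text \<open>Every \<open>u\<close> is \<open>Q u + P u\<close>; the first part acts on the left factor, the second on the right one.\<close>

lemma multiply_surj: "multiply ` tensor_space (image_algebra Q) (image_algebra P) = UNIV"
proof -
  interpret Q: heisenberg_projection B d e Y vac act h Q by (rule complement)
  let ?T = "tensor_space (image_algebra Q) (image_algebra P)"
  let ?I = "multiply ` ?T"
  have I: "csubspace ?I"
    by (rule complex_vector_pair.linear_subspace_image[OF clinear_multiply subspace_tensor_space])
  have "fock_space UNIV (\<lambda>u n. J u n) vac \<subseteq> ?I"
  proof (rule fock_space_subset[OF I])
    show "vac \<in> ?I"
      using pure_in_tensor_space[OF Q.vac_in_image_algebra vac_in_image_algebra]
      by (intro image_eqI[of _ _ "vac \<otimes>\<^sub>C vac"]) (simp_all add: multiply_pure vacuum')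
    fix u n x assume "x \<in> ?I"
    then obtain t where t: "x = multiply t" "t \<in> ?T" by blast
    have "J u n (multiply t) \<in> ?I"
      using t(2) unfolding tensor_space_def
    proof (rule clinear_span_subset[of "\<lambda>t. J u n (multiply t)", rotated -1])
      show "clinear (\<lambda>t. J u n (multiply t))"
        by (intro clinearI) (simp_all add: clinear_add[OF clinear_multiply] clinear_scale[OF clinear_multiply]
            J_right_simps)
      show "csubspace (multiply ` cspan {v \<otimes>\<^sub>C w |v w. v \<in> image_algebra Q \<and> w \<in> image_algebra P})"
        using I by (simp add: tensor_space_def)
      fix p assume "p \<in> {v \<otimes>\<^sub>C w |v w. v \<in> image_algebra Q \<and> w \<in> image_algebra P}"
      then obtain a b where p: "p = a \<otimes>\<^sub>C b" and ab: "a \<in> image_algebra Q" "b \<in> image_algebra P" by blast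
      have "J u n (multiply p) = J (Q u) n (Y a (- 1) b) + J (P u) n (Y a (- 1) b)"
        by (simp add: p multiply_pure J_left_simps)
      also have "\<dots> = multiply (J (Q u) n a \<otimes>\<^sub>C b + a \<otimes>\<^sub>C J (P u) n b)"
        using ab by (simp only: J_complement_multiply[OF rangeI] J_multiply[OF rangeI] clinear_add[OF clinear_multiply] multiply_pure)
      finally have "J u n (multiply p) = multiply (J (Q u) n a \<otimes>\<^sub>C b + a \<otimes>\<^sub>C J (P u) n b)" .
      moreover have "J (Q u) n a \<otimes>\<^sub>C b + a \<otimes>\<^sub>C J (P u) n b \<in> ?T"
        using ab by (intro complex_vector.subspace_add[OF subspace_tensor_space] pure_in_tensor_space
            Q.J_in_image_algebra J_in_image_algebra rangeI)
      ultimately show "J u n (multiply p) \<in> multiply ` cspan {v \<otimes>\<^sub>C w |v w. v \<in> image_algebra Q \<and> w \<in> image_algebra P}"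
        unfolding tensor_space_def by blast
    qed
    then show "J u n x \<in> ?I" by (simp only: t)
  qed
  then show ?thesis using fock_space_UNIV by auto
qed

text \<open>An annihilation operator from \<open>Q \<hh>\<close> acts on the coefficients \<open>a b\<close> alone, and by induction the results
vanish; so the coefficients are multiples of the vacuum, and independence of \<open>t\<close> applies.\<close>

lemma multiply_independent:
  assumes "finite t" "complex_vector.independent t" "t \<subseteq> image_algebra P"
    and "\<And>b. b \<in> t \<Longrightarrow> a b \<in> heisenberg_rep.annihilation_filtration (range Q) (\<lambda>u n. J u n) vac N"
    and "(\<Sum>b\<in>t. Y (a b) (- 1) b) = 0"
  shows "\<forall>b\<in>t. a b = 0"
proof -
  interpret Q: heisenberg_projection B d e Y vac act h Q by (rule complement)
  show ?thesis
    using assms(4,5)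
  proof (induction N arbitrary: a)
    case 0
    then show ?case by simp
  next
    case (Suc N)
    have a: "a b \<in> image_algebra Q" if "b \<in> t" for b
      using Suc.prems(1)[OF that] by (simp add: Q.image_algebra_eq_fock)
    have "J u n (a b) = 0" if u: "u \<in> range Q" "0 < n" and "b \<in> t" for u n b
    proof -
      have "(\<Sum>b\<in>t. Y (J u n (a b)) (- 1) b) = (\<Sum>b\<in>t. J u n (Y (a b) (- 1) b))"
        using assms(3) a u(1) by (intro sum.cong refl J_complement_multiply[symmetric]) auto
      also have "\<dots> = J u n (\<Sum>b\<in>t. Y (a b) (- 1) b)" by (simp add: J_right_simps)
      finally have "(\<Sum>b\<in>t. Y (J u n (a b)) (- 1) b) = 0"
        using Suc.prems(2) by (simp add: J_right_simps)
      moreover have "J u n (a b') \<in> Q.rep.annihilation_filtration N" if "b' \<in> t" for b'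
        using Suc.prems(1)[OF that] u by auto
      ultimately show ?thesis using Suc.IH[of "\<lambda>b. J u n (a b)"] \<open>b \<in> t\<close> by blast
    qed
    then have "a b \<in> cspan {vac}" if "b \<in> t" for b
      using that a by (intro Q.rep.annihilated_in_vac_span) (simp_all add: Q.image_algebra_eq_fock)
    then have "\<forall>b\<in>t. \<exists>c. a b = c *\<^sub>C vac"
      by (auto simp: complex_vector.span_singleton)
    then obtain c where c: "\<And>b. b \<in> t \<Longrightarrow> a b = c b *\<^sub>C vac" by metis
    then have "(\<Sum>b\<in>t. c b *\<^sub>C b) = 0"
      using Suc.prems(2) by (simp add: Y_left_simps vacuum')
    then have "c b = 0" if "b \<in> t" for b
      using complex_vector.independentD[OF assms(2,1) order_refl _ that, of c] by simp
    then show ?case using c by simp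
  qed
qed

lemma multiply_inj:
  assumes "x \<in> tensor_space (image_algebra Q) (image_algebra P)" "multiply x = 0"
  shows "x = 0"
proof -
  interpret Q: heisenberg_projection B d e Y vac act h Q by (rule complement)
  obtain S where S: "S \<subseteq> image_algebra P" "complex_vector.independent S" "image_algebra P \<subseteq> cspan S"
    using complex_vector.basis_exists by metis
  have "cspan S = image_algebra P"
    using S(3) complex_vector.span_minimal[OF S(1) subspace_image_algebra] by auto
  then obtain t a where t: "finite t" "t \<subseteq> S" "\<And>b. a b \<in> image_algebra Q" "x = (\<Sum>b\<in>t. a b \<otimes>\<^sub>C b)"
    using tensor_space_expansion[OF Q.subspace_image_algebra, of x S] assms(1) by metis
  have "\<forall>b. \<exists>N. a b \<in> Q.rep.annihilation_filtration N"
    using t(3) Q.rep.exists_annihilation_filtration by (simp add: Q.image_algebra_eq_fock)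
  then obtain N where N: "\<And>b. a b \<in> Q.rep.annihilation_filtration (N b)" by metis
  have "a b \<in> Q.rep.annihilation_filtration (Max (N ` t))" if "b \<in> t" for b
    using N[of b] Q.rep.annihilation_filtration_mono[of "N b" "Max (N ` t)"] t(1) that by auto
  moreover have "(\<Sum>b\<in>t. Y (a b) (- 1) b) = 0"
    using assms(2) by (simp add: t(4) clinear_sum[OF clinear_multiply] multiply_pure)
  moreover have "complex_vector.independent t"
    using S(2) t(2) complex_vector.independent_mono by blast
  ultimately have "\<forall>b\<in>t. a b = 0"
    using t(1,2) S(1) by (intro multiply_independent) auto
  then show ?thesis by (simp add: t(4) pure_tensor_0_left)
qed

end

section \<open>Semi-conformal vectors\<close>

context heisenberg_setup
begin

lemma identity_projection: "heisenberg_projection B d e Y vac act (\<lambda>u. u)"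
  by unfold_locales simp_all

sublocale id: heisenberg_projection B d e Y vac act h "\<lambda>u. u"
  by (rule identity_projection)

lemma omega_id: "omega (\<lambda>u. u) = omega_vec e d act vac h"
  by (simp add: omega_def omega_vec_def)

lemma image_algebra_id: "image_algebra (\<lambda>u. u) = UNIV"
  using id.image_algebra_eq_fock fock_space_UNIV by simp

lemma vertex_operator_algebra_UNIV: "vertex_operator_algebra UNIV Y vac (omega (\<lambda>u. u))"
  using id.vertex_operator_algebra_image_algebra by (simp add: image_algebra_id)

definition quadratic_form_vector :: "(nat \<Rightarrow> nat \<Rightarrow> complex) \<Rightarrow> (nat \<Rightarrow> complex) \<Rightarrow> 'v" where
  "quadratic_form_vector a b =
    (\<Sum>i=1..d. \<Sum>j=i..d. a i j *\<^sub>C J (e i) (- 1) (hv (e j))) + (\<Sum>i=1..d. b i *\<^sub>C J (e i) (- 2) vac)"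

definition upper_triangular :: "(nat \<Rightarrow> nat \<Rightarrow> complex) \<Rightarrow> bool" where
  "upper_triangular a \<longleftrightarrow> (\<forall>i j. \<not> (1 \<le> i \<and> i \<le> j \<and> j \<le> d) \<longrightarrow> a i j = 0)"

text \<open>The linear map whose matrix is \<open>A_matrix\<close> built from the coefficients \<open>a\<close>, without recourse to their
uniqueness.\<close>

definition symmetrized_map :: "(nat \<Rightarrow> nat \<Rightarrow> complex) \<Rightarrow> 'h \<Rightarrow> 'h" where
  "symmetrized_map a u = (\<Sum>i=1..d. \<Sum>j=1..d.
     ((if i = j then 2 * a i i else a (min i j) (max i j)) * B (e j) u) *\<^sub>C e i)"

lemma triangle_sum: "(\<Sum>i=1..d. \<Sum>j=i..d. g i j) = (\<Sum>i=1..d. \<Sum>j=1..d. if i \<le> j then g i j else 0 :: 'v)"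
proof (rule sum.cong[OF refl])
  fix i assume "i \<in> {1..d}"
  then show "(\<Sum>j=i..d. g i j) = (\<Sum>j=1..d. if i \<le> j then g i j else 0)"
    by (intro sum.mono_neutral_cong_left) auto
qed

text \<open>This is why the diagonal of the matrix is doubled: \<open>u(1)\<close> contracts with either factor of
\<open>e\<^sub>i(-1)e\<^sub>j(-1)\<one>\<close>.\<close>

lemma J_quadratic_form_vector: "J u 1 (quadratic_form_vector a b) = hv (symmetrized_map a u)"
proof -
  let ?x = "\<lambda>i. B u (e i)" and ?y = "\<lambda>i. hv (e i)"
  have "J u 1 (quadratic_form_vector a b) =
     (\<Sum>i=1..d. \<Sum>j=i..d. a i j *\<^sub>C (?x i *\<^sub>C ?y j + ?x j *\<^sub>C ?y i))"
    by (simp add: quadratic_form_vector_def J_right_simps J_hv2 J_hv_derivative)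
  also have "\<dots> = (\<Sum>i=1..d. \<Sum>j=1..d. (if i \<le> j then (a i j * ?x i) *\<^sub>C ?y j else 0))
      + (\<Sum>i=1..d. \<Sum>j=1..d. (if i \<le> j then (a i j * ?x j) *\<^sub>C ?y i else 0))"
    unfolding triangle_sum sum.distrib[symmetric]
    by (intro sum.cong refl) (simp add: scaleC_add_right scaleC_scaleC)
  also have "(\<Sum>i=1..d. \<Sum>j=1..d. (if i \<le> j then (a i j * ?x i) *\<^sub>C ?y j else 0)) =
      (\<Sum>i=1..d. \<Sum>j=1..d. (if j \<le> i then (a j i * ?x j) *\<^sub>C ?y i else 0))"
    by (rule sum.swap)
  also have "\<dots> + (\<Sum>i=1..d. \<Sum>j=1..d. (if i \<le> j then (a i j * ?x j) *\<^sub>C ?y i else 0)) =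
      (\<Sum>i=1..d. \<Sum>j=1..d. ((if i = j then 2 * a i i else a (min i j) (max i j)) * B (e j) u) *\<^sub>C ?y i)"
    unfolding sum.distrib[symmetric]
  proof (intro sum.cong refl)
    fix i j
    have "(a i i * c) *\<^sub>C y + (a i i * c) *\<^sub>C y = (2 * a i i * c) *\<^sub>C y" for c and y :: 'v
      by (simp flip: scaleC_add_left)
    then show "(if j \<le> i then (a j i * ?x j) *\<^sub>C ?y i else 0) + (if i \<le> j then (a i j * ?x j) *\<^sub>C ?y i else 0)
      = ((if i = j then 2 * a i i else a (min i j) (max i j)) * B (e j) u) *\<^sub>C ?y i"
      by (auto simp: B_sym[of u] min_def max_def)
  qed
  finally show ?thesis by (simp add: symmetrized_map_def J_left_simps)
qed

lemma quadratic_form_vector_quadratic: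
  "quadratic_vector (symmetrized_map a) (\<Sum>i=1..d. b i *\<^sub>C e i) (quadratic_form_vector a b)"
  unfolding quadratic_vector_def
proof (intro allI conjI impI)
  fix u
  show "J u 0 (quadratic_form_vector a b) = 0"
    by (simp add: quadratic_form_vector_def J_right_simps J_hv2 J_hv_derivative)
  show "J u n (quadratic_form_vector a b) = 0" if "3 \<le> n" for n
    using that by (simp add: quadratic_form_vector_def J_right_simps J_hv2 J_hv_derivative)
  show "J u 2 (quadratic_form_vector a b) = (2 * B u (\<Sum>i=1..d. b i *\<^sub>C e i)) *\<^sub>C vac"
    by (simp add: quadratic_form_vector_def J_right_simps J_hv2 J_hv_derivative B_simps
        sum_distrib_left complex_vector.scale_sum_left scaleC_scaleC mult.left_commute)
qed (rule J_quadratic_form_vector)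

lemma symmetrized_map_inj:
  assumes a: "upper_triangular a" "upper_triangular a'" and eq: "symmetrized_map a = symmetrized_map a'"
  shows "a = a'"
proof (intro ext)
  fix i j
  show "a i j = a' i j"
  proof (cases "1 \<le> i \<and> i \<le> j \<and> j \<le> d")
    case False
    then show ?thesis using a unfolding upper_triangular_def by metis
  next
    case True
    have B_e: "B (e k) (e l) = (if k = l then 1 else 0)" if "k \<in> {1..d}" "l \<in> {1..d}" for k l
      using orthonormal that by (simp add: orthonormal_basis_def)
    have "B (e i) (symmetrized_map a (e j)) = (if i = j then 2 * a i i else a i j)" for a
    proof -
      have "B (e i) (symmetrized_map a (e j)) = (\<Sum>k=1..d. \<Sum>l=1..d.
         (if l = j then (if k = i then (if k = l then 2 * a k k else a (min k l) (max k l)) else 0) else 0))"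
        unfolding symmetrized_map_def B_simps
        using True by (intro sum.cong refl) (simp add: B_e)
      also have "\<dots> = (if i = j then 2 * a i i else a (min i j) (max i j))"
        using True by (simp add: sum.delta)
      finally show ?thesis using True by simp
    qed
    from this[of a] this[of a'] eq show ?thesis by (auto split: if_splits)
  qed
qed

text \<open>The words of degree two are \<open>[(i, 2)]\<close> and \<open>[(i, 1), (j, 1)]\<close>.\<close>

lemma weight_two_quadratic_form:
  assumes "Y (omega (\<lambda>u. u)) 1 x = 2 *\<^sub>C x"
  obtains a b where "upper_triangular a" "x = quadratic_form_vector a b"
proof -
  define E where "E = {x. \<exists>a b. upper_triangular a \<and> x = quadratic_form_vector a b}"
  have E: "csubspace E"
  proof (rule complex_vector.subspaceI)
    show "0 \<in> E" unfolding E_def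
      by (intro CollectI exI[of _ "\<lambda>_ _. 0"] exI[of _ "\<lambda>_. 0"])
        (simp add: upper_triangular_def quadratic_form_vector_def)
    show "x + y \<in> E" if xy: "x \<in> E" "y \<in> E" for x y
    proof -
      from xy obtain a b a' b' where *: "upper_triangular a" "x = quadratic_form_vector a b"
        "upper_triangular a'" "y = quadratic_form_vector a' b'" unfolding E_def by blast
      then show ?thesis unfolding E_def
        by (intro CollectI exI[of _ "\<lambda>i j. a i j + a' i j"] exI[of _ "\<lambda>i. b i + b' i"])
          (simp add: upper_triangular_def quadratic_form_vector_def scaleC_add_left sum.distrib)
    qed
    show "c *\<^sub>C x \<in> E" if x: "x \<in> E" for c x
    proof -
      from x obtain a b where *: "upper_triangular a" "x = quadratic_form_vector a b"
        unfolding E_def by blast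
      then show ?thesis unfolding E_def
        by (intro CollectI exI[of _ "\<lambda>i j. c * a i j"] exI[of _ "\<lambda>i. c * b i"])
          (simp add: upper_triangular_def quadratic_form_vector_def scaleC_add_right scaleC_scaleC
            complex_vector.scale_sum_right)
    qed
  qed
  have E1: "J (e i) (- 2) vac \<in> E" if "i \<in> {1..d}" for i
  proof -
    have "quadratic_form_vector (\<lambda>_ _. 0) (\<lambda>k. if k = i then 1 else 0) =
       (\<Sum>k=1..d. if k = i then J (e k) (- 2) vac else 0)"
      unfolding quadratic_form_vector_def by (simp add: if_distrib[of "\<lambda>c. c *\<^sub>C _"] scaleC_one cong: if_cong)
    then have "J (e i) (- 2) vac = quadratic_form_vector (\<lambda>_ _. 0) (\<lambda>k. if k = i then 1 else 0)"
      using that by simp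
    moreover have "upper_triangular (\<lambda>_ _. 0)" by (simp add: upper_triangular_def)
    ultimately show ?thesis unfolding E_def by blast
  qed
  have E2: "J (e i) (- 1) (hv (e j)) \<in> E" if "i \<in> {1..d}" "j \<in> {1..d}" "i \<le> j" for i j
  proof -
    let ?a = "\<lambda>k l. if l = j then if k = i then 1 else 0 else 0"
    have "quadratic_form_vector ?a (\<lambda>_. 0) =
       (\<Sum>k=1..d. \<Sum>l=1..d. if l = j then if k = i then J (e i) (- 1) (hv (e j)) else 0 else 0)"
      unfolding quadratic_form_vector_def triangle_sum
      using that
      by (simp only: complex_vector.scale_zero_left sum.neutral_const add_0_right, intro sum.cong refl)
        (auto simp: scaleC_one)
    also have "\<dots> = J (e i) (- 1) (hv (e j))" using that by simp
    finally have "J (e i) (- 1) (hv (e j)) = quadratic_form_vector ?a (\<lambda>_. 0)" ..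
    moreover have "upper_triangular ?a" using that by (auto simp: upper_triangular_def)
    ultimately show ?thesis unfolding E_def by blast
  qed
  have E3: "J (e i) (- 1) (hv (e j)) \<in> E" if "i \<in> {1..d}" "j \<in> {1..d}" for i j
  proof (cases "i \<le> j")
    case False
    have "J (e i) (- 1) (hv (e j)) = J (e j) (- 1) (hv (e i))"
      by (simp add: J_commute[of "e i" "- 1" "e j"])
    then show ?thesis using E2[of j i] that False by simp
  qed (use E2 that in simp)
  have "id.rep.creation_monomial w \<in> E" if "w \<in> id.rep.creation_words" "id.rep.word_degree w = 2" for w
  proof -
    from that obtain i n v where w: "w = (i, n) # v" by (cases w) auto
    show ?thesis
    proof (cases v)
      case Nil
      then show ?thesis using that E1[of i] w by simp
    next
      case (Cons p v')
      obtain j m where p: "p = (j, m)" by (cases p)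
      have "n = 1" "m = 1" "id.rep.word_degree v' = 0" using that by (auto simp: w Cons p)
      moreover from this have "v' = []" using that by (cases v') (auto simp: w Cons p)
      ultimately show ?thesis using that E3[of i j] by (simp add: w Cons p)
    qed
  qed
  then have "cspan (id.rep.creation_monomial ` {w \<in> id.rep.creation_words. int (id.rep.word_degree w) = 2}) \<subseteq> E"
    by (intro complex_vector.span_minimal E) auto
  moreover have "x \<in> weight_space (image_algebra (\<lambda>u. u)) Y (omega (\<lambda>u. u)) 2"
    using assms by (simp add: weight_space_def image_algebra_id)
  ultimately have "x \<in> E" unfolding id.weight_space_eq by blast
  then show thesis unfolding E_def using that by blast
qed

lemma quadratic_coeff_eq:
  assumes "upper_triangular a"
  shows "quadratic_coeff e d act vac (quadratic_form_vector a b) = a"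
  unfolding quadratic_coeff_def
proof (rule the_equality)
  show "(\<forall>i j. \<not> (1 \<le> i \<and> i \<le> j \<and> j \<le> d) \<longrightarrow> a i j = 0) \<and> (\<exists>b'. quadratic_form_vector a b =
        (\<Sum>i=1..d. \<Sum>j=i..d. a i j *\<^sub>C J (e i) (- 1) (hv (e j))) + (\<Sum>i=1..d. b' i *\<^sub>C J (e i) (- 2) vac))"
    using assms by (auto simp: upper_triangular_def quadratic_form_vector_def)
  fix a'
  assume "(\<forall>i j. \<not> (1 \<le> i \<and> i \<le> j \<and> j \<le> d) \<longrightarrow> a' i j = 0) \<and> (\<exists>b'. quadratic_form_vector a b =
        (\<Sum>i=1..d. \<Sum>j=i..d. a' i j *\<^sub>C J (e i) (- 1) (hv (e j))) + (\<Sum>i=1..d. b' i *\<^sub>C J (e i) (- 2) vac))"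
  then obtain b' where a': "upper_triangular a'" and eq: "quadratic_form_vector a b = quadratic_form_vector a' b'"
    unfolding upper_triangular_def quadratic_form_vector_def by blast
  have "hv (symmetrized_map a' u) = hv (symmetrized_map a u)" for u
    using J_quadratic_form_vector[of u a b] J_quadratic_form_vector[of u a' b'] eq by simp
  then have "symmetrized_map a' = symmetrized_map a" using hv_inj by blast
  then show "a' = a" by (rule symmetrized_map_inj[OF a' assms])
qed

lemma A_map_quadratic:
  assumes "Y (omega (\<lambda>u. u)) 1 x = 2 *\<^sub>C x"
  shows "\<exists>b. quadratic_vector (A_map B e d act vac x) b x"
proof -
  obtain a b where ab: "upper_triangular a" "x = quadratic_form_vector a b"
    by (rule weight_two_quadratic_form[OF assms])
  have "A_map B e d act vac x = symmetrized_map a"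
    by (intro ext) (simp only: A_map_def A_matrix_def symmetrized_map_def ab(2) quadratic_coeff_eq[OF ab(1)])
  then show ?thesis using quadratic_form_vector_quadratic[of a b] ab(2) by auto
qed

lemma clinear_A_map: "clinear (A_map B e d act vac x)"
  unfolding A_map_def
  by (rule clinearI)
    (simp_all add: B_simps distrib_left scaleC_add_left sum.distrib complex_vector.scale_sum_right
      scaleC_scaleC mult.left_commute)

text \<open>\<open>u(1)\<close> and \<open>v(1)\<close> commute; compare their two products on \<open>x\<close>.\<close>

lemma quadratic_vector_adjoint:
  assumes "quadratic_vector P b x"
  shows "B (P u) v = B u (P v)"
proof -
  have "J v 1 (J u 1 x) = J u 1 (J v 1 x)" by (simp add: J_commute[of v 1 u])
  then have "B v (P u) *\<^sub>C vac = B u (P v) *\<^sub>C vac"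
    using assms by (simp only: quadratic_vector_def J_1_hv)
  then show ?thesis by (simp add: vac_nonzero B_sym[of v])
qed

text \<open>Apply \<open>u(1)\<close> to \<open>x\<^sub>1 x = 2x\<close>; the left side becomes \<open>2 (P P u)(-1)\<one>\<close>.\<close>

lemma quadratic_vector_idempotent:
  assumes q: "quadratic_vector P b x" and "Y x 1 x = 2 *\<^sub>C x"
  shows "P (P u) = P u"
proof -
  have two: "y + y = 2 *\<^sub>C y" for y :: 'v
    using scaleC_add_left[of 1 1 y] by (simp add: scaleC_one)
  have x_hv: "Y x 1 (hv w) = hv (P w)" for w
    by (simp add: quadratic_vector_commutator'[OF q] creation_nonneg' J_right_simps
        complex_vector.scale_minus_left scaleC_one)
  have J1: "J u 1 x = hv (P u)" for u using q by (simp add: quadratic_vector_def)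
  have "J u 1 (Y x 1 x) = Y x 1 (J u 1 x) + J (P u) 1 x"
    by (simp add: quadratic_vector_commutator[OF q] scaleC_one)
  then have "2 *\<^sub>C hv (P u) = 2 *\<^sub>C hv (P (P u))"
    by (simp add: assms(2) J_right_simps J1 x_hv two)
  then have "hv (P u) = hv (P (P u))" by simp
  then show ?thesis using hv_inj by auto
qed

text \<open>Apply \<open>u(1)\<close> to \<open>(\<omega>\<^sub>h)\<^sub>2 x = 0\<close>.\<close>

lemma quadratic_vector_linear_part:
  assumes q: "quadratic_vector P b x" and "Y (omega (\<lambda>u. u)) 2 x = 0"
  shows "b = P h"
proof (rule B_eqI)
  fix u
  have J: "J u 1 x = hv (P u)" "J u 2 x = (2 * B u b) *\<^sub>C vac" using q by (simp_all add: quadratic_vector_def)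
  have "J u 1 (Y (omega (\<lambda>u. u)) 2 x) = Y (omega (\<lambda>u. u)) 2 (J u 1 x) + J u 2 x"
    by (simp add: quadratic_vector_commutator[OF id.omega_quadratic] scaleC_one)
  then have "0 = - ((2 * B (P u) h) *\<^sub>C vac) + (2 * B u b) *\<^sub>C vac"
    using assms(2) by (simp add: J J_right_simps id.omega_hv J_vac)
  then have "(2 * B u b) *\<^sub>C vac = (2 * B (P u) h) *\<^sub>C vac" by simp
  then show "B u b = B u (P h)"
    using vac_nonzero quadratic_vector_adjoint[OF q] by simp
qed

text \<open>The difference is killed by all annihilation operators, hence is a multiple of the vacuum; but it also
has weight two.\<close>

lemma quadratic_vector_unique:
  assumes "quadratic_vector P b x" "quadratic_vector P b y"
    and "Y (omega (\<lambda>u. u)) 1 x = 2 *\<^sub>C x" "Y (omega (\<lambda>u. u)) 1 y = 2 *\<^sub>C y"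
  shows "x = y"
proof -
  have J: "J u n (x - y) = 0" if "0 < n" for u n
  proof -
    have "n = 1 \<or> n = 2 \<or> 3 \<le> n" using that by linarith
    then show ?thesis using assms(1,2) by (auto simp: quadratic_vector_def J_right_simps)
  qed
  then have "x - y \<in> cspan {vac}"
    by (intro id.rep.annihilated_in_vac_span) (simp_all add: fock_space_UNIV)
  then obtain c where c: "x - y = c *\<^sub>C vac" by (auto simp: complex_vector.span_singleton)
  have "Y (omega (\<lambda>u. u)) 1 (x - y) = 2 *\<^sub>C (x - y)"
    using assms(3,4) by (simp add: Y_right_simps complex_vector.scale_right_diff_distrib)
  then have "x - y = 0" unfolding c by (simp add: Y_right_simps creation_nonneg')
  then show ?thesis by simp
qed

end

context heisenberg_projection
begin

lemma omega_weight_two: "Y (omega (\<lambda>u. u)) 1 (omega P) = 2 *\<^sub>C omega P"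
proof -
  have "2 *\<^sub>C omega P = (\<Sum>i=1..d. J (P (e i)) (- 1) (hv (P (e i)))) + 2 *\<^sub>C J (P h) (- 2) vac"
    by (simp add: omega_def scaleC_add_right scaleC_scaleC scaleC_one)
  then show ?thesis
    by (subst omega_def) (simp add: Y_right_simps id.omega_hv2 id.omega_hv_derivative scaleC_scaleC scaleC_one
        flip: complex_vector.scale_sum_right)
qed

end

text \<open>The Virasoro relations of the subalgebra, applied to the vacuum, give the products of \<open>\<omega>'\<close> with itself;
for nonnegative modes \<open>\<omega>\<close> acts on \<open>\<omega>'\<close> in the same way.\<close>

lemma semi_conformal_products:
  assumes "vertex_algebra UNIV Y vac" and "\<omega>' \<in> semi_conformal UNIV Y vac \<omega>"
  shows "Y \<omega>' 1 \<omega>' = 2 *\<^sub>C \<omega>'" "Y \<omega> 1 \<omega>' = 2 *\<^sub>C \<omega>'" "Y \<omega> 2 \<omega>' = 0"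
proof -
  interpret vertex_algebra_UNIV Y vac using assms(1) by (simp add: vertex_algebra_UNIV_def)
  obtain U where U: "vertex_operator_algebra U Y vac \<omega>'" and eq: "\<And>n u. 0 \<le> n \<Longrightarrow> u \<in> U \<Longrightarrow> Y \<omega> n u = Y \<omega>' n u"
    using assms(2) unfolding semi_conformal_def by blast
  interpret U: vertex_operator_algebra U Y vac \<omega>' by fact
  obtain c where c: "\<And>m n. Y \<omega>' (m + 1) (Y \<omega>' (n + 1) vac) - Y \<omega>' (n + 1) (Y \<omega>' (m + 1) vac) =
      of_int (m - n) *\<^sub>C Y \<omega>' (m + n + 1) vac
        + (if m + n = 0 then (of_int (m ^ 3 - m) / 12 * c) *\<^sub>C vac else 0)"
    using U.virasoro U.vac_closed by blast
  show 1: "Y \<omega>' 1 \<omega>' = 2 *\<^sub>C \<omega>'"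
    using c[of 0 "- 2"] by (simp add: creation' creation_nonneg' Y_right_simps)
  have 2: "Y \<omega>' 2 \<omega>' = 0"
    using c[of 1 "- 2"] by (simp add: creation' creation_nonneg' Y_right_simps)
  show "Y \<omega> 1 \<omega>' = 2 *\<^sub>C \<omega>'" "Y \<omega> 2 \<omega>' = 0"
    using eq[of 1 \<omega>'] eq[of 2 \<omega>'] U.conformal_closed 1 2 by simp_all
qed

theorem theorem1p6:
  fixes B :: "'h::complex_vector \<Rightarrow> 'h \<Rightarrow> complex"
    and d :: nat
    and e :: "nat \<Rightarrow> 'h"
    and Y :: "'v::complex_vector \<Rightarrow> int \<Rightarrow> 'v \<Rightarrow> 'v"
    and vac :: 'v
    and act :: "'h affine \<Rightarrow> 'v \<Rightarrow> 'v"
    and h :: 'h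
    and \<omega>' :: 'v
  defines "\<omega>h \<equiv> omega_vec e d act vac h"
  defines "A \<equiv> A_map B e d act vac \<omega>'"
  defines "gen \<equiv> generated_subalgebra (UNIV :: 'v set) Y vac"
  defines "Com \<equiv> commutant (UNIV :: 'v set) Y"
  defines "V_Im \<equiv> gen ((\<lambda>u. act (loop u (-1)) vac) ` range A)"
  defines "V_Ker \<equiv> gen ((\<lambda>u. act (loop u (-1)) vac) ` {u. A u = 0})"
  assumes "cdim (UNIV :: 'h set) = d"
    and "bilinear_form B" and "symmetric_form B" and "nondegenerate_on UNIV B"
    and "orthonormal_basis B d e"
    and "heisenberg_vertex_algebra UNIV B UNIV Y vac act"
    and "\<omega>' \<in> semi_conformal UNIV Y vac \<omega>h"
  shows
    "(heisenberg_vertex_algebra (range A) B V_Im Y vac act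
        \<and> vertex_operator_algebra V_Im Y vac \<omega>'
        \<and> V_Im = Com (gen {\<omega>h - \<omega>'})
      \<and> heisenberg_vertex_algebra {u. A u = 0} B V_Ker Y vac act
        \<and> vertex_operator_algebra V_Ker Y vac (\<omega>h - \<omega>')
        \<and> V_Ker = Com (gen {\<omega>'}))
   \<and> (vertex_operator_algebra (Com V_Ker) Y vac \<omega>' \<and> Com V_Ker = V_Im
      \<and> vertex_operator_algebra (Com V_Im) Y vac (\<omega>h - \<omega>') \<and> Com V_Im = V_Ker)
   \<and> (vertex_operator_algebra (Com (gen {\<omega>'})) Y vac (\<omega>h - \<omega>')
      \<and> vertex_operator_algebra (Com (Com (gen {\<omega>'}))) Y vac \<omega>'
      \<and> voa_isomorphic UNIV Y vac \<omega>h
          (tensor_space (Com (gen {\<omega>'})) (Com (Com (gen {\<omega>'}))))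
          (tensor_Y (Com (gen {\<omega>'})) Y (Com (Com (gen {\<omega>'}))) Y)
          (vac \<otimes>\<^sub>C vac)
          ((\<omega>h - \<omega>') \<otimes>\<^sub>C vac + vac \<otimes>\<^sub>C \<omega>'))"
proof -
  interpret heisenberg_setup B d e Y vac act h
    using assms(8-12) by (intro heisenberg_setup.intro)
  have \<omega>h: "\<omega>h = omega (\<lambda>u. u)" by (simp add: \<omega>h_def omega_id)
  have \<omega>': "Y \<omega>' 1 \<omega>' = 2 *\<^sub>C \<omega>'" "Y (omega (\<lambda>u. u)) 1 \<omega>' = 2 *\<^sub>C \<omega>'" "Y (omega (\<lambda>u. u)) 2 \<omega>' = 0"
    using semi_conformal_products[OF vertex_algebra_axioms assms(13)] by (simp_all add: \<omega>h)
  obtain b where qb: "quadratic_vector A b \<omega>'"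
    using A_map_quadratic[OF \<omega>'(2)] unfolding A_def by blast
  have q: "quadratic_vector A (A h) \<omega>'"
    using qb quadratic_vector_linear_part[OF qb \<omega>'(3)] by simp
  interpret Im: heisenberg_projection B d e Y vac act h A
  proof unfold_locales
    show "A (u + v) = A u + A v" "A (c *\<^sub>C u) = c *\<^sub>C A u" for u v c
      unfolding A_def by (simp_all only: clinear_add[OF clinear_A_map] clinear_scale[OF clinear_A_map])
    show "A (A u) = A u" for u by (rule quadratic_vector_idempotent[OF q \<omega>'(1)])
    show "B (A u) v = B u (A v)" for u v by (rule quadratic_vector_adjoint[OF q])
  qed
  let ?Q = "\<lambda>u. u - A u"
  interpret Ker: heisenberg_projection B d e Y vac act h ?Q by (rule Im.complement)
  have ker: "{u. A u = 0} = range ?Q" using Im.range_complement by blast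
  have omega_A: "\<omega>' = omega A"
    by (rule quadratic_vector_unique[OF q Im.omega_quadratic \<omega>'(2) Im.omega_weight_two])
  have omega_Q: "\<omega>h - \<omega>' = omega ?Q"
  proof (rule quadratic_vector_unique[OF _ Ker.omega_quadratic _ Ker.omega_weight_two])
    show "quadratic_vector ?Q (?Q h) (\<omega>h - \<omega>')"
      using q id.omega_quadratic unfolding quadratic_vector_def \<omega>h
      by (simp add: J_right_simps J_left_simps B_simps right_diff_distrib
          complex_vector.scale_left_diff_distrib)
    show "Y (omega (\<lambda>u. u)) 1 (\<omega>h - \<omega>') = 2 *\<^sub>C (\<omega>h - \<omega>')"
      using \<omega>'(2) id.omega_OPE(2)
      by (simp add: \<omega>h Y_right_simps complex_vector.scale_right_diff_distrib)
  qed
  have V_Im: "V_Im = image_algebra A" by (simp add: V_Im_def gen_def image_algebra_def)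
  have V_Ker: "V_Ker = image_algebra ?Q" by (simp add: V_Ker_def gen_def image_algebra_def ker)
  have com: "Com (gen {\<omega>h - \<omega>'}) = image_algebra A" "Com (gen {\<omega>'}) = image_algebra ?Q" "Com (image_algebra ?Q) = image_algebra A" "Com (image_algebra A) = image_algebra ?Q"
    using Im.image_algebra_eq_commutant_omega Im.image_algebra_eq_commutant Ker.image_algebra_eq_commutant_omega Ker.image_algebra_eq_commutant
    by (simp_all add: Com_def gen_def omega_Q flip: omega_A)
  have voa: "vertex_operator_algebra (image_algebra A) Y vac \<omega>'" "vertex_operator_algebra (image_algebra ?Q) Y vac (\<omega>h - \<omega>')"
    using Im.vertex_operator_algebra_image_algebra Ker.vertex_operator_algebra_image_algebra omega_A omega_Q by metis+
  have "voa_isomorphic UNIV Y vac ((\<omega>h - \<omega>') + \<omega>') (tensor_space (image_algebra ?Q) (image_algebra A)) (tensor_Y (image_algebra ?Q) Y (image_algebra A) Y)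
     (vac \<otimes>\<^sub>C vac) ((\<omega>h - \<omega>') \<otimes>\<^sub>C vac + vac \<otimes>\<^sub>C \<omega>')"
  proof (rule tensor_decomposition)
    show "subalg (image_algebra ?Q)" "subalg (image_algebra A)" unfolding image_algebra_def by (rule subalg_gen)+
    show "\<omega>h - \<omega>' \<in> image_algebra ?Q" unfolding omega_Q by (rule Ker.omega_in_image_algebra)
    show "\<omega>' \<in> image_algebra A" using Im.omega_in_image_algebra by (simp only: omega_A)
    show "vertex_operator_algebra UNIV Y vac (\<omega>h - \<omega>' + \<omega>')"
      using vertex_operator_algebra_UNIV by (simp add: \<omega>h)
  qed (use Im.complement_commutes Im.multiply_inj Im.multiply_surj in auto)
  then show ?thesis
    unfolding com V_Im V_Ker using voa Im.heisenberg_vertex_algebra_image_algebra Ker.heisenberg_vertex_algebra_image_algebra ker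
    by (simp add: com)
qed

end
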